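(* Let $0\le c<a=b=p$. For every $r\ge\frac p2$, static quantize-map-forward (with equal listening and transmit times) is optimal on the half-duplex $(a,b,c)$-relay channel; that is, its diversity gain at multiplexing gain $r$ equals the optimal diversity-multiplexing tradeoff $d^*_{(p,p,c)}(r)$.
   Context: Channel. For $a,b,c\ge 0$ and $\rho>1$, the half-duplex $(a,b,c)$-relay channel has a source S, relay R, destination D, each with one antenna. The gains of the S-R, R-D, S-D links are $h_{sr}\rho^{a/2},h_{rd}\rho^{b/2},h_{sd}\rho^{c/2}$ with $h_{sr},h_{rd},h_{sd}$ i.i.d. $\mathcal{CN}(0,1)$, constant over a codeword (quasi-static fading) and independent across codewords. At times when the relay listens, $y_r=h_{sr}\rho^{a/2}x_s+z_r$ and $y_d=h_{sd}\rho^{c/2}x_s+z_d$; at times when the relay transmits, $y_r=0$ and $y_d=h_{sd}\rho^{c/2}x_s+h_{rd}\rho^{b/2}x_r+z_d$. Noises are i.i.d. $\mathcal{CN}(0,1)$ over time and independent across nodes; $x_s,x_r$ satisfy a unit average power constraint; the relay is causal. Codeword lengths may be taken arbitrarily large. Receive CSI: the source knows no channel realization; the relay knows only $h_{sr}$ (its listen/transmit schedule may be random and may depend on $h_{sr}$ and its received signals); the destination knows all realizations. All nodes know $a,b,c,\rho,r$. DMT. A family of codes indexed by $\rho$, with rates $R(\rho)$ and error probabilities $P_e(\rho)$ averaged over fading and noise, achieves multiplexing gain $r$ and diversity gain $d$ if $\lim_{\rho\to\infty}R(\rho)/\log\rho=r$ and $\lim_{\rho\to\infty}\log P_e(\rho)/\log\rho=-d$.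 $d^*_{(a,b,c)}(r)$ is the supremum of diversity gains achievable at multiplexing gain $r$. Static quantize-map-forward (QMF): the relay listens during the first half of the block, quantizes its received signal at noise level, maps it to a random Gaussian codeword, and transmits that in the second half, regardless of the channel realizations. The rate $R_{QMF}$ it supports for given channel realizations satisfies $C-\kappa\le R_{QMF}\le C$, where $\kappa$ is a constant independent of $\rho$ and of the realizations, and $C$ is the value at $t=\frac12$ of $$\min\Big\{t\log(1+|h_{sr}|^2\rho^a+|h_{sd}|^2\rho^c)+(1-t)\log(1+|h_{sd}|^2\rho^c),\ t\log(1+|h_{sd}|^2\rho^c)+(1-t)\log\big(1+(|h_{rd}|\rho^{b/2}+|h_{sd}|\rho^{c/2})^2\big)\Big\}.$$ Its diversity gain is the exponent of the probability that $R_{QMF}\le R(\rho)$. *)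

theory Defs
  imports "HOL-Probability.Probability"
begin

section \<open>Fading and noise\<close>

text \<open>Circularly symmetric complex Gaussian \<open>CN(0,1)\<close>: its density on the plane is
  \<open>exp (-|z|^2) / pi\<close>, i.e. variance 1/2 per real dimension.\<close>

definition cnormal :: "complex measure" where
  "cnormal = density lborel (\<lambda>z. ennreal (exp (- (cmod z)\<^sup>2) / pi))"

text \<open>A realization is the triple \<open>(h\<^sub>s\<^sub>r, h\<^sub>r\<^sub>d, h\<^sub>s\<^sub>d)\<close>.\<close>

type_synonym gains = "complex \<times> complex \<times> complex"

definition fading :: "gains measure" where
  "fading = cnormal \<Otimes>\<^sub>M (cnormal \<Otimes>\<^sub>M cnormal)"

section \<open>Codes for the half-duplex relay channel\<close>

text \<open>
  Symbol sequences are functions on the natural numbers, of which the indices below the block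
  length matter. At time \<open>i\<close> the relay sees \<open>(h\<^sub>s\<^sub>r, u, y)\<close>, where \<open>u\<close> is its private
  randomness (uniform on the unit interval) and \<open>y\<close> is the sequence of its past received symbols;
  \<open>relay_sends\<close> tells whether it transmits (rather than listens) and \<open>relay_sym\<close> which symbol it
  then transmits. The destination sees all gains and its received sequence, but not \<open>u\<close>.
\<close>

record relay_code =
  blocklen :: nat
  nmsg :: nat
  enc :: "nat \<Rightarrow> nat \<Rightarrow> complex"
  relay_sends :: "nat \<Rightarrow> complex \<times> real \<times> (nat \<Rightarrow> complex) \<Rightarrow> bool"
  relay_sym :: "nat \<Rightarrow> complex \<times> real \<times> (nat \<Rightarrow> complex) \<Rightarrow> complex"
  decode :: "gains \<times> (nat \<Rightarrow> complex) \<Rightarrow> nat"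

text \<open>
  \<open>relay_hist a \<rho> K h\<^sub>s\<^sub>r u w z i\<close> is the sequence received by the relay up to time \<open>i\<close>
  (exclusive) when message \<open>w\<close> is sent and \<open>z\<close> is the noise at the relay. It vanishes at all indices
  from \<open>i\<close> on, so a relay function applied to it is causal.
\<close>

primrec relay_hist ::
  "real \<Rightarrow> real \<Rightarrow> relay_code \<Rightarrow> complex \<Rightarrow> real \<Rightarrow> nat \<Rightarrow> (nat \<Rightarrow> complex) \<Rightarrow> nat \<Rightarrow> (nat \<Rightarrow> complex)"
where
  "relay_hist a \<rho> K hsr u w z 0 = (\<lambda>_. 0)"
| "relay_hist a \<rho> K hsr u w z (Suc i) =
     (let y = relay_hist a \<rho> K hsr u w z i in
      y(i := (if relay_sends K i (hsr, u, y) then 0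
              else hsr * of_real (\<rho> powr (a / 2)) * enc K w i + z i)))"

definition relay_input ::
  "real \<Rightarrow> real \<Rightarrow> relay_code \<Rightarrow> complex \<Rightarrow> real \<Rightarrow> nat \<Rightarrow> (nat \<Rightarrow> complex) \<Rightarrow> nat \<Rightarrow> complex"
where
  "relay_input a \<rho> K hsr u w z i =
     (let s = (hsr, u, relay_hist a \<rho> K hsr u w z i) in
      if relay_sends K i s then relay_sym K i s else 0)"

definition dest_output ::
  "real \<Rightarrow> real \<Rightarrow> real \<Rightarrow> real \<Rightarrow> relay_code \<Rightarrow> gains \<Rightarrow> real \<Rightarrow> nat \<Rightarrow>
   (nat \<Rightarrow> complex) \<Rightarrow> (nat \<Rightarrow> complex) \<Rightarrow> (nat \<Rightarrow> complex)"
where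
  "dest_output a b c \<rho> K = (\<lambda>(hsr, hrd, hsd) u w zr zd i.
     if i < blocklen K then
       hsd * of_real (\<rho> powr (c / 2)) * enc K w i
       + hrd * of_real (\<rho> powr (b / 2)) * relay_input a \<rho> K hsr u w zr i
       + zd i
     else 0)"

text \<open>The power constraint is imposed on every transmitted block, for every realization of the
  fading, of the relay's randomness and of the noise.\<close>

definition relay_code_ok :: "real \<Rightarrow> real \<Rightarrow> relay_code \<Rightarrow> bool" where
  "relay_code_ok a \<rho> K \<longleftrightarrow>
     blocklen K > 0 \<and> nmsg K > 0 \<and>
     (\<forall>i. relay_sends K i \<in> borel \<rightarrow>\<^sub>M count_space UNIV) \<and>
     (\<forall>i. relay_sym K i \<in> borel \<rightarrow>\<^sub>M borel) \<and>
     decode K \<in> borel \<rightarrow>\<^sub>M count_space UNIV \<and>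
     (\<forall>w<nmsg K. (\<Sum>i<blocklen K. (cmod (enc K w i))\<^sup>2) / real (blocklen K) \<le> 1) \<and>
     (\<forall>hsr. \<forall>u\<in>{0..1}. \<forall>w<nmsg K. \<forall>z.
        (\<Sum>i<blocklen K. (cmod (relay_input a \<rho> K hsr u w z i))\<^sup>2) / real (blocklen K) \<le> 1)"

definition code_rate :: "relay_code \<Rightarrow> real" where
  "code_rate K = ln (real (nmsg K)) / real (blocklen K)"

definition local_randomness :: "nat \<Rightarrow> (real \<times> (nat \<Rightarrow> complex) \<times> (nat \<Rightarrow> complex)) measure" where
  "local_randomness n =
     uniform_measure lborel {0..1} \<Otimes>\<^sub>M (PiM {..<n} (\<lambda>_. cnormal) \<Otimes>\<^sub>M PiM {..<n} (\<lambda>_. cnormal))"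

text \<open>Error probability given the gains, for a uniformly distributed message.\<close>

definition cond_error :: "real \<Rightarrow> real \<Rightarrow> real \<Rightarrow> real \<Rightarrow> relay_code \<Rightarrow> gains \<Rightarrow> real" where
  "cond_error a b c \<rho> K h =
     (\<Sum>w<nmsg K. measure (local_randomness (blocklen K))
        {x \<in> space (local_randomness (blocklen K)).
           case x of (u, zr, zd) \<Rightarrow> decode K (h, dest_output a b c \<rho> K h u w zr zd) \<noteq> w})
     / real (nmsg K)"

definition error_prob :: "real \<Rightarrow> real \<Rightarrow> real \<Rightarrow> real \<Rightarrow> relay_code \<Rightarrow> real" where
  "error_prob a b c \<rho> K = (\<integral>h. cond_error a b c \<rho> K h \<partial>fading)"

section \<open>Diversity-multiplexing tradeoff\<close>

text \<open>\<open>ln 0\<close> is a junk value in the reals; here \<open>log 0 = -\<infinity>\<close>, so that a vanishing probability has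
  diversity gain \<open>\<infinity>\<close>.\<close>

definition elog :: "real \<Rightarrow> ereal" where
  "elog x = (if x = 0 then - \<infinity> else ereal (ln x))"

definition has_diversity_gain :: "(real \<Rightarrow> real) \<Rightarrow> ereal \<Rightarrow> bool" where
  "has_diversity_gain P d \<longleftrightarrow> ((\<lambda>\<rho>. elog (P \<rho>) / ereal (ln \<rho>)) \<longlongrightarrow> - d) at_top"

definition has_multiplexing_gain :: "(real \<Rightarrow> real) \<Rightarrow> real \<Rightarrow> bool" where
  "has_multiplexing_gain R r \<longleftrightarrow> ((\<lambda>\<rho>. R \<rho> / ln \<rho>) \<longlongrightarrow> r) at_top"

definition achieves_dmt :: "real \<Rightarrow> real \<Rightarrow> real \<Rightarrow> real \<Rightarrow> ereal \<Rightarrow> bool" where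
  "achieves_dmt a b c r d \<longleftrightarrow>
     (\<exists>K :: real \<Rightarrow> relay_code.
        (\<forall>\<rho>>1. relay_code_ok a \<rho> (K \<rho>)) \<and>
        has_multiplexing_gain (\<lambda>\<rho>. code_rate (K \<rho>)) r \<and>
        has_diversity_gain (\<lambda>\<rho>. error_prob a b c \<rho> (K \<rho>)) d)"

definition optimal_dmt :: "real \<Rightarrow> real \<Rightarrow> real \<Rightarrow> real \<Rightarrow> ereal" where
  "optimal_dmt a b c r = Sup {d. achieves_dmt a b c r d}"

section \<open>Static quantize-map-forward\<close>

text \<open>
  The noise has unit variance, so quantizing at noise level is rounding the real and imaginary parts
  to the nearest integers. A relay codebook assigns to every quantized sequence \<open>q\<close> the codeword
  \<open>\<lambda>i. F (q, i)\<close>; its entries are drawn i.i.d. \<open>CN(0,1)\<close>.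
\<close>

type_synonym relay_codebook = "(int \<times> int) list \<times> nat \<Rightarrow> complex"

definition quantize :: "nat \<Rightarrow> (nat \<Rightarrow> complex) \<Rightarrow> (int \<times> int) list" where
  "quantize m y = map (\<lambda>i. (round (Re (y i)), round (Im (y i)))) [0..<m]"

definition gaussian_codebook :: "relay_codebook measure" where
  "gaussian_codebook = PiM UNIV (\<lambda>_. cnormal)"

text \<open>The decoder may use the relay codebook, which is revealed to it before communication.\<close>

record qmf_scheme =
  half_len :: nat
  qmf_nmsg :: nat
  qmf_enc :: "nat \<Rightarrow> nat \<Rightarrow> complex"
  qmf_decode :: "relay_codebook \<times> gains \<times> (nat \<Rightarrow> complex) \<Rightarrow> nat"

text \<open>The relay occupies only half of the block of length \<open>2 m\<close>, so a Gaussian codeword of \<open>m\<close>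
  symbols violates the power constraint with probability tending to 0; such a codeword is replaced
  by zero.\<close>

definition relay_codeword :: "nat \<Rightarrow> relay_codebook \<Rightarrow> (int \<times> int) list \<Rightarrow> nat \<Rightarrow> complex" where
  "relay_codeword m F q i =
     (if (\<Sum>j<m. (cmod (F (q, j)))\<^sup>2) \<le> 2 * real m then F (q, i) else 0)"

definition qmf_code :: "qmf_scheme \<Rightarrow> relay_codebook \<Rightarrow> relay_code" where
  "qmf_code Q F =
     \<lparr> blocklen = 2 * half_len Q,
       nmsg = qmf_nmsg Q,
       enc = qmf_enc Q,
       relay_sends = (\<lambda>i _. half_len Q \<le> i),
       relay_sym = (\<lambda>i (_, _, y).
         relay_codeword (half_len Q) F (quantize (half_len Q) y) (i - half_len Q)),
       decode = (\<lambda>(h, y). qmf_decode Q (F, h, y)) \<rparr>"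

definition qmf_scheme_ok :: "qmf_scheme \<Rightarrow> bool" where
  "qmf_scheme_ok Q \<longleftrightarrow>
     half_len Q > 0 \<and> qmf_nmsg Q > 0 \<and>
     (\<forall>w<qmf_nmsg Q. (\<Sum>i<2 * half_len Q. (cmod (qmf_enc Q w i))\<^sup>2) / real (2 * half_len Q) \<le> 1) \<and>
     qmf_decode Q \<in> borel \<rightarrow>\<^sub>M count_space UNIV"

definition qmf_rate :: "qmf_scheme \<Rightarrow> real" where
  "qmf_rate Q = ln (real (qmf_nmsg Q)) / real (2 * half_len Q)"

definition qmf_cond_error :: "real \<Rightarrow> real \<Rightarrow> real \<Rightarrow> real \<Rightarrow> qmf_scheme \<Rightarrow> gains \<Rightarrow> real" where
  "qmf_cond_error a b c \<rho> Q h = (\<integral>F. cond_error a b c \<rho> (qmf_code Q F) h \<partial>gaussian_codebook)"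

text \<open>
  \<open>S \<rho> h\<close> is a rate that static QMF supports at the realization \<open>h\<close>. The schemes are chosen
  before \<open>h\<close> is drawn: one sequence of schemes of rate tending to \<open>R\<close> and of growing block length
  has vanishing error probability at (almost) all realizations \<open>h\<close> with \<open>R < S \<rho> h\<close>.
\<close>

definition qmf_supports :: "real \<Rightarrow> real \<Rightarrow> real \<Rightarrow> (real \<Rightarrow> gains \<Rightarrow> real) \<Rightarrow> bool" where
  "qmf_supports a b c S \<longleftrightarrow>
     (\<forall>\<rho>>1. \<forall>R\<ge>0. \<exists>Q :: nat \<Rightarrow> qmf_scheme.
        (\<forall>k. qmf_scheme_ok (Q k)) \<and>
        filterlim (\<lambda>k. half_len (Q k)) at_top sequentially \<and>
        (\<lambda>k. qmf_rate (Q k)) \<longlonglongrightarrow> R \<and>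
        (AE h in fading. R < S \<rho> h \<longrightarrow> (\<lambda>k. qmf_cond_error a b c \<rho> (Q k) h) \<longlonglongrightarrow> 0))"

definition cutset_rate :: "real \<Rightarrow> real \<Rightarrow> real \<Rightarrow> real \<Rightarrow> real \<Rightarrow> gains \<Rightarrow> real" where
  "cutset_rate a b c t \<rho> = (\<lambda>(hsr, hrd, hsd).
     min (t * ln (1 + (cmod hsr)\<^sup>2 * \<rho> powr a + (cmod hsd)\<^sup>2 * \<rho> powr c)
            + (1 - t) * ln (1 + (cmod hsd)\<^sup>2 * \<rho> powr c))
         (t * ln (1 + (cmod hsd)\<^sup>2 * \<rho> powr c)
            + (1 - t) * ln (1 + (cmod hrd * \<rho> powr (b / 2) + cmod hsd * \<rho> powr (c / 2))\<^sup>2)))"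

text \<open>\<open>S\<close> is the rate \<open>R\<^sub>Q\<^sub>M\<^sub>F\<close> supported by static QMF, within a constant \<open>\<kappa>\<close> of
  the cut-set value with equal listening and transmit times.\<close>

definition is_qmf_rate :: "real \<Rightarrow> real \<Rightarrow> real \<Rightarrow> (real \<Rightarrow> gains \<Rightarrow> real) \<Rightarrow> bool" where
  "is_qmf_rate a b c S \<longleftrightarrow>
     qmf_supports a b c S \<and>
     (\<forall>\<rho>>1. S \<rho> \<in> borel_measurable borel) \<and>
     (\<exists>\<kappa>. \<forall>\<rho>>1. \<forall>h. cutset_rate a b c (1/2) \<rho> h - \<kappa> \<le> S \<rho> h \<and>
                      S \<rho> h \<le> cutset_rate a b c (1/2) \<rho> h)"

end

theory Submission
  imports Defs
begin

text \<open>
  Put \<open>d = max 0 (p + c - 2 r)\<close>; both sides have diversity gain \<open>d\<close>.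

  Converse. Let \<open>L\<close> be the random set of times at which the relay listens, \<open>n\<close> the block length,
  and suppose that the relay links have strength about \<open>\<rho>\<^sup>A\<close>, the direct link at most \<open>\<rho>\<^sup>C\<close>. If
  \<open>2 |L| \<le> n\<close>, giving the relay's observations to the destination lets at most
  \<open>|L| A + (n - |L|) C \<le> n (A + C) / 2\<close> through (in units of \<open>ln \<rho>\<close>); if \<open>2 |L| \<ge> n\<close>, a source
  and a relay that cooperate perfectly reach at most \<open>(n - |L|) A + |L| C \<le> n (A + C) / 2\<close>. So no schedule
  beats equal times. Each bound is a change of measure: the law of the outputs given a message is
  dominated by \<open>(const * \<rho> powr ((A + C) / 2)) ^ n\<close> times a probability measure not depending on the
  message, and the decoding regions are disjoint. Hence the error probability is at least \<open>1/2\<close>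
  whenever \<open>A + C < 2 r\<close>, which has probability about \<open>\<rho> powr (- d)\<close>.

  Achievability. Up to constants, an outage of static QMF forces \<open>|h\<^sub>s\<^sub>r|\<^sup>2 |h\<^sub>s\<^sub>d|\<^sup>2\<close> or
  \<open>|h\<^sub>r\<^sub>d|\<^sup>2 |h\<^sub>s\<^sub>d|\<^sup>2\<close> below \<open>\<rho> powr (2 r - p - c)\<close>, which has probability about \<open>\<rho> powr (- d)\<close>.
  Averaging over the relay codebook then yields a single code at each \<open>\<rho>\<close> with that error probability.
\<close>

section \<open>Domination of shifted Gaussian vectors\<close>

text \<open>The schedule is the obstacle: it depends on the message and on the relay noise, so
  neither cut can be evaluated for one fixed listening set. Both cuts are bounded by sums over the
  at most 2 ^ n possible sets. This is affordable because any factor const ^ n is beaten by \<rho>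
  powr (n * \<epsilon>) once \<rho> is large, for all block lengths n at once. For the same reason
  no exact capacity enters: comparing densities pointwise, up to a constant factor per symbol, is
  enough.

  The two cuts are treated differently. For the cooperative cut the relay noise is frozen, and the
  relay's input becomes a second deterministic codeword. For the other cut the relay's observation
  itself carries information, so its noise has to be integrated and the comparison law must describe
  relay and destination jointly.

  A diversity gain is a limit, not a bound. To show that d is achieved, the error of the constructed
  codes must therefore also be bounded from below; the converse supplies this as well.\<close>

definition gauss :: "real \<Rightarrow> complex measure" where
  "gauss v = density lborel (\<lambda>z. ennreal (exp (- (cmod z)\<^sup>2 / v) / (pi * v)))"

lemma cnormal_eq_gauss: "cnormal = gauss 1"
  by (simp add: cnormal_def gauss_def)

lemma sets_gauss [simp, measurable_cong]: "sets (gauss v) = sets borel"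
  by (simp add: gauss_def)

lemma space_gauss [simp]: "space (gauss v) = UNIV"
  by (simp add: gauss_def)

lemma sets_cnormal [simp, measurable_cong]: "sets cnormal = sets borel"
  by (simp add: cnormal_def)

lemma space_cnormal [simp]: "space cnormal = UNIV"
  by (simp add: cnormal_def)

lemma prob_space_gauss:
  assumes "v > 0"
  shows "prob_space (gauss v)"
proof
  \<comment> \<open>A circular complex Gaussian of variance \<open>v\<close> has independent real
    and imaginary parts of variance v / 2, so the density is a product over the two basis
    directions.\<close>
  define s where "s = sqrt (v / 2)"
  have s: "s > 0" "2 * s\<^sup>2 = v" using assms by (auto simp: s_def)
  have "emeasure (gauss v) (space (gauss v)) =
      (\<integral>\<^sup>+ (z::complex). ennreal (exp (- (cmod z)\<^sup>2 / v) / (pi * v)) \<partial>lborel)"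
    by (simp add: gauss_def emeasure_density)
  also have "\<dots> = (\<integral>\<^sup>+ (z::complex). ennreal (\<Prod>b\<in>Basis. normal_density 0 s (z \<bullet> b)) \<partial>lborel)"
  proof (intro nn_integral_cong arg_cong[where f = ennreal])
    fix z :: complex
    have "(\<Prod>b\<in>Basis. normal_density 0 s (z \<bullet> b)) =
        exp (- (Re z)\<^sup>2 / v) * exp (- (Im z)\<^sup>2 / v) / (sqrt (pi * v) * sqrt (pi * v))"
      using s by (simp add: Basis_complex_def normal_density_def algebra_simps inner_complex_def
          complex_eq_iff)
    also have "\<dots> = exp (- (cmod z)\<^sup>2 / v) / (pi * v)"
      using assms by (simp add: exp_add[symmetric] cmod_power2 add_divide_distrib diff_divide_distrib)
    finally show "exp (- (cmod z)\<^sup>2 / v) / (pi * v) = (\<Prod>b\<in>Basis. normal_density 0 s (z \<bullet> b))" ..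
  qed
  also have "\<dots> = (\<integral>\<^sup>+ (z::complex). (\<Prod>b\<in>Basis. ennreal (normal_density 0 s (z \<bullet> b))) \<partial>lborel)"
    by (simp add: prod_ennreal)
  also have "\<dots> = (\<Prod>b\<in>(Basis::complex set). (\<integral>\<^sup>+ x. ennreal (normal_density 0 s x) \<partial>lborel))"
    by (subst nn_integral_lborel_prod) auto
  also have "(\<integral>\<^sup>+ x. ennreal (normal_density 0 s x) \<partial>lborel) = 1"
    using s by (subst nn_integral_eq_integral) (auto simp: normal_density_nonneg)
  finally show "emeasure (gauss v) (space (gauss v)) = 1" by simp
qed

lemma prob_space_cnormal: "prob_space cnormal"
  using prob_space_gauss[of 1] by (simp add: cnormal_eq_gauss)

text \<open>Bounding both sides pointwise against a flatter centered Gaussian replaces any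
  typicality argument for the noise.\<close>

lemma nn_integral_gauss_shift_le:
  fixes g :: "complex \<Rightarrow> ennreal"
  assumes [measurable]: "g \<in> borel_measurable borel"
    and v: "v > 0" and "t \<ge> 0" and le: "2 / v \<le> 1 - t"
  shows "(\<integral>\<^sup>+ z. ennreal (exp (t * (cmod z)\<^sup>2)) * g (z + \<mu>) \<partial>cnormal) \<le>
    ennreal (v * exp (2 * (cmod \<mu>)\<^sup>2 / v)) * (\<integral>\<^sup>+ y. g y \<partial>gauss v)"
proof -
  have "(\<integral>\<^sup>+ z. ennreal (exp (t * (cmod z)\<^sup>2)) * g (z + \<mu>) \<partial>cnormal) =
      (\<integral>\<^sup>+ z. ennreal (exp (- (cmod z)\<^sup>2) / pi) * (ennreal (exp (t * (cmod z)\<^sup>2)) * g (z + \<mu>)) \<partial>lborel)"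
    by (simp add: cnormal_def nn_integral_density)
  also have "\<dots> \<le> (\<integral>\<^sup>+ z. ennreal (v * exp (2 * (cmod \<mu>)\<^sup>2 / v)) *
      (ennreal (exp (- (cmod (\<mu> + z))\<^sup>2 / v) / (pi * v)) * g (\<mu> + z)) \<partial>lborel)"
  proof (rule nn_integral_mono)
    fix z :: complex
    \<comment> \<open>Splitting the squared norm costs a factor 2 on both parts. The noise part 2 /
      v * |z|^2 fits into the share 1 - t of the Gaussian exponent that the weight leaves free; the
      mean part becomes the constant in front.\<close>
    have "cmod (\<mu> + z) \<le> cmod \<mu> + cmod z" by (rule norm_triangle_ineq)
    then have "(cmod (\<mu> + z))\<^sup>2 \<le> (cmod \<mu> + cmod z)\<^sup>2" by (intro power_mono) auto
    also have "\<dots> \<le> 2 * (cmod \<mu>)\<^sup>2 + 2 * (cmod z)\<^sup>2"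
      using sum_squares_bound[of "cmod \<mu>" "cmod z"] by (simp add: power2_sum)
    finally have "(cmod (\<mu> + z))\<^sup>2 / v \<le> (2 * (cmod \<mu>)\<^sup>2 + 2 * (cmod z)\<^sup>2) / v"
      using v by (intro divide_right_mono) auto
    also have "\<dots> = 2 * (cmod \<mu>)\<^sup>2 / v + 2 / v * (cmod z)\<^sup>2" by (simp add: add_divide_distrib)
    also have "\<dots> \<le> 2 * (cmod \<mu>)\<^sup>2 / v + (1 - t) * (cmod z)\<^sup>2"
      using le by (intro add_left_mono mult_right_mono) auto
    finally have "- (cmod z)\<^sup>2 + t * (cmod z)\<^sup>2 \<le>
        2 * (cmod \<mu>)\<^sup>2 / v + - (cmod (\<mu> + z))\<^sup>2 / v" by (simp add: algebra_simps)
    then have "exp (- (cmod z)\<^sup>2) * exp (t * (cmod z)\<^sup>2) \<le>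
        exp (2 * (cmod \<mu>)\<^sup>2 / v) * exp (- (cmod (\<mu> + z))\<^sup>2 / v)"
      unfolding exp_add[symmetric] by simp
    then have "exp (- (cmod z)\<^sup>2) / pi * exp (t * (cmod z)\<^sup>2) \<le>
        v * exp (2 * (cmod \<mu>)\<^sup>2 / v) * (exp (- (cmod (\<mu> + z))\<^sup>2 / v) / (pi * v))"
      using v by (simp add: field_simps)
    then have "(ennreal (exp (- (cmod z)\<^sup>2) / pi) * ennreal (exp (t * (cmod z)\<^sup>2))) * g (\<mu> + z) \<le>
        (ennreal (v * exp (2 * (cmod \<mu>)\<^sup>2 / v)) * ennreal (exp (- (cmod (\<mu> + z))\<^sup>2 / v) / (pi * v))) * g (\<mu> + z)"
      using v by (intro mult_right_mono) (auto simp del: times_divide_eq_right simp flip: ennreal_mult)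
    then show "ennreal (exp (- (cmod z)\<^sup>2) / pi) * (ennreal (exp (t * (cmod z)\<^sup>2)) * g (z + \<mu>)) \<le>
      ennreal (v * exp (2 * (cmod \<mu>)\<^sup>2 / v)) *
      (ennreal (exp (- (cmod (\<mu> + z))\<^sup>2 / v) / (pi * v)) * g (\<mu> + z))"
      by (simp only: mult.assoc add.commute)
  qed
  also have "\<dots> = ennreal (v * exp (2 * (cmod \<mu>)\<^sup>2 / v)) *
      (\<integral>\<^sup>+ z. ennreal (exp (- (cmod (\<mu> + z))\<^sup>2 / v) / (pi * v)) * g (\<mu> + z) \<partial>lborel)"
    by (rule nn_integral_cmult) auto
  also have "(\<integral>\<^sup>+ z. ennreal (exp (- (cmod (\<mu> + z))\<^sup>2 / v) / (pi * v)) * g (\<mu> + z) \<partial>lborel) =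
      (\<integral>\<^sup>+ y. ennreal (exp (- (cmod y)\<^sup>2 / v) / (pi * v)) * g y \<partial>distr lborel borel ((+) \<mu>))"
    by (subst nn_integral_distr) auto
  also have "\<dots> = (\<integral>\<^sup>+ y. g y \<partial>gauss v)"
    by (simp add: lborel_distr_plus gauss_def nn_integral_density)
  finally show ?thesis .
qed

text \<open>Domination is stable under independent products even though \<open>G\<close> couples all
  coordinates: integrate the coordinates one at a time, each time applying the one-dimensional bound
  to a section of \<open>G\<close>. The weights \<open>W\<close> are there for the relay noise,
  where an earlier integration leaves an unbounded factor behind.\<close>

lemma nn_integral_PiM_dominated:
  fixes W :: "'i \<Rightarrow> 'a \<Rightarrow> ennreal" and K :: "'i \<Rightarrow> ennreal"
  assumes "finite I"
    and M: "\<And>i. sigma_finite_measure (M i)" and N: "\<And>i. sigma_finite_measure (N i)"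
    and W: "\<And>i. i \<in> I \<Longrightarrow> W i \<in> borel_measurable (M i)"
    and \<phi>: "\<And>i. i \<in> I \<Longrightarrow> \<phi> i \<in> M i \<rightarrow>\<^sub>M N i"
    and dom: "\<And>i g. i \<in> I \<Longrightarrow> g \<in> borel_measurable (N i) \<Longrightarrow>
      (\<integral>\<^sup>+ z. W i z * g (\<phi> i z) \<partial>M i) \<le> K i * (\<integral>\<^sup>+ y. g y \<partial>N i)"
    and G: "G \<in> borel_measurable (PiM I N)"
  shows "(\<integral>\<^sup>+ z. (\<Prod>i\<in>I. W i (z i)) * G (\<lambda>i\<in>I. \<phi> i (z i)) \<partial>PiM I M) \<le>
    (\<Prod>i\<in>I. K i) * (\<integral>\<^sup>+ y. G y \<partial>PiM I N)"
  using assms(1,4-)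
proof (induction I arbitrary: G rule: finite_induct)
  case empty
  interpret PM: product_sigma_finite M using M by (simp add: product_sigma_finite_def)
  interpret PN: product_sigma_finite N using N by (simp add: product_sigma_finite_def)
  show ?case by (simp add: PiM_empty nn_integral_count_space_finite)
next
  case (insert i I)
  interpret PM: product_sigma_finite M using M by (simp add: product_sigma_finite_def)
  interpret PN: product_sigma_finite N using N by (simp add: product_sigma_finite_def)
  note [measurable] = insert.prems(1)[OF insertI2] insert.prems(1)[OF insertI1]
    insert.prems(2)[OF insertI2] insert.prems(2)[OF insertI1] insert.prems(4)
  have meas: "(\<lambda>z. (\<Prod>j\<in>insert i I. W j (z j)) * G (\<lambda>j\<in>insert i I. \<phi> j (z j)))
      \<in> borel_measurable (PiM (insert i I) M)"
  proof -
    have "(\<lambda>z. \<Prod>j\<in>insert i I. W j (z j)) \<in> borel_measurable (PiM (insert i I) M)"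
      using insert.prems(1) by (intro borel_measurable_prod_ennreal)
        (auto intro!: measurable_compose[OF measurable_component_singleton])
    moreover have "(\<lambda>z. \<lambda>j\<in>insert i I. \<phi> j (z j)) \<in> PiM (insert i I) M \<rightarrow>\<^sub>M PiM (insert i I) N"
      using insert.prems(2) by (intro measurable_restrict)
        (auto intro!: measurable_compose[OF measurable_component_singleton])
    ultimately show ?thesis
      by (intro borel_measurable_times_ennreal measurable_compose[OF _ insert.prems(4)])
  qed
  have G1: "(\<lambda>y. G (y(i := w))) \<in> borel_measurable (PiM I N)" if "w \<in> space (N i)" for w
    using that by (intro measurable_compose[OF _ insert.prems(4)] measurable_fun_upd[where J = I])
      auto
  have G2: "(\<lambda>(w, y). G (y(i := w))) \<in> borel_measurable (N i \<Otimes>\<^sub>M PiM I N)"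
    unfolding case_prod_beta
    by (intro measurable_compose[OF _ insert.prems(4)] measurable_fun_upd[where J = I]) auto
  \<comment> \<open>The function to which the one-dimensional bound at the new coordinate
    \<open>i\<close> is applied, after the induction hypothesis has replaced all other coordinates
    by their comparison law.\<close>
  define g where "g w = (\<integral>\<^sup>+ y. G (y(i := w)) \<partial>PiM I N)" for w
  have g: "g \<in> borel_measurable (N i)"
    unfolding g_def
    using sigma_finite_measure.borel_measurable_nn_integral[OF PN.sigma_finite[OF insert.hyps(1)] G2]
    by simp
  have "(\<integral>\<^sup>+ z. (\<Prod>j\<in>insert i I. W j (z j)) * G (\<lambda>j\<in>insert i I. \<phi> j (z j)) \<partial>PiM (insert i I) M) =
     (\<integral>\<^sup>+ x. (\<integral>\<^sup>+ z. (\<Prod>j\<in>insert i I. W j ((z(i := x)) j)) *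
        G (\<lambda>j\<in>insert i I. \<phi> j ((z(i := x)) j)) \<partial>PiM I M) \<partial>M i)"
    using insert.hyps meas by (rule PM.product_nn_integral_insert_rev)
  also have "\<dots> = (\<integral>\<^sup>+ x. (\<integral>\<^sup>+ z. W i x * ((\<Prod>j\<in>I. W j (z j)) *
        G ((\<lambda>j\<in>I. \<phi> j (z j))(i := \<phi> i x))) \<partial>PiM I M) \<partial>M i)"
  proof (intro nn_integral_cong)
    fix x z
    have "(\<lambda>j\<in>insert i I. \<phi> j ((z(i := x)) j)) = (\<lambda>j\<in>I. \<phi> j (z j))(i := \<phi> i x)"
      by (auto simp: fun_eq_iff)
    moreover have "(\<Prod>j\<in>insert i I. W j ((z(i := x)) j)) = W i x * (\<Prod>j\<in>I. W j (z j))"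
    proof -
      have "(\<Prod>j\<in>I. W j ((z(i := x)) j)) = (\<Prod>j\<in>I. W j (z j))"
        using insert.hyps by (intro prod.cong) auto
      then show ?thesis using insert.hyps by simp
    qed
    ultimately show "(\<Prod>j\<in>insert i I. W j ((z(i := x)) j)) *
        G (\<lambda>j\<in>insert i I. \<phi> j ((z(i := x)) j)) =
        W i x * ((\<Prod>j\<in>I. W j (z j)) * G ((\<lambda>j\<in>I. \<phi> j (z j))(i := \<phi> i x)))"
      by (simp add: mult.assoc)
  qed
  also have "\<dots> \<le> (\<integral>\<^sup>+ x. W i x * ((\<Prod>j\<in>I. K j) * g (\<phi> i x)) \<partial>M i)"
  proof (rule nn_integral_mono)
    fix x assume x: "x \<in> space (M i)"
    then have x': "\<phi> i x \<in> space (N i)"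
      using insert.prems(2)[OF insertI1] by (rule measurable_space[rotated])
    have "(\<lambda>z. (\<Prod>j\<in>I. W j (z j)) * G ((\<lambda>j\<in>I. \<phi> j (z j))(i := \<phi> i x)))
      \<in> borel_measurable (PiM I M)"
    proof -
      have 1: "(\<lambda>z. \<Prod>j\<in>I. W j (z j)) \<in> borel_measurable (PiM I M)"
        using insert.prems(1) by (intro borel_measurable_prod_ennreal)
          (auto intro!: measurable_compose[OF measurable_component_singleton])
      have "(\<lambda>z. \<lambda>j\<in>I. \<phi> j (z j)) \<in> PiM I M \<rightarrow>\<^sub>M PiM I N"
        using insert.prems(2) by (intro measurable_restrict)
          (auto intro!: measurable_compose[OF measurable_component_singleton])
      from measurable_compose[OF this G1[OF x']] 1 show ?thesis
        by (intro borel_measurable_times_ennreal) auto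
    qed
    then have "(\<integral>\<^sup>+ z. W i x * ((\<Prod>j\<in>I. W j (z j)) *
        G ((\<lambda>j\<in>I. \<phi> j (z j))(i := \<phi> i x))) \<partial>PiM I M) =
        W i x * (\<integral>\<^sup>+ z. (\<Prod>j\<in>I. W j (z j)) * G ((\<lambda>j\<in>I. \<phi> j (z j))(i := \<phi> i x)) \<partial>PiM I M)"
      by (rule nn_integral_cmult)
    also have "\<dots> \<le> W i x * ((\<Prod>j\<in>I. K j) * (\<integral>\<^sup>+ y. G (y(i := \<phi> i x)) \<partial>PiM I N))"
      by (intro mult_left_mono insert.IH insert.prems G1[OF x']) auto
    finally show "(\<integral>\<^sup>+ z. W i x * ((\<Prod>j\<in>I. W j (z j)) *
        G ((\<lambda>j\<in>I. \<phi> j (z j))(i := \<phi> i x))) \<partial>PiM I M) \<le> W i x * ((\<Prod>j\<in>I. K j) * g (\<phi> i x))"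
      by (simp add: g_def)
  qed
  also have "\<dots> = (\<Prod>j\<in>I. K j) * (\<integral>\<^sup>+ x. W i x * g (\<phi> i x) \<partial>M i)"
    using g by (subst nn_integral_cmult[symmetric]) (auto simp: mult_ac)
  also have "\<dots> \<le> (\<Prod>j\<in>I. K j) * (K i * (\<integral>\<^sup>+ w. g w \<partial>N i))"
    by (intro mult_left_mono insert.prems(3) g) auto
  also have "(\<integral>\<^sup>+ w. g w \<partial>N i) = (\<integral>\<^sup>+ y. G y \<partial>PiM (insert i I) N)"
    unfolding g_def
    using insert.hyps insert.prems(4) by (rule PN.product_nn_integral_insert_rev[symmetric])
  finally show ?case using insert.hyps by (simp add: mult_ac)
qed

section \<open>The two cuts\<close>

text \<open>This is where equal listening and transmit times emerge as extremal. At least half of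
  the factors are the smaller \<open>C\<close>; raising the surplus beyond one half to the geometric
  mean of \<open>A\<close> and \<open>C\<close> can only increase the product.\<close>

lemma prod_two_powers_le:
  fixes A C :: real
  assumes "0 \<le> C" "C \<le> A" "n \<le> 2 * k" "k \<le> n"
  shows "C ^ k * A ^ (n - k) \<le> sqrt (A * C) ^ n"
proof -
  \<comment> \<open>Square roots keep all exponents natural numbers when n is odd.\<close>
  define \<alpha> \<gamma> where "\<alpha> = sqrt A" and "\<gamma> = sqrt C"
  have g: "0 \<le> \<gamma>" "\<gamma> \<le> \<alpha>" "\<gamma>\<^sup>2 = C" "\<alpha>\<^sup>2 = A" using assms by (auto simp: \<alpha>_def \<gamma>_def)
  have "C ^ k * A ^ (n - k) = \<gamma> ^ (2 * k) * \<alpha> ^ (2 * (n - k))"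
    by (simp add: power_mult g)
  also have "2 * k = n + (2 * k - n)" using assms by simp
  also have "\<gamma> ^ (n + (2 * k - n)) * \<alpha> ^ (2 * (n - k)) =
      \<gamma> ^ n * (\<gamma> ^ (2 * k - n) * \<alpha> ^ (2 * (n - k)))" by (simp only: power_add mult.assoc)
  also have "\<dots> \<le> \<gamma> ^ n * (\<alpha> ^ (2 * k - n) * \<alpha> ^ (2 * (n - k)))"
    using g by (intro mult_left_mono mult_right_mono power_mono) auto
  also have "\<alpha> ^ (2 * k - n) * \<alpha> ^ (2 * (n - k)) = \<alpha> ^ n"
  proof -
    have "2 * k - n + 2 * (n - k) = n" using assms by simp
    then show ?thesis by (simp only: power_add[symmetric])
  qed
  also have "\<gamma> ^ n * \<alpha> ^ n = sqrt (A * C) ^ n"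
    by (simp add: \<alpha>_def \<gamma>_def real_sqrt_mult power_mult_distrib)
  finally show ?thesis .
qed

lemma prod_if_const:
  fixes c d :: real
  assumes "s \<subseteq> {..<n}"
  shows "(\<Prod>i<n. if i \<in> s then c else d) = c ^ card s * d ^ (n - card s)"
proof -
  have f: "finite s" using assms by (rule finite_subset) simp
  have "(\<Prod>i<n. if i \<in> s then c else d) = (\<Prod>i\<in>{..<n} \<inter> s. c) * (\<Prod>i\<in>{..<n} - s. d)"
    by (subst prod.If_cases) (auto simp: set_diff_eq Compl_eq Int_def)
  also have "{..<n} \<inter> s = s" using assms by auto
  finally show ?thesis using f assms by (simp add: card_Diff_subset)
qed

text \<open>Noise lives on a finite product space, whereas decoders act on infinite sequences with
  their Borel sets; this is the passage from one to the other.\<close>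

lemma measurable_extend_zero:
  fixes n :: nat
  assumes "\<And>i. i < n \<Longrightarrow> f i \<in> borel_measurable M"
  shows "(\<lambda>z i. if i < n then f i z else (0::complex)) \<in> borel_measurable M"
  proof (rule measurable_coordinatewise_then_product)
  show "(\<lambda>z. if i < n then f i z else 0) \<in> borel_measurable M" for i
    using assms by (cases "i < n") auto
qed

lemma cnormal_shift_le:
  assumes "g \<in> borel_measurable borel" "v \<ge> 2"
  shows "(\<integral>\<^sup>+ z. g (z + \<mu>) \<partial>cnormal) \<le>
    ennreal (v * exp (2 * (cmod \<mu>)\<^sup>2 / v)) * (\<integral>\<^sup>+ y. g y \<partial>gauss v)"
  using nn_integral_gauss_shift_le[of g v 0 \<mu>] assms by simp

lemma sigma_finite_cnormal: "sigma_finite_measure cnormal"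
  using prob_space_cnormal by (simp add: prob_space_imp_sigma_finite)

lemma sigma_finite_gauss: "v > 0 \<Longrightarrow> sigma_finite_measure (gauss v)"
  using prob_space_gauss by (simp add: prob_space_imp_sigma_finite)

text \<open>Source and relay are viewed as one transmitter with two given codewords \<open>x\<close>
  and \<open>q\<close>. Where the relay is silent the received strength is at most about
  \<open>C\<close>, elsewhere about \<open>A\<close>; a centered Gaussian of that variance absorbs
  the mean at a cost depending only on the symbol powers.\<close>

lemma mac_cut_dominated:
  fixes G :: "(nat \<Rightarrow> complex) \<Rightarrow> ennreal"
  assumes s: "s \<subseteq> {..<n}" "n \<le> 2 * card s"
    and AC: "4 \<le> C" "C \<le> A"
    and gd: "(cmod gd)\<^sup>2 \<le> C" and gb: "(cmod gb)\<^sup>2 \<le> A"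
    and x: "(\<Sum>i<n. (cmod (x i))\<^sup>2) \<le> real n" and q: "(\<Sum>i<n. (cmod (q i))\<^sup>2) \<le> real n"
    and q0: "\<And>i. i \<in> s \<Longrightarrow> q i = 0"
    and [measurable]: "G \<in> borel_measurable borel"
  shows "(\<integral>\<^sup>+ z. G (\<lambda>i. if i < n then gd * x i + gb * q i + z i else 0) \<partial>PiM {..<n} (\<lambda>_. cnormal)) \<le>
    ennreal ((exp 8 * sqrt (A * C)) ^ n) *
    (\<integral>\<^sup>+ y. G (\<lambda>i. if i < n then y i else 0) \<partial>PiM {..<n} (\<lambda>i. gauss (if i \<in> s then C else A)))"
proof -
  define v where "v i = (if i \<in> s then C else A)" for i
  define \<mu> where "\<mu> i = gd * x i + gb * q i" for i
  define G' where "G' y = G (\<lambda>i. if i < n then y i else 0)" for y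
  have v: "v i \<ge> 4" for i using AC by (auto simp: v_def)
  have [measurable]: "G' \<in> borel_measurable (PiM {..<n} (\<lambda>i. gauss (v i)))"
    unfolding G'_def by (intro measurable_compose[OF measurable_extend_zero]) auto
  have "(\<integral>\<^sup>+ z. (\<Prod>i<n. 1) * G' (\<lambda>i\<in>{..<n}. z i + \<mu> i) \<partial>PiM {..<n} (\<lambda>_. cnormal)) \<le>
      (\<Prod>i<n. ennreal (v i * exp (2 * (cmod (\<mu> i))\<^sup>2 / v i))) *
      (\<integral>\<^sup>+ y. G' y \<partial>PiM {..<n} (\<lambda>i. gauss (v i)))"
  proof (rule nn_integral_PiM_dominated)
    show "sigma_finite_measure (gauss (v i))" for i
      using v[of i] by (intro sigma_finite_gauss) auto
    show "(\<integral>\<^sup>+ z. 1 * g (z + \<mu> i) \<partial>cnormal) \<le>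
        ennreal (v i * exp (2 * (cmod (\<mu> i))\<^sup>2 / v i)) * (\<integral>\<^sup>+ y. g y \<partial>gauss (v i))"
      if "g \<in> borel_measurable (gauss (v i))" for i g
    proof -
      have "g \<in> borel_measurable borel" using that by (simp cong: measurable_cong_sets)
      then show ?thesis using cnormal_shift_le[of g "v i" "\<mu> i"] v[of i] by simp
    qed
  qed (auto intro: sigma_finite_cnormal)
  also have "(\<Prod>i<n. ennreal (v i * exp (2 * (cmod (\<mu> i))\<^sup>2 / v i))) =
      ennreal (\<Prod>i<n. v i * exp (2 * (cmod (\<mu> i))\<^sup>2 / v i))"
    using v by (intro prod_ennreal) (auto intro!: mult_nonneg_nonneg intro: order_trans[of 0 4])
  also have "(\<Prod>i<n. v i * exp (2 * (cmod (\<mu> i))\<^sup>2 / v i)) \<le>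
      (\<Prod>i<n. v i * exp (4 * (cmod (x i))\<^sup>2 + 4 * (cmod (q i))\<^sup>2))"
  proof (intro prod_mono conjI)
    fix i assume "i \<in> {..<n}"
    have v0: "v i > 0" using v[of i] by simp
    then show "0 \<le> v i * exp (2 * (cmod (\<mu> i))\<^sup>2 / v i)" by simp
    have "(cmod (\<mu> i))\<^sup>2 \<le> 2 * v i * ((cmod (x i))\<^sup>2 + (cmod (q i))\<^sup>2)"
    proof -
      have "cmod (\<mu> i) \<le> cmod (gd * x i) + cmod (gb * q i)"
        unfolding \<mu>_def by (rule norm_triangle_ineq)
      then have "(cmod (\<mu> i))\<^sup>2 \<le> (cmod (gd * x i) + cmod (gb * q i))\<^sup>2" by (intro power_mono) auto
      also have "\<dots> \<le> 2 * (cmod (gd * x i))\<^sup>2 + 2 * (cmod (gb * q i))\<^sup>2"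
        using sum_squares_bound[of "cmod (gd * x i)" "cmod (gb * q i)"] by (simp add: power2_sum)
      also have "\<dots> \<le> 2 * (v i * (cmod (x i))\<^sup>2) + 2 * (v i * (cmod (q i))\<^sup>2)"
      proof -
        have "(cmod gd)\<^sup>2 \<le> v i" using gd AC by (auto simp: v_def)
        then have "(cmod (gd * x i))\<^sup>2 \<le> v i * (cmod (x i))\<^sup>2"
          by (simp add: norm_mult power_mult_distrib mult_right_mono)
        moreover have "(cmod (gb * q i))\<^sup>2 \<le> v i * (cmod (q i))\<^sup>2"
          using gb q0[of i] by (cases "i \<in> s")
            (auto simp add: v_def norm_mult power_mult_distrib mult_right_mono)
        ultimately show ?thesis by simp
      qed
      finally show ?thesis by (simp add: algebra_simps)
    qed
    then have "2 * (cmod (\<mu> i))\<^sup>2 / v i \<le> 4 * (cmod (x i))\<^sup>2 + 4 * (cmod (q i))\<^sup>2"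
      using v0 by (simp add: field_simps)
    then show "v i * exp (2 * (cmod (\<mu> i))\<^sup>2 / v i) \<le>
        v i * exp (4 * (cmod (x i))\<^sup>2 + 4 * (cmod (q i))\<^sup>2)" using v0 by simp
  qed
  \<comment> \<open>The codewords now enter through their total power alone, which the constraints
    bound by n for each of the two: hence exp 8 per symbol.\<close>
  also have "\<dots> = (\<Prod>i<n. v i) * exp (4 * (\<Sum>i<n. (cmod (x i))\<^sup>2) + 4 * (\<Sum>i<n. (cmod (q i))\<^sup>2))"
    by (simp add: prod.distrib exp_sum[symmetric] sum.distrib sum_distrib_left)
  also have "(\<Prod>i<n. v i) = C ^ card s * A ^ (n - card s)"
    unfolding v_def using s(1) by (rule prod_if_const)
  also have "C ^ card s * A ^ (n - card s) *
      exp (4 * (\<Sum>i<n. (cmod (x i))\<^sup>2) + 4 * (\<Sum>i<n. (cmod (q i))\<^sup>2)) \<le>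
      sqrt (A * C) ^ n * exp (8 * real n)"
  proof (rule mult_mono)
    have "card s \<le> n" using card_mono[OF _ s(1)] by simp
    then show "C ^ card s * A ^ (n - card s) \<le> sqrt (A * C) ^ n"
      using AC s by (intro prod_two_powers_le) auto
  qed (use x q AC in auto)
  also have "\<dots> = (exp 8 * sqrt (A * C)) ^ n"
    by (simp add: power_mult_distrib exp_of_nat2_mult[symmetric])
  finally show ?thesis
    unfolding G'_def v_def[symmetric]
    by (simp add: \<mu>_def algebra_simps ennreal_leI mult_right_mono cong: if_cong)
qed

text \<open>The relay's memory before time \<open>i\<close> under a prescribed listening set.
  Prescribing the set removes the recursion in which past observations decide what is observed
  next.\<close>

definition masked :: "nat set \<Rightarrow> (nat \<Rightarrow> complex) \<Rightarrow> nat \<Rightarrow> nat \<Rightarrow> complex" where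
  "masked s y i = (\<lambda>j. if j \<in> s \<and> j < i then y j else 0)"

lemma measurable_masked:
  assumes "\<And>j. j < i \<Longrightarrow> (\<lambda>z. f z j) \<in> borel_measurable M"
  shows "(\<lambda>z. masked s (f z) i) \<in> borel_measurable M"
  unfolding masked_def
proof (rule measurable_coordinatewise_then_product)
  show "(\<lambda>z. if j \<in> s \<and> j < i then f z j else 0) \<in> borel_measurable M" for j
    using assms by (cases "j \<in> s \<and> j < i") auto
qed

lemma measurable_output_integral:
  fixes G :: "(nat \<Rightarrow> complex) \<Rightarrow> ennreal"
  assumes m: "\<And>i. i < n \<Longrightarrow> (\<lambda>y. m y i) \<in> borel_measurable N"
    and G: "G \<in> borel_measurable borel" and v: "\<And>i. v i > 0"
  shows "(\<lambda>y. \<integral>\<^sup>+ e. G (\<lambda>i. if i < n then m y i + e i else 0) \<partial>PiM {..<n} (\<lambda>i. gauss (v i)))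
    \<in> borel_measurable N"
proof -
  interpret product_sigma_finite "\<lambda>i. gauss (v i)"
    by (rule product_sigma_finite.intro) (intro sigma_finite_gauss v)
  have "(\<lambda>p. m (fst p) i) \<in> borel_measurable (N \<Otimes>\<^sub>M PiM {..<n} (\<lambda>i. gauss (v i)))" if "i < n" for i
    using m[OF that] by simp
  then have "(\<lambda>p. G (\<lambda>i. if i < n then m (fst p) i + snd p i else 0))
      \<in> borel_measurable (N \<Otimes>\<^sub>M PiM {..<n} (\<lambda>i. gauss (v i)))"
    by (intro measurable_compose[OF measurable_extend_zero G] borel_measurable_add) auto
  then show ?thesis
    by (intro sigma_finite_measure.borel_measurable_nn_integral sigma_finite)
      (auto simp: case_prod_beta)
qed

text \<open>While the relay listens, the destination's symbol is compared with \<open>\<theta>\<close> times the relay's: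
  the difference \<open>z\<^sub>d - \<theta> z\<^sub>r\<close> is of noise level, so the direct link adds nothing there.\<close>

lemma bc_cut_dominated:
  fixes G :: "(nat \<Rightarrow> complex) \<Rightarrow> ennreal" and X :: "nat \<Rightarrow> (nat \<Rightarrow> complex) \<Rightarrow> complex"
  assumes s: "s \<subseteq> {..<n}" "2 * card s \<le> n"
    and AC: "4 \<le> C" "C \<le> A"
    and gr: "(cmod gr)\<^sup>2 \<le> A" and gd: "(cmod gd)\<^sup>2 \<le> C"
    and \<theta>: "gd = \<theta> * gr" "cmod \<theta> \<le> 1"
    and x: "(\<Sum>i<n. (cmod (x i))\<^sup>2) \<le> real n"
    and X [measurable]: "\<And>i. X i \<in> borel_measurable borel"
    and G [measurable]: "G \<in> borel_measurable borel"
  shows "(\<integral>\<^sup>+ zr. \<integral>\<^sup>+ zd. G (\<lambda>i. if i < n then gd * x i +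
        (if i \<in> s then 0 else X i (masked s (\<lambda>j. gr * x j + zr j) i)) + zd i else 0)
        \<partial>PiM {..<n} (\<lambda>_. cnormal) \<partial>PiM {..<n} (\<lambda>_. cnormal)) \<le>
    ennreal ((4 * exp 2 * sqrt (A * C)) ^ n) *
    (\<integral>\<^sup>+ y. \<integral>\<^sup>+ e. G (\<lambda>i. if i < n then (if i \<in> s then \<theta> * y i else X i (masked s y i)) + e i else 0)
        \<partial>PiM {..<n} (\<lambda>i. gauss (if i \<in> s then 4 else C))
        \<partial>PiM {..<n} (\<lambda>i. gauss (if i \<in> s then A else 1)))"
proof -
  \<comment> \<open>\<open>w\<close> is the comparison variance for the relay's observation,
    \<open>v\<close> the one for the destination's symbol after subtracting \<open>m y\<close>. A
    listening symbol costs \<open>A\<close> at the relay and a constant at the destination; any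
    other symbol costs \<open>C\<close> at the destination and nothing at the relay.\<close>
  define v w where "v i = (if i \<in> s then 4 else C)" and "w i = (if i \<in> s then A else 1)" for i
  define a where "a i = (if i \<in> s then gr * x i else 0)" for i
  define m where "m y i = (if i \<in> s then \<theta> * y i else X i (masked s y i))" for y i
  define \<Psi> where "\<Psi> y = (\<integral>\<^sup>+ e. G (\<lambda>i. if i < n then m y i + e i else 0) \<partial>PiM {..<n} (\<lambda>i. gauss (v i)))" for y
  define k where "k i = (if i \<in> s then 4 else C * exp (2 * (cmod (x i))\<^sup>2))" for i
  define k' where "k' i = (if i \<in> s then A * exp (2 * (cmod (x i))\<^sup>2) else 1)" for i
  \<comment> \<open>Shifting by \<theta> times the relay noise is an unbounded shift: against
    variance 4 it leaves the factor exp (2 * |z|^2 / 4). This factor is carried into the integral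
    over the relay noise and absorbed there.\<close>
  define W :: "nat \<Rightarrow> complex \<Rightarrow> ennreal" where "W i z = (if i \<in> s then ennreal (exp ((cmod z)\<^sup>2 / 2)) else 1)" for i z
  have v: "v i \<ge> 4" and w: "w i > 0" and k: "k i \<ge> 0" and k': "k' i \<ge> 0" for i
    using AC by (auto simp: v_def w_def k_def k'_def)
  have \<Psi>: "\<Psi> \<in> borel_measurable (PiM {..<n} (\<lambda>i. gauss (w i)))"
  proof -
    have "(\<lambda>y. m y i) \<in> borel_measurable (PiM {..<n} (\<lambda>i. gauss (w i)))" if "i < n" for i
    proof (cases "i \<in> s")
      case True
      then show ?thesis using that by (simp add: m_def)
    next
      case False
      have "(\<lambda>y. masked s y i) \<in> borel_measurable (PiM {..<n} (\<lambda>i. gauss (w i)))"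
        using that by (intro measurable_masked) simp
      from measurable_compose[OF this X] show ?thesis using False by (simp add: m_def)
    qed
    then show ?thesis
      unfolding \<Psi>_def using v by (intro measurable_output_integral) (auto intro: less_le_trans[of 0 4])
  qed
  have inner: "(\<integral>\<^sup>+ zd. G (\<lambda>i. if i < n then gd * x i +
        (if i \<in> s then 0 else X i (masked s (\<lambda>j. gr * x j + zr j) i)) + zd i else 0)
        \<partial>PiM {..<n} (\<lambda>_. cnormal)) \<le>
      (\<Prod>i<n. ennreal (k i)) * ((\<Prod>i<n. W i (zr i)) * \<Psi> (\<lambda>i\<in>{..<n}. zr i + a i))" for zr
  proof -
    define y where "y = (\<lambda>i\<in>{..<n}. zr i + a i)"
    \<comment> \<open>At listening times the direct signal equals \<theta> times the relay's
      noiseless symbol, that is \<open>\<theta> * (y i - zr i)\<close>. Once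
      \<open>\<theta> * y i\<close> is subtracted, only the multiple of the relay noise remains as a
      shift.\<close>
    define \<mu> where "\<mu> i = (if i \<in> s then - \<theta> * zr i else gd * x i)" for i
    define G' where "G' e = G (\<lambda>i. if i < n then m y i + e i else 0)" for e
    have [measurable]: "G' \<in> borel_measurable (PiM {..<n} (\<lambda>i. gauss (v i)))"
      unfolding G'_def by (intro measurable_compose[OF measurable_extend_zero]) auto
    have "(\<integral>\<^sup>+ z. (\<Prod>i<n. 1) * G' (\<lambda>i\<in>{..<n}. z i + \<mu> i) \<partial>PiM {..<n} (\<lambda>_. cnormal)) \<le>
        (\<Prod>i<n. ennreal (k i) * W i (zr i)) * (\<integral>\<^sup>+ e. G' e \<partial>PiM {..<n} (\<lambda>i. gauss (v i)))"
    proof (rule nn_integral_PiM_dominated)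
      show "sigma_finite_measure (gauss (v i))" for i
        using v[of i] by (intro sigma_finite_gauss) auto
      show "(\<integral>\<^sup>+ z. 1 * g (z + \<mu> i) \<partial>cnormal) \<le>
          ennreal (k i) * W i (zr i) * (\<integral>\<^sup>+ y. g y \<partial>gauss (v i))"
        if "g \<in> borel_measurable (gauss (v i))" for i g
      proof -
        have "v i * exp (2 * (cmod (\<mu> i))\<^sup>2 / v i) \<le>
            k i * (if i \<in> s then exp ((cmod (zr i))\<^sup>2 / 2) else 1)"
        proof (cases "i \<in> s")
          case True
          have "(cmod (\<theta> * zr i))\<^sup>2 \<le> (cmod (zr i))\<^sup>2"
            using \<theta>(2) by (intro power_mono) (auto simp: norm_mult mult_left_le_one_le)
          then show ?thesis using True by (simp add: v_def k_def \<mu>_def)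
        next
          case False
          have "(cmod (gd * x i))\<^sup>2 \<le> C * (cmod (x i))\<^sup>2"
            using gd by (simp add: norm_mult power_mult_distrib mult_right_mono)
          then show ?thesis using False AC by (simp add: v_def k_def \<mu>_def field_simps)
        qed
        then have le: "ennreal (v i * exp (2 * (cmod (\<mu> i))\<^sup>2 / v i)) \<le> ennreal (k i) * W i (zr i)"
          using k[of i] by (simp add: W_def ennreal_mult'[symmetric] ennreal_leI split: if_splits)
        have "g \<in> borel_measurable borel" using that by (simp cong: measurable_cong_sets)
        then have "(\<integral>\<^sup>+ z. 1 * g (z + \<mu> i) \<partial>cnormal) \<le>
            ennreal (v i * exp (2 * (cmod (\<mu> i))\<^sup>2 / v i)) * (\<integral>\<^sup>+ y. g y \<partial>gauss (v i))"
          using cnormal_shift_le[of g "v i" "\<mu> i"] v[of i] by simp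
        then show ?thesis using mult_right_mono[OF le] by (rule order_trans) auto
      qed
    qed (auto intro: sigma_finite_cnormal)
    moreover have "(\<lambda>i. if i < n then m y i + (\<lambda>i\<in>{..<n}. z i + \<mu> i) i else 0) =
        (\<lambda>i. if i < n then gd * x i +
        (if i \<in> s then 0 else X i (masked s (\<lambda>j. gr * x j + zr j) i)) + z i else 0)" for z
    proof (rule ext)
      fix i
      have "masked s y i = masked s (\<lambda>j. gr * x j + zr j) i" if "i < n"
        using that by (auto simp: masked_def y_def a_def fun_eq_iff)
      then show "(if i < n then m y i + (\<lambda>i\<in>{..<n}. z i + \<mu> i) i else 0) =
        (if i < n then gd * x i +
        (if i \<in> s then 0 else X i (masked s (\<lambda>j. gr * x j + zr j) i)) + z i else 0)"
        by (auto simp: m_def \<mu>_def y_def a_def \<theta>(1) algebra_simps)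
    qed
    ultimately show ?thesis
      by (simp add: G'_def \<Psi>_def y_def[symmetric] prod.distrib mult.assoc)
  qed
  have "(\<integral>\<^sup>+ zr. \<integral>\<^sup>+ zd. G (\<lambda>i. if i < n then gd * x i +
        (if i \<in> s then 0 else X i (masked s (\<lambda>j. gr * x j + zr j) i)) + zd i else 0)
        \<partial>PiM {..<n} (\<lambda>_. cnormal) \<partial>PiM {..<n} (\<lambda>_. cnormal)) \<le>
      (\<integral>\<^sup>+ zr. (\<Prod>i<n. ennreal (k i)) * ((\<Prod>i<n. W i (zr i)) * \<Psi> (\<lambda>i\<in>{..<n}. zr i + a i))
        \<partial>PiM {..<n} (\<lambda>_. cnormal))"
    by (intro nn_integral_mono inner)
  also have "\<dots> = (\<Prod>i<n. ennreal (k i)) *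
      (\<integral>\<^sup>+ zr. (\<Prod>i<n. W i (zr i)) * \<Psi> (\<lambda>i\<in>{..<n}. zr i + a i) \<partial>PiM {..<n} (\<lambda>_. cnormal))"
  proof (rule nn_integral_cmult)
    have "(\<lambda>zr. \<lambda>i\<in>{..<n}. zr i + a i) \<in> PiM {..<n} (\<lambda>_. cnormal) \<rightarrow>\<^sub>M PiM {..<n} (\<lambda>i. gauss (w i))"
      by (intro measurable_restrict) simp
    from measurable_compose[OF this \<Psi>]
    show "(\<lambda>zr. (\<Prod>i<n. W i (zr i)) * \<Psi> (\<lambda>i\<in>{..<n}. zr i + a i))
      \<in> borel_measurable (PiM {..<n} (\<lambda>_. cnormal))"
      unfolding W_def by (intro borel_measurable_times_ennreal borel_measurable_prod_ennreal) auto
  qed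
  also have "\<dots> \<le> (\<Prod>i<n. ennreal (k i)) *
      ((\<Prod>i<n. ennreal (k' i)) * (\<integral>\<^sup>+ y. \<Psi> y \<partial>PiM {..<n} (\<lambda>i. gauss (w i))))"
  proof (intro mult_left_mono nn_integral_PiM_dominated)
    show "sigma_finite_measure (gauss (w i))" for i
      using w[of i] by (intro sigma_finite_gauss) auto
    show "(\<integral>\<^sup>+ z. W i z * g (z + a i) \<partial>cnormal) \<le> ennreal (k' i) * (\<integral>\<^sup>+ y. g y \<partial>gauss (w i))"
      if "g \<in> borel_measurable (gauss (w i))" for i g
    proof (cases "i \<in> s")
      case True
      have "g \<in> borel_measurable borel" using that by (simp cong: measurable_cong_sets)
      then have "(\<integral>\<^sup>+ z. W i z * g (z + a i) \<partial>cnormal) \<le>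
          ennreal (A * exp (2 * (cmod (a i))\<^sup>2 / A)) * (\<integral>\<^sup>+ y. g y \<partial>gauss A)"
        \<comment> \<open>The weight uses up half of the Gaussian exponent, so 2 / A must be at most
          1/2; this is what 4 \<le> A provides.\<close>
        using nn_integral_gauss_shift_le[of g A "1/2" "a i"] AC True by (simp add: W_def)
      also have "A * exp (2 * (cmod (a i))\<^sup>2 / A) \<le> k' i"
      proof -
        have "(cmod (a i))\<^sup>2 \<le> A * (cmod (x i))\<^sup>2"
          using gr True by (simp add: a_def norm_mult power_mult_distrib mult_right_mono)
        then show ?thesis using True AC by (simp add: k'_def field_simps)
      qed
      finally show ?thesis using True by (simp add: w_def ennreal_leI mult_right_mono)
    next
      case False
      then show ?thesis by (simp add: W_def a_def k'_def w_def cnormal_eq_gauss)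
    qed
  qed (auto intro: sigma_finite_cnormal \<Psi> simp: W_def)
  also have "\<dots> = ennreal (\<Prod>i<n. k i * k' i) * (\<integral>\<^sup>+ y. \<Psi> y \<partial>PiM {..<n} (\<lambda>i. gauss (w i)))"
    using k k' by (simp add: prod_ennreal prod.distrib ennreal_mult prod_nonneg mult.assoc)
  also have "(\<Prod>i<n. k i * k' i) = (\<Prod>i<n. (if i \<in> s then 4 * A else C) * exp (2 * (cmod (x i))\<^sup>2))"
    by (intro prod.cong) (auto simp: k_def k'_def)
  also have "\<dots> = (\<Prod>i<n. (if i \<in> s then 4 * A else C)) * exp (2 * (\<Sum>i<n. (cmod (x i))\<^sup>2))"
    by (simp add: prod.distrib exp_sum[symmetric] sum_distrib_left)
  also have "(\<Prod>i<n. (if i \<in> s then 4 * A else C)) = (4 * A) ^ card s * C ^ (n - card s)"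
    using s by (intro prod_if_const) auto
  also have "(4 * A) ^ card s * C ^ (n - card s) * exp (2 * (\<Sum>i<n. (cmod (x i))\<^sup>2)) \<le>
      (4 ^ n * sqrt (A * C) ^ n) * exp (2 * real n)"
  proof (rule mult_mono)
    have le: "card s \<le> n" using card_mono[OF _ s(1)] by simp
    \<comment> \<open>Here the smaller factor \<open>C\<close> belongs to the symbols at which the
      relay does not listen. They fill at least half of the block, so the inequality is applied with
      n - card s in the role of \<open>k\<close>.\<close>
    have "(4 * A) ^ card s * C ^ (n - card s) = 4 ^ card s * (C ^ (n - card s) * A ^ (n - (n - card s)))"
      using le by (simp add: power_mult_distrib)
    also have "\<dots> \<le> 4 ^ n * sqrt (A * C) ^ n"
      using AC s le by (intro mult_mono prod_two_powers_le power_increasing) auto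
    finally show "(4 * A) ^ card s * C ^ (n - card s) \<le> 4 ^ n * sqrt (A * C) ^ n" .
  qed (use x AC in auto)
  also have "\<dots> = (4 * exp 2 * sqrt (A * C)) ^ n"
    by (simp add: power_mult_distrib exp_of_nat2_mult[symmetric])
  finally show ?thesis
    unfolding \<Psi>_def m_def v_def w_def by (simp add: ennreal_leI mult_right_mono)
qed

section \<open>Measurability of the decoded message\<close>

definition listens :: "real \<Rightarrow> real \<Rightarrow> relay_code \<Rightarrow> complex \<Rightarrow> real \<Rightarrow> nat \<Rightarrow> (nat \<Rightarrow> complex) \<Rightarrow> nat set" where
  "listens a \<rho> K hsr u w z =
     {i. i < blocklen K \<and> \<not> relay_sends K i (hsr, u, relay_hist a \<rho> K hsr u w z i)}"

text \<open>The history is zero at transmit times and at all times not yet reached, so the listening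
  set alone determines which noisy symbols survive in it. This turns the recursion into a closed
  formula that can be evaluated for each possible set separately.\<close>

lemma relay_hist_eq_masked:
  "i \<le> blocklen K \<Longrightarrow> relay_hist a \<rho> K hsr u w z i =
    masked (listens a \<rho> K hsr u w z) (\<lambda>j. hsr * of_real (\<rho> powr (a / 2)) * enc K w j + z j) i"
proof (induction i)
  case 0
  then show ?case by (simp add: masked_def)
next
  case (Suc i)
  have "i \<in> listens a \<rho> K hsr u w z \<longleftrightarrow> \<not> relay_sends K i (hsr, u, relay_hist a \<rho> K hsr u w z i)"
    using Suc.prems by (auto simp: listens_def)
  with Suc show ?case by (auto simp: Let_def masked_def fun_eq_iff less_Suc_eq)
qed

lemma relay_input_eq_masked:
  assumes "i < blocklen K"
  shows "relay_input a \<rho> K hsr u w z i =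
    (if i \<in> listens a \<rho> K hsr u w z then 0
     else relay_sym K i (hsr, u, masked (listens a \<rho> K hsr u w z)
       (\<lambda>j. hsr * of_real (\<rho> powr (a / 2)) * enc K w j + z j) i))"
  using assms
  by (simp add: relay_input_def Let_def relay_hist_eq_masked[OF less_imp_le, symmetric])
    (auto simp: listens_def)

lemma listens_subset: "listens a \<rho> K hsr u w z \<subseteq> {..<blocklen K}"
  by (auto simp: listens_def)

text \<open>The code may itself vary with the sample point, because a quantize-map-forward code
  depends on a random relay codebook. Measurability of the relay functions is therefore required
  only along compositions, a form that fits fixed and random codes alike.\<close>

lemma measurable_relay_hist:
  fixes K :: "'a \<Rightarrow> relay_code"
  assumes enc: "\<And>x. enc (K x) = E"
    and sends: "\<And>i s. s \<in> borel_measurable N \<Longrightarrow> (\<lambda>x. relay_sends (K x) i (s x)) \<in> N \<rightarrow>\<^sub>M count_space UNIV"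
    and [measurable]: "hsr \<in> borel_measurable N" "u \<in> borel_measurable N"
    and z: "\<And>i. i < n \<Longrightarrow> (\<lambda>x. z x i) \<in> borel_measurable N"
  shows "i \<le> n \<Longrightarrow> (\<lambda>x. relay_hist a \<rho> (K x) (hsr x) (u x) w (z x) i) \<in> borel_measurable N"
proof (induction i)
  case 0
  then show ?case by simp
next
  case (Suc i)
  let ?y = "\<lambda>x. relay_hist a \<rho> (K x) (hsr x) (u x) w (z x) i"
  have y: "?y \<in> borel_measurable N" using Suc by simp
  have [measurable]: "(\<lambda>x. z x i) \<in> borel_measurable N" using Suc.prems z by simp
  have [measurable]: "Measurable.pred N (\<lambda>x. relay_sends (K x) i (hsr x, u x, ?y x))"
    using y by (intro sends borel_measurable_Pair) auto
  show ?case
  proof (rule measurable_coordinatewise_then_product)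
    fix j
    have [measurable]: "(\<lambda>x. ?y x j) \<in> borel_measurable N"
      using measurable_compose[OF y borel_measurable_continuous_onI[OF continuous_on_product_coordinates]] .
    have "(\<lambda>x. if j = i then if relay_sends (K x) i (hsr x, u x, ?y x) then 0
        else hsr x * of_real (\<rho> powr (a / 2)) * E w i + z x i else ?y x j) \<in> borel_measurable N"
      by measurable
    moreover have "relay_hist a \<rho> (K x) (hsr x) (u x) w (z x) (Suc i) j =
      (if j = i then if relay_sends (K x) i (hsr x, u x, ?y x) then 0
        else hsr x * of_real (\<rho> powr (a / 2)) * E w i + z x i else ?y x j)" for x
      by (simp only: relay_hist.simps Let_def enc fun_upd_apply)
    ultimately show "(\<lambda>x. relay_hist a \<rho> (K x) (hsr x) (u x) w (z x) (Suc i) j) \<in> borel_measurable N"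
      by (simp only:)
  qed
qed

lemma measurable_decode_output:
  fixes K :: "'a \<Rightarrow> relay_code"
  assumes enc: "\<And>x. enc (K x) = E" and n: "\<And>x. blocklen (K x) = n"
    and sends: "\<And>i s. s \<in> borel_measurable N \<Longrightarrow> (\<lambda>x. relay_sends (K x) i (s x)) \<in> N \<rightarrow>\<^sub>M count_space UNIV"
    and sym: "\<And>i s. s \<in> borel_measurable N \<Longrightarrow> (\<lambda>x. relay_sym (K x) i (s x)) \<in> borel_measurable N"
    and dec: "\<And>s. s \<in> borel_measurable N \<Longrightarrow> (\<lambda>x. decode (K x) (s x)) \<in> N \<rightarrow>\<^sub>M count_space UNIV"
    and h [measurable]: "h \<in> borel_measurable N" and [measurable]: "u \<in> borel_measurable N"
    and zr: "\<And>i. i < n \<Longrightarrow> (\<lambda>x. zr x i) \<in> borel_measurable N"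
    and zd: "\<And>i. i < n \<Longrightarrow> (\<lambda>x. zd x i) \<in> borel_measurable N"
  shows "(\<lambda>x. decode (K x) (h x, dest_output a b c \<rho> (K x) (h x) (u x) w (zr x) (zd x)))
    \<in> N \<rightarrow>\<^sub>M count_space UNIV"
proof -
  have [measurable]: "(\<lambda>x. fst (h x)) \<in> borel_measurable N" "(\<lambda>x. fst (snd (h x))) \<in> borel_measurable N"
    "(\<lambda>x. snd (snd (h x))) \<in> borel_measurable N"
    by (auto intro!: measurable_compose[OF h] borel_measurable_continuous_onI continuous_intros)
  have inp: "(\<lambda>x. relay_input a \<rho> (K x) (fst (h x)) (u x) w (zr x) i) \<in> borel_measurable N" if "i < n" for i
  proof -
    have y: "(\<lambda>x. relay_hist a \<rho> (K x) (fst (h x)) (u x) w (zr x) i) \<in> borel_measurable N"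
      by (rule measurable_relay_hist[where n = n, OF enc sends]) (use that zr in auto)
    have [measurable]: "Measurable.pred N (\<lambda>x. relay_sends (K x) i (fst (h x), u x,
        relay_hist a \<rho> (K x) (fst (h x)) (u x) w (zr x) i))"
      using y by (intro sends borel_measurable_Pair) auto
    have [measurable]: "(\<lambda>x. relay_sym (K x) i (fst (h x), u x,
        relay_hist a \<rho> (K x) (fst (h x)) (u x) w (zr x) i)) \<in> borel_measurable N"
      using y by (intro sym borel_measurable_Pair) auto
    show ?thesis by (simp add: relay_input_def Let_def)
  qed
  have out: "(\<lambda>x i. if i < n then snd (snd (h x)) * of_real (\<rho> powr (c / 2)) * E w i +
      fst (snd (h x)) * of_real (\<rho> powr (b / 2)) * relay_input a \<rho> (K x) (fst (h x)) (u x) w (zr x) i +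
      zd x i else 0) \<in> borel_measurable N"
  proof (rule measurable_extend_zero)
    fix i assume "i < n"
    note [measurable] = inp[OF this] zd[OF this]
    show "(\<lambda>x. snd (snd (h x)) * of_real (\<rho> powr (c / 2)) * E w i +
      fst (snd (h x)) * of_real (\<rho> powr (b / 2)) * relay_input a \<rho> (K x) (fst (h x)) (u x) w (zr x) i +
      zd x i) \<in> borel_measurable N" by measurable
  qed
  have eq: "(\<lambda>x i. if i < n then snd (snd (h x)) * of_real (\<rho> powr (c / 2)) * E w i +
      fst (snd (h x)) * of_real (\<rho> powr (b / 2)) * relay_input a \<rho> (K x) (fst (h x)) (u x) w (zr x) i +
      zd x i else 0) = (\<lambda>x. dest_output a b c \<rho> (K x) (h x) (u x) w (zr x) (zd x))"
  proof
    fix x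
    obtain hsr hrd hsd where "h x = (hsr, hrd, hsd)" by (cases "h x")
    then show "(\<lambda>i. if i < n then snd (snd (h x)) * of_real (\<rho> powr (c / 2)) * E w i +
      fst (snd (h x)) * of_real (\<rho> powr (b / 2)) * relay_input a \<rho> (K x) (fst (h x)) (u x) w (zr x) i +
      zd x i else 0) = dest_output a b c \<rho> (K x) (h x) (u x) w (zr x) (zd x)"
      by (simp only: dest_output_def prod.case fst_conv snd_conv enc n)
  qed
  show ?thesis by (rule dec[OF borel_measurable_Pair[OF h out[unfolded eq]]])
qed

text \<open>Decoding regions are disjoint, so each output counts for at most one message. Under a
  law that does not depend on the message, the success probabilities of all messages thus share
  total mass one.\<close>

lemma sum_decoded_le:
  fixes D :: "'a \<Rightarrow> nat"
  assumes "prob_space N" "D \<in> N \<rightarrow>\<^sub>M count_space UNIV"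
  shows "(\<Sum>w<M. \<integral>\<^sup>+ y. indicator {y. D y = w} y \<partial>N) \<le> (1::ennreal)"
proof -
  have [measurable]: "Measurable.pred N (\<lambda>y. D y = w)" for w
    using measurable_compose[OF assms(2), of "\<lambda>d. d = w"] by simp
  have "(\<Sum>w<M. \<integral>\<^sup>+ y. indicator {y. D y = w} y \<partial>N) = (\<integral>\<^sup>+ y. (\<Sum>w<M. indicator {y. D y = w} y) \<partial>N)"
    by (rule nn_integral_sum[symmetric]) measurable
  also have "\<dots> \<le> (\<integral>\<^sup>+ y. 1 \<partial>N)"
  proof (rule nn_integral_mono)
    fix y
    have "(\<Sum>w<M. indicator {y. D y = w} y) = (\<Sum>w<M. if D y = w then 1 else 0 :: ennreal)"
      by (intro sum.cong) (auto simp: indicator_def)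
    also have "\<dots> = (if D y < M then 1 else 0)" by (subst sum.delta') auto
    finally show "(\<Sum>w<M. indicator {y. D y = w} y) \<le> (1::ennreal)" by simp
  qed
  also have "\<dots> = 1" using prob_space.emeasure_space_1[OF assms(1)] by simp
  finally show ?thesis .
qed

lemma prob_space_PiM_gauss:
  "(\<And>i. v i > 0) \<Longrightarrow> prob_space (PiM I (\<lambda>i. gauss (v i)))"
  by (intro prob_space_PiM prob_space_gauss)

section \<open>Error probability at a given realization\<close>

lemma prob_space_local_randomness: "prob_space (local_randomness n)"
proof -
  interpret N: prob_space "PiM {..<n} (\<lambda>_. cnormal)" by (intro prob_space_PiM prob_space_cnormal)
  interpret U: prob_space "uniform_measure lborel {0..1::real}"
    by (intro prob_space_uniform_measure) auto
  interpret NN: pair_prob_space "PiM {..<n} (\<lambda>_. cnormal)" "PiM {..<n} (\<lambda>_. cnormal)" ..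
  interpret UNN: pair_prob_space "uniform_measure lborel {0..1::real}"
    "PiM {..<n} (\<lambda>_. cnormal) \<Otimes>\<^sub>M PiM {..<n} (\<lambda>_. cnormal)" ..
  show ?thesis unfolding local_randomness_def by (rule UNN.prob_space_axioms)
qed

text \<open>\<open>A\<close> bounds both relay links and \<open>C\<close> the direct link, after
  scaling by \<rho>. The ratio \<theta> of modulus at most 1 says that the direct link is no
  stronger than the source-relay link, so at listening times the destination's symbol is known from
  the relay's up to noise level.\<close>

locale relay_realization =
  fixes a b c \<rho> :: real and K :: relay_code and hsr hrd hsd gr gb gd \<theta> :: complex and A C :: real
  assumes ok: "relay_code_ok a \<rho> K"
    and gr_def: "gr = hsr * of_real (\<rho> powr (a / 2))"
    and gb_def: "gb = hrd * of_real (\<rho> powr (b / 2))"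
    and gd_def: "gd = hsd * of_real (\<rho> powr (c / 2))"
    and gr_le: "(cmod gr)\<^sup>2 \<le> A" and gb_le: "(cmod gb)\<^sup>2 \<le> A" and gd_le: "(cmod gd)\<^sup>2 \<le> C"
    and AC: "4 \<le> C" "C \<le> A" and \<theta>: "gd = \<theta> * gr" "cmod \<theta> \<le> 1"
begin

definition n where "n = blocklen K"
definition L where "L u w zr = listens a \<rho> K hsr u w zr"
definition out where "out u w zr zd = dest_output a b c \<rho> K (hsr, hrd, hsd) u w zr zd"
definition dec where "dec y = decode K ((hsr, hrd, hsd), y)"
definition hit :: "nat \<Rightarrow> (nat \<Rightarrow> complex) \<Rightarrow> ennreal" where "hit w y = indicator {y. dec y = w} y"
abbreviation noise where "noise \<equiv> PiM {..<n} (\<lambda>_. cnormal)"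

lemma enc_power:
  assumes "w < nmsg K"
  shows "(\<Sum>i<n. (cmod (enc K w i))\<^sup>2) \<le> real n"
  using ok assms by (auto simp: relay_code_ok_def n_def divide_le_eq_1_pos)

lemma input_power:
  assumes "w < nmsg K" "u \<in> {0..1}"
  shows "(\<Sum>i<n. (cmod (relay_input a \<rho> K hsr u w z i))\<^sup>2) \<le> real n"
  using ok assms by (auto simp: relay_code_ok_def n_def divide_le_eq_1_pos)

lemma measurable_dec: "dec \<in> borel \<rightarrow>\<^sub>M count_space UNIV"
proof -
  have "decode K \<in> borel \<rightarrow>\<^sub>M count_space UNIV" using ok by (simp add: relay_code_ok_def)
  then show ?thesis unfolding dec_def by measurable
qed

lemma measurable_hit: "hit w \<in> borel_measurable borel"
proof -
  have [measurable]: "Measurable.pred borel (\<lambda>y. dec y = w)"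
    using measurable_compose[OF measurable_dec, of "\<lambda>d. d = w"] by simp
  show ?thesis unfolding hit_def by measurable
qed

lemma measurable_sends:
  "s \<in> borel_measurable N \<Longrightarrow> (\<lambda>x. relay_sends K i (s x)) \<in> N \<rightarrow>\<^sub>M count_space UNIV"
  using ok by (auto simp: relay_code_ok_def intro: measurable_compose)

lemma measurable_sym:
  "s \<in> borel_measurable N \<Longrightarrow> (\<lambda>x. relay_sym K i (s x)) \<in> borel_measurable N"
  using ok by (auto simp: relay_code_ok_def intro: measurable_compose)

lemma sum_hit_le:
  assumes "prob_space N" "f \<in> borel_measurable N"
  shows "(\<Sum>w<M. \<integral>\<^sup>+ y. hit w (f y) \<partial>N) \<le> 1"
  using sum_decoded_le[OF assms(1) measurable_compose[OF assms(2) measurable_dec], of M]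
  by (simp add: hit_def indicator_def)

lemma prob_noise: "prob_space noise"
  by (intro prob_space_PiM prob_space_cnormal)

lemma out_eq_input:
  "out u w zr zd =
     (\<lambda>i. if i < n then gd * enc K w i + gb * relay_input a \<rho> K hsr u w zr i + zd i else 0)"
  by (simp add: out_def dest_output_def gd_def gb_def n_def cong: if_cong)

definition X where "X u i y = gb * relay_sym K i (hsr, u, y)"

lemma measurable_X: "X u i \<in> borel_measurable borel"
  unfolding X_def by (intro borel_measurable_times measurable_sym borel_measurable_Pair) auto

lemma out_eq_X:
  "out u w zr zd = (\<lambda>i. if i < n then gd * enc K w i +
     (if i \<in> L u w zr then 0 else X u i (masked (L u w zr) (\<lambda>j. gr * enc K w j + zr j) i)) + zd i
     else 0)"
  by (auto simp: out_eq_input fun_eq_iff n_def relay_input_eq_masked L_def X_def gr_def)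

text \<open>With \<open>zr\<close> and \<open>u\<close> fixed, schedule and relay input are
  functions of the message only. Different messages may still induce different schedules, hence
  different comparison laws; summing over all subsets gives a family of laws common to all messages,
  and disjointness of the decoding regions applies to each law.\<close>

lemma mac_cut:
  assumes u: "u \<in> {0..1}"
  shows "(\<Sum>w<nmsg K. if 2 * card (L u w zr) \<le> n then 0 else \<integral>\<^sup>+ zd. hit w (out u w zr zd) \<partial>noise) \<le>
    ennreal (2 ^ n * (exp 8 * sqrt (A * C)) ^ n)"
proof -
  let ?P = "\<lambda>s. PiM {..<n} (\<lambda>i. gauss (if i \<in> s then C else A))"
  let ?k = "ennreal ((exp 8 * sqrt (A * C)) ^ n)"
  let ?J = "\<lambda>s w. \<integral>\<^sup>+ y. hit w (\<lambda>i. if i < n then y i else 0) \<partial>?P s"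
  have "(\<Sum>w<nmsg K. if 2 * card (L u w zr) \<le> n then 0 else \<integral>\<^sup>+ zd. hit w (out u w zr zd) \<partial>noise) \<le>
      (\<Sum>w<nmsg K. \<Sum>s\<in>Pow {..<n}. ?k * ?J s w)"
  proof (intro sum_mono)
    fix w assume w: "w \<in> {..<nmsg K}"
    show "(if 2 * card (L u w zr) \<le> n then 0 else \<integral>\<^sup>+ zd. hit w (out u w zr zd) \<partial>noise) \<le>
      (\<Sum>s\<in>Pow {..<n}. ?k * ?J s w)"
    proof (cases "2 * card (L u w zr) \<le> n")
      case False
      have sub: "L u w zr \<subseteq> {..<n}" by (simp add: L_def n_def listens_subset)
      have "(\<integral>\<^sup>+ zd. hit w (out u w zr zd) \<partial>noise) \<le> ?k * ?J (L u w zr) w"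
        unfolding out_eq_input using w u False
        by (intro mac_cut_dominated sub AC gd_le gb_le enc_power input_power measurable_hit)
          (auto simp: L_def n_def relay_input_eq_masked listens_def)
      also have "\<dots> \<le> (\<Sum>s\<in>Pow {..<n}. ?k * ?J s w)"
        using sub by (intro member_le_sum) auto
      finally show ?thesis using False by simp
    qed simp
  qed
  also have "\<dots> = (\<Sum>s\<in>Pow {..<n}. ?k * (\<Sum>w<nmsg K. ?J s w))"
    by (subst sum.swap) (simp add: sum_distrib_left)
  also have "\<dots> \<le> (\<Sum>s\<in>Pow {..<n}. ?k * 1)"
    using AC by (intro sum_mono mult_left_mono sum_hit_le prob_space_PiM_gauss measurable_extend_zero) auto
  also have "\<dots> = ennreal (2 ^ n * (exp 8 * sqrt (A * C)) ^ n)"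
    using AC by (simp add: card_Pow ennreal_mult ennreal_power[symmetric])
  finally show ?thesis .
qed

text \<open>The schedule varies with the relay noise over which one integrates, while the domination
  needs a fixed set. The true integrand is therefore bounded by the sum, over all sets with few
  listening times, of what the destination would see if the relay were forced to follow that set;
  the term of the actual schedule is one of the summands.\<close>

lemma bc_cut:
  "(\<Sum>w<nmsg K. \<integral>\<^sup>+ zr. (if 2 * card (L u w zr) \<le> n then \<integral>\<^sup>+ zd. hit w (out u w zr zd) \<partial>noise else 0) \<partial>noise) \<le>
    ennreal (2 ^ n * (4 * exp 2 * sqrt (A * C)) ^ n)"
proof -
  define S where "S = {s \<in> Pow {..<n}. 2 * card s \<le> n}"
  have S: "finite S" "card S \<le> 2 ^ n"
    using card_mono[of "Pow {..<n}" S] by (auto simp: S_def card_Pow)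
  let ?P = "\<lambda>s. PiM {..<n} (\<lambda>i. gauss (if i \<in> s then 4 else C))"
  let ?Q = "\<lambda>s. PiM {..<n} (\<lambda>i. gauss (if i \<in> s then A else 1))"
  let ?k = "ennreal ((4 * exp 2 * sqrt (A * C)) ^ n)"
  let ?f = "\<lambda>s y e i. if i < n then (if i \<in> s then \<theta> * y i else X u i (masked s y i)) + e i else 0"
  let ?J = "\<lambda>s w. \<integral>\<^sup>+ y. \<integral>\<^sup>+ e. hit w (?f s y e) \<partial>?P s \<partial>?Q s"
  let ?I = "\<lambda>s w zr. \<integral>\<^sup>+ zd. hit w (\<lambda>i. if i < n then gd * enc K w i +
        (if i \<in> s then 0 else X u i (masked s (\<lambda>j. gr * enc K w j + zr j) i)) + zd i else 0) \<partial>noise"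
  have meas: "?I s w \<in> borel_measurable noise" for s w
  proof -
    have "(\<lambda>zr. gd * enc K w i + (if i \<in> s then 0 else X u i (masked s (\<lambda>j. gr * enc K w j + zr j) i)))
        \<in> borel_measurable noise" if "i < n" for i
    proof -
      have "(\<lambda>zr. masked s (\<lambda>j. gr * enc K w j + zr j) i) \<in> borel_measurable noise"
        using that by (intro measurable_masked) simp
      from measurable_compose[OF this measurable_X] show ?thesis by simp
    qed
    from measurable_output_integral[OF this measurable_hit, where v = "\<lambda>_. 1"]
    show ?thesis by (simp add: cnormal_eq_gauss)
  qed
  have "(\<Sum>w<nmsg K. \<integral>\<^sup>+ zr. (if 2 * card (L u w zr) \<le> n then \<integral>\<^sup>+ zd. hit w (out u w zr zd) \<partial>noise else 0) \<partial>noise) \<le>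
      (\<Sum>w<nmsg K. \<Sum>s\<in>S. ?k * ?J s w)"
  proof (intro sum_mono)
    fix w assume w: "w \<in> {..<nmsg K}"
    have "(\<integral>\<^sup>+ zr. (if 2 * card (L u w zr) \<le> n then \<integral>\<^sup>+ zd. hit w (out u w zr zd) \<partial>noise else 0) \<partial>noise) \<le>
        (\<integral>\<^sup>+ zr. (\<Sum>s\<in>S. ?I s w zr) \<partial>noise)"
    proof (rule nn_integral_mono)
      fix zr
      show "(if 2 * card (L u w zr) \<le> n then \<integral>\<^sup>+ zd. hit w (out u w zr zd) \<partial>noise else 0) \<le> (\<Sum>s\<in>S. ?I s w zr)"
      proof (cases "2 * card (L u w zr) \<le> n")
        case True
        have "L u w zr \<in> S" using True listens_subset[of a \<rho> K hsr u w zr]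
          by (simp add: S_def L_def n_def)
        then have "?I (L u w zr) w zr \<le> (\<Sum>s\<in>S. ?I s w zr)" by (intro member_le_sum S) auto
        then show ?thesis using True by (simp add: out_eq_X)
      qed simp
    qed
    also have "\<dots> = (\<Sum>s\<in>S. \<integral>\<^sup>+ zr. ?I s w zr \<partial>noise)"
      by (rule nn_integral_sum) (rule meas)
    also have "\<dots> \<le> (\<Sum>s\<in>S. ?k * ?J s w)"
      using w by (intro sum_mono bc_cut_dominated gr_le gd_le AC \<theta> enc_power measurable_X measurable_hit)
        (auto simp: S_def)
    finally show "(\<integral>\<^sup>+ zr. (if 2 * card (L u w zr) \<le> n then \<integral>\<^sup>+ zd. hit w (out u w zr zd) \<partial>noise else 0) \<partial>noise) \<le>
        (\<Sum>s\<in>S. ?k * ?J s w)" .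
  qed
  also have "\<dots> = (\<Sum>s\<in>S. ?k * (\<Sum>w<nmsg K. ?J s w))"
    by (subst sum.swap) (simp add: sum_distrib_left)
  also have "\<dots> \<le> (\<Sum>s\<in>S. ?k * 1)"
  proof (intro sum_mono mult_left_mono)
    fix s
    have m: "(\<lambda>y. if i \<in> s then \<theta> * y i else X u i (masked s y i)) \<in> borel_measurable (?Q s)"
      if "i < n" for i
    proof -
      have "(\<lambda>y. masked s y i) \<in> borel_measurable (?Q s)"
        using that by (intro measurable_masked) simp
      from measurable_compose[OF this measurable_X] show ?thesis using that by (cases "i \<in> s") simp_all
    qed
    \<comment> \<open>The message no longer occurs in either comparison law. Given the relay's
      sequence \<open>y\<close>, the law of the output is common to all messages, so the bound by
      one holds pointwise in \<open>y\<close>.\<close>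
    have "(\<Sum>w<nmsg K. ?J s w) = (\<integral>\<^sup>+ y. (\<Sum>w<nmsg K. \<integral>\<^sup>+ e. hit w (?f s y e) \<partial>?P s) \<partial>?Q s)"
      using AC by (intro nn_integral_sum[symmetric] measurable_output_integral m measurable_hit) auto
    also have "\<dots> \<le> (\<integral>\<^sup>+ y. 1 \<partial>?Q s)"
      using AC by (intro nn_integral_mono sum_hit_le prob_space_PiM_gauss measurable_extend_zero) auto
    also have "\<dots> = 1"
      using prob_space.emeasure_space_1[OF prob_space_PiM_gauss[of "\<lambda>i. if i \<in> s then A else 1"]] AC
      by simp
    finally show "(\<Sum>w<nmsg K. ?J s w) \<le> 1" .
  qed simp
  also have "\<dots> = ennreal (real (card S) * (4 * exp 2 * sqrt (A * C)) ^ n)"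
    using AC by (simp add: ennreal_mult ennreal_of_nat_eq_real_of_nat)
  also have "\<dots> \<le> ennreal (2 ^ n * (4 * exp 2 * sqrt (A * C)) ^ n)"
  proof -
    have "real (card S) \<le> real (2 ^ n)" using S(2) by (rule of_nat_mono)
    then show ?thesis using AC by (intro ennreal_leI mult_right_mono) auto
  qed
  finally show ?thesis .
qed

section \<open>Averaging over the noise and the relay's private randomness\<close>

definition hits where
  "hits w = {x \<in> space (local_randomness n). case x of (u, zr, zd) \<Rightarrow> dec (out u w zr zd) = w}"

lemma prob_uniform: "prob_space (uniform_measure lborel {0..1::real})"
  by (intro prob_space_uniform_measure) auto

lemma measurable_dec_out:
  "(\<lambda>(u, zr, zd). dec (out u w zr zd)) \<in> local_randomness n \<rightarrow>\<^sub>M count_space UNIV"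
  unfolding dec_def out_def case_prod_beta
  by (rule measurable_decode_output[where n = n])
    (use ok in \<open>auto simp: n_def local_randomness_def relay_code_ok_def intro: measurable_compose\<close>)

lemma measurable_few_listens:
  "Measurable.pred noise (\<lambda>zr. 2 * card (L u w zr) \<le> n)"
proof -
  have [measurable]: "Measurable.pred noise (\<lambda>zr. relay_sends K i (hsr, u, relay_hist a \<rho> K hsr u w zr i))"
    if "i < n" for i
    using that
    by (intro measurable_sends borel_measurable_Pair measurable_relay_hist[where n = n])
      (auto intro: measurable_sends)
  have "(\<lambda>zr. \<Sum>i<n. if relay_sends K i (hsr, u, relay_hist a \<rho> K hsr u w zr i) then 0 else 1 :: nat)
      \<in> noise \<rightarrow>\<^sub>M count_space UNIV"
    by (intro measurable_sum_nat) auto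
  moreover have "(\<Sum>i<n. if relay_sends K i (hsr, u, relay_hist a \<rho> K hsr u w zr i) then 0 else 1 :: nat)
      = card (L u w zr)" for zr
  proof -
    have "L u w zr = {..<n} \<inter> - {i. relay_sends K i (hsr, u, relay_hist a \<rho> K hsr u w zr i)}"
      by (auto simp: L_def listens_def n_def)
    then show ?thesis by (simp add: sum.If_cases)
  qed
  ultimately have "(\<lambda>zr. card (L u w zr)) \<in> noise \<rightarrow>\<^sub>M count_space UNIV" by simp
  then show ?thesis by measurable
qed

lemma measurable_dec_out_pair:
  "(\<lambda>(zr, zd). dec (out u w zr zd)) \<in> noise \<Otimes>\<^sub>M noise \<rightarrow>\<^sub>M count_space UNIV"
  unfolding dec_def out_def case_prod_beta
  by (rule measurable_decode_output[where n = n])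
    (use ok in \<open>auto simp: n_def relay_code_ok_def intro: measurable_compose\<close>)

lemma hit_eq: "hit w y = indicator {w} (dec y)"
  by (simp add: hit_def indicator_def)

lemma measurable_hit_prob:
  "(\<lambda>zr. \<integral>\<^sup>+ zd. hit w (out u w zr zd) \<partial>noise) \<in> borel_measurable noise"
proof -
  interpret N: prob_space noise by (rule prob_noise)
  have "(\<lambda>p. indicator {w} (case p of (zr, zd) \<Rightarrow> dec (out u w zr zd)) :: ennreal)
      \<in> borel_measurable (noise \<Otimes>\<^sub>M noise)"
    by (rule measurable_compose[OF measurable_dec_out_pair]) simp
  then have "(\<lambda>(zr, zd). hit w (out u w zr zd)) \<in> borel_measurable (noise \<Otimes>\<^sub>M noise)"
    by (simp add: hit_eq case_prod_beta)
  then show ?thesis by (rule N.borel_measurable_nn_integral)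
qed

text \<open>Each noise realization falls under exactly one cut, according to whether the relay
  listens for at most half of the block, so the two bounds add up. The factor 2 counts the cuts;
  \<open>8 * exp 8\<close> absorbs both constants per symbol and the 2 ^ n schedules.\<close>

lemma correct_given_u_le:
  assumes u: "u \<in> {0..1}"
  shows "(\<Sum>w<nmsg K. \<integral>\<^sup>+ zr. \<integral>\<^sup>+ zd. hit w (out u w zr zd) \<partial>noise \<partial>noise) \<le>
    ennreal (2 * (8 * exp 8 * sqrt (A * C)) ^ n)"
proof -
  note [measurable] = measurable_hit_prob measurable_few_listens
  let ?I = "\<lambda>w zr. \<integral>\<^sup>+ zd. hit w (out u w zr zd) \<partial>noise"
  let ?few = "\<lambda>w zr. 2 * card (L u w zr) \<le> n"
  have "(\<Sum>w<nmsg K. \<integral>\<^sup>+ zr. ?I w zr \<partial>noise) =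
      (\<Sum>w<nmsg K. \<integral>\<^sup>+ zr. (if ?few w zr then ?I w zr else 0) + (if ?few w zr then 0 else ?I w zr) \<partial>noise)"
    by (intro sum.cong nn_integral_cong) auto
  also have "\<dots> = (\<Sum>w<nmsg K. \<integral>\<^sup>+ zr. (if ?few w zr then ?I w zr else 0) \<partial>noise) +
      (\<Sum>w<nmsg K. \<integral>\<^sup>+ zr. (if ?few w zr then 0 else ?I w zr) \<partial>noise)"
    by (subst nn_integral_add) (measurable, auto simp: sum.distrib)
  also have "\<dots> \<le> ennreal (2 ^ n * (4 * exp 2 * sqrt (A * C)) ^ n) +
      ennreal (2 ^ n * (exp 8 * sqrt (A * C)) ^ n)"
  proof (rule add_mono[OF bc_cut])
    have "(\<Sum>w<nmsg K. \<integral>\<^sup>+ zr. (if ?few w zr then 0 else ?I w zr) \<partial>noise) =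
      (\<integral>\<^sup>+ zr. (\<Sum>w<nmsg K. if ?few w zr then 0 else ?I w zr) \<partial>noise)"
      by (rule nn_integral_sum[symmetric]) measurable
    also have "\<dots> \<le> (\<integral>\<^sup>+ zr. ennreal (2 ^ n * (exp 8 * sqrt (A * C)) ^ n) \<partial>noise)"
      by (intro nn_integral_mono mac_cut u)
    also have "\<dots> = ennreal (2 ^ n * (exp 8 * sqrt (A * C)) ^ n)"
      using prob_space.emeasure_space_1[OF prob_noise] by simp
    finally show "(\<Sum>w<nmsg K. \<integral>\<^sup>+ zr. (if ?few w zr then 0 else ?I w zr) \<partial>noise) \<le> \<dots>" .
  qed
  also have "\<dots> = ennreal (2 ^ n * (4 * exp 2 * sqrt (A * C)) ^ n + 2 ^ n * (exp 8 * sqrt (A * C)) ^ n)"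
    using AC by (intro ennreal_plus[symmetric]) auto
  also have "\<dots> \<le> ennreal (2 * (8 * exp 8 * sqrt (A * C)) ^ n)"
  proof (rule ennreal_leI)
    have "(4 * exp 2 * sqrt (A * C)) ^ n \<le> (4 * exp 8 * sqrt (A * C)) ^ n"
      using AC by (intro power_mono mult_mono) auto
    moreover have "(exp 8 * sqrt (A * C)) ^ n \<le> (4 * exp 8 * sqrt (A * C)) ^ n"
      using AC by (intro power_mono mult_mono) auto
    ultimately have "2 ^ n * (4 * exp 2 * sqrt (A * C)) ^ n + 2 ^ n * (exp 8 * sqrt (A * C)) ^ n \<le>
        2 ^ n * (4 * exp 8 * sqrt (A * C)) ^ n + 2 ^ n * (4 * exp 8 * sqrt (A * C)) ^ n"
      by (intro add_mono mult_left_mono) auto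
    also have "\<dots> = 2 * (8 * exp 8 * sqrt (A * C)) ^ n"
    proof -
      have "8 * exp 8 * sqrt (A * C) = 2 * (4 * exp 8 * sqrt (A * C))" by simp
      then have "(8 * exp 8 * sqrt (A * C)) ^ n = 2 ^ n * (4 * exp 8 * sqrt (A * C)) ^ n"
        by (simp only: power_mult_distrib[of 2])
      then show ?thesis by simp
    qed
    finally show "2 ^ n * (4 * exp 2 * sqrt (A * C)) ^ n + 2 ^ n * (exp 8 * sqrt (A * C)) ^ n \<le> \<dots>" .
  qed
  finally show ?thesis .
qed

lemma sum_hits_le:
  "(\<Sum>w<nmsg K. emeasure (local_randomness n) (hits w)) \<le> ennreal (2 * (8 * exp 8 * sqrt (A * C)) ^ n)"
proof -
  let ?U = "uniform_measure lborel {0..1::real}"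
  interpret N: prob_space noise by (rule prob_noise)
  interpret NN: pair_prob_space noise noise ..
  have [measurable]: "Measurable.pred (local_randomness n) (\<lambda>x. case x of (u, zr, zd) \<Rightarrow> dec (out u w zr zd) = w)" for w
    using measurable_compose[OF measurable_dec_out, of "\<lambda>d. d = w"] by (simp add: case_prod_beta)
  let ?H = "\<lambda>w x. case x of (u, zr, zd) \<Rightarrow> hit w (out u w zr zd)"
  have H: "?H w \<in> borel_measurable (local_randomness n)" for w
  proof -
    have "(\<lambda>x. indicator {w} (case x of (u, zr, zd) \<Rightarrow> dec (out u w zr zd)) :: ennreal)
        \<in> borel_measurable (local_randomness n)"
      by (rule measurable_compose[OF measurable_dec_out]) simp
    then show ?thesis by (simp add: hit_eq case_prod_beta)
  qed
  have H': "?H w \<in> borel_measurable (?U \<Otimes>\<^sub>M (noise \<Otimes>\<^sub>M noise))" for w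
    using H[of w] by (simp add: local_randomness_def)
  have int: "(\<integral>\<^sup>+ p. ?H w (u, p) \<partial>(noise \<Otimes>\<^sub>M noise)) =
      (\<integral>\<^sup>+ zr. \<integral>\<^sup>+ zd. hit w (out u w zr zd) \<partial>noise \<partial>noise)" if "u \<in> space ?U" for w u
    using measurable_compose_Pair1[OF that H'[of w]]
    by (subst N.nn_integral_fst[symmetric]) simp_all
  have "(\<Sum>w<nmsg K. emeasure (local_randomness n) (hits w)) =
      (\<Sum>w<nmsg K. \<integral>\<^sup>+ x. ?H w x \<partial>local_randomness n)"
  proof (intro sum.cong refl)
    fix w
    have "hits w \<in> sets (local_randomness n)" unfolding hits_def by measurable
    then have "emeasure (local_randomness n) (hits w) = (\<integral>\<^sup>+ x. indicator (hits w) x \<partial>local_randomness n)"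
      by simp
    also have "\<dots> = (\<integral>\<^sup>+ x. ?H w x \<partial>local_randomness n)"
      by (intro nn_integral_cong) (auto simp: hits_def hit_def indicator_def)
    finally show "emeasure (local_randomness n) (hits w) = \<dots>" .
  qed
  also have "\<dots> = (\<integral>\<^sup>+ x. (\<Sum>w<nmsg K. ?H w x) \<partial>local_randomness n)"
    by (rule nn_integral_sum[symmetric]) (rule H)
  also have "\<dots> = (\<integral>\<^sup>+ u. \<integral>\<^sup>+ p. (\<Sum>w<nmsg K. ?H w (u, p)) \<partial>(noise \<Otimes>\<^sub>M noise) \<partial>?U)"
    unfolding local_randomness_def
    using H' by (intro NN.nn_integral_fst[symmetric] borel_measurable_sum)
  also have "\<dots> = (\<integral>\<^sup>+ u. (\<Sum>w<nmsg K. \<integral>\<^sup>+ p. ?H w (u, p) \<partial>(noise \<Otimes>\<^sub>M noise)) \<partial>?U)"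
    by (intro nn_integral_cong nn_integral_sum measurable_compose_Pair1[OF _ H'])
  also have "\<dots> = (\<integral>\<^sup>+ u. (\<Sum>w<nmsg K. \<integral>\<^sup>+ zr. \<integral>\<^sup>+ zd. hit w (out u w zr zd) \<partial>noise \<partial>noise) \<partial>?U)"
    by (intro nn_integral_cong sum.cong int refl)
  also have "\<dots> \<le> (\<integral>\<^sup>+ u. ennreal (2 * (8 * exp 8 * sqrt (A * C)) ^ n) \<partial>?U)"
    \<comment> \<open>The power constraint is available for \<open>u\<close> in the unit interval,
      which has full measure under the uniform law.\<close>
    by (intro nn_integral_mono_AE AE_uniform_measureI) (auto intro!: correct_given_u_le)
  also have "\<dots> = ennreal (2 * (8 * exp 8 * sqrt (A * C)) ^ n)"
    using prob_space.emeasure_space_1[OF prob_uniform] by simp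
  finally show ?thesis .
qed

lemma cond_error_ge:
  "1 - 2 * (8 * exp 8 * sqrt (A * C)) ^ n / real (nmsg K) \<le> cond_error a b c \<rho> K (hsr, hrd, hsd)"
proof -
  interpret LR: prob_space "local_randomness n" by (rule prob_space_local_randomness)
  have M: "nmsg K > 0" using ok by (simp add: relay_code_ok_def)
  have [measurable]: "Measurable.pred (local_randomness n) (\<lambda>x. case x of (u, zr, zd) \<Rightarrow> dec (out u w zr zd) = w)" for w
    using measurable_compose[OF measurable_dec_out, of "\<lambda>d. d = w"] by (simp add: case_prod_beta)
  have hits: "hits w \<in> sets (local_randomness n)" for w unfolding hits_def by measurable
  have "ennreal (\<Sum>w<nmsg K. measure (local_randomness n) (hits w)) =
      (\<Sum>w<nmsg K. emeasure (local_randomness n) (hits w))"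
    by (simp add: LR.emeasure_eq_measure)
  also have "\<dots> \<le> ennreal (2 * (8 * exp 8 * sqrt (A * C)) ^ n)" by (rule sum_hits_le)
  finally have le: "(\<Sum>w<nmsg K. measure (local_randomness n) (hits w)) \<le> 2 * (8 * exp 8 * sqrt (A * C)) ^ n"
    using AC by (subst (asm) ennreal_le_iff) auto
  have "cond_error a b c \<rho> K (hsr, hrd, hsd) =
      (\<Sum>w<nmsg K. measure (local_randomness n) (space (local_randomness n) - hits w)) / real (nmsg K)"
  proof -
    have "{x \<in> space (local_randomness (blocklen K)). case x of (u, zr, zd) \<Rightarrow>
        decode K ((hsr, hrd, hsd), dest_output a b c \<rho> K (hsr, hrd, hsd) u w zr zd) \<noteq> w} =
      space (local_randomness n) - hits w" for w
      by (auto simp: hits_def n_def dec_def out_def)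
    then show ?thesis by (simp add: cond_error_def n_def)
  qed
  also have "\<dots> = (\<Sum>w<nmsg K. 1 - measure (local_randomness n) (hits w)) / real (nmsg K)"
    by (simp add: LR.prob_compl[OF hits])
  also have "\<dots> = 1 - (\<Sum>w<nmsg K. measure (local_randomness n) (hits w)) / real (nmsg K)"
    using M by (simp add: sum_subtractf field_simps)
  also have "\<dots> \<ge> 1 - 2 * (8 * exp 8 * sqrt (A * C)) ^ n / real (nmsg K)"
    using le M by (intro diff_left_mono divide_right_mono) auto
  finally show ?thesis .
qed

end

section \<open>Codes from quantize-map-forward\<close>

lemma sets_fading [measurable_cong]: "sets fading = sets borel"
proof -
  have "sets (cnormal \<Otimes>\<^sub>M cnormal) = sets (borel \<Otimes>\<^sub>M borel :: (complex \<times> complex) measure)"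
    by (intro sets_pair_measure_cong) simp_all
  then have "sets fading = sets (borel \<Otimes>\<^sub>M (borel \<Otimes>\<^sub>M borel) :: gains measure)"
    unfolding fading_def by (intro sets_pair_measure_cong) simp_all
  then show ?thesis by (simp only: borel_prod)
qed

lemma space_fading [simp]: "space fading = UNIV"
  using sets_eq_imp_space_eq[OF sets_fading] by simp

lemma prob_space_fading: "prob_space fading"
proof -
  interpret C: prob_space cnormal by (rule prob_space_cnormal)
  interpret CC: pair_prob_space cnormal cnormal ..
  interpret CCC: pair_prob_space cnormal "cnormal \<Otimes>\<^sub>M cnormal" ..
  show ?thesis unfolding fading_def by (rule CCC.prob_space_axioms)
qed

lemma cond_error_bounds:
  assumes "nmsg K > 0"
  shows "0 \<le> cond_error a b c \<rho> K h" "cond_error a b c \<rho> K h \<le> 1"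
proof -
  interpret prob_space "local_randomness (blocklen K)" by (rule prob_space_local_randomness)
  show "0 \<le> cond_error a b c \<rho> K h" unfolding cond_error_def by (intro divide_nonneg_nonneg sum_nonneg) auto
  show "cond_error a b c \<rho> K h \<le> 1"
    using assms sum_mono[of "{..<nmsg K}" "\<lambda>w. prob
        {x \<in> space (local_randomness (blocklen K)).
           case x of (u, zr, zd) \<Rightarrow> decode K (h, dest_output a b c \<rho> K h u w zr zd) \<noteq> w}" "\<lambda>_. 1"]
    by (simp add: cond_error_def divide_le_eq_1_pos)
qed

text \<open>Joint measurability in code and gains is what lets the averages over codebook and fading
  be exchanged. The error is the measure of a section of a measurable set in the product with the
  local randomness.\<close>

lemma measurable_cond_error_family:
  fixes K :: "'f \<Rightarrow> relay_code"
  assumes enc: "\<And>f. enc (K f) = E" and n: "\<And>f. blocklen (K f) = n" and M: "\<And>f. nmsg (K f) = M"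
    and sends: "\<And>i. (\<lambda>(f, s). relay_sends (K f) i s) \<in> P \<Otimes>\<^sub>M borel \<rightarrow>\<^sub>M count_space UNIV"
    and sym: "\<And>i. (\<lambda>(f, s). relay_sym (K f) i s) \<in> borel_measurable (P \<Otimes>\<^sub>M borel)"
    and dec: "(\<lambda>(f, s). decode (K f) s) \<in> P \<Otimes>\<^sub>M borel \<rightarrow>\<^sub>M count_space UNIV"
  shows "(\<lambda>(f, h). cond_error a b c \<rho> (K f) h) \<in> borel_measurable (P \<Otimes>\<^sub>M fading)"
proof -
  interpret LR: prob_space "local_randomness n" by (rule prob_space_local_randomness)
  let ?N = "(P \<Otimes>\<^sub>M fading) \<Otimes>\<^sub>M local_randomness n"
  define D where "D w x = (case x of ((f, h), (u, zr, zd)) \<Rightarrow>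
      decode (K f) (h, dest_output a b c \<rho> (K f) h u w zr zd))" for w x
  have F: "(\<lambda>x. fst (fst x)) \<in> ?N \<rightarrow>\<^sub>M P" by measurable
  have comp: "(\<lambda>x. g (fst (fst x)) (s x)) \<in> ?N \<rightarrow>\<^sub>M Q"
    if "(\<lambda>(f, s). g f s) \<in> P \<Otimes>\<^sub>M borel \<rightarrow>\<^sub>M Q" "s \<in> borel_measurable ?N"
    for g :: "'f \<Rightarrow> 't::topological_space \<Rightarrow> 'q" and s Q
    using measurable_compose[OF measurable_Pair[OF F that(2)] that(1)] by simp
  have h: "(\<lambda>x. snd (fst x)) \<in> borel_measurable ?N"
    using measurable_cong_sets[OF refl sets_fading] by (auto intro: measurable_compose[OF measurable_fst])
  have D: "D w \<in> ?N \<rightarrow>\<^sub>M count_space UNIV" for w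
    unfolding D_def case_prod_beta
  proof (rule measurable_decode_output[where n = n and E = E])
    fix i :: nat and s :: "_ \<Rightarrow> complex \<times> real \<times> (nat \<Rightarrow> complex)" assume "s \<in> borel_measurable ?N"
    then show "(\<lambda>x. relay_sends (K (fst (fst x))) i (s x)) \<in> ?N \<rightarrow>\<^sub>M count_space UNIV"
      by (rule comp[OF sends])
  next
    fix i :: nat and s :: "_ \<Rightarrow> complex \<times> real \<times> (nat \<Rightarrow> complex)" assume "s \<in> borel_measurable ?N"
    then show "(\<lambda>x. relay_sym (K (fst (fst x))) i (s x)) \<in> borel_measurable ?N"
      by (rule comp[OF sym])
  next
    fix s :: "_ \<Rightarrow> gains \<times> (nat \<Rightarrow> complex)" assume "s \<in> borel_measurable ?N"
    then show "(\<lambda>x. decode (K (fst (fst x))) (s x)) \<in> ?N \<rightarrow>\<^sub>M count_space UNIV"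
      by (rule comp[OF dec])
  qed (auto simp: enc n local_randomness_def h[unfolded local_randomness_def])
  have meas: "(\<lambda>p. measure (local_randomness n) {x \<in> space (local_randomness n). D w (p, x) \<noteq> w})
      \<in> borel_measurable (P \<Otimes>\<^sub>M fading)" for w
  proof -
    have [measurable]: "Measurable.pred ?N (\<lambda>x. D w x = w)"
      using measurable_compose[OF D, of "\<lambda>d. d = w"] by simp
    have "{x \<in> space ?N. D w x \<noteq> w} \<in> sets ?N" by measurable
    from LR.measurable_emeasure_Pair[OF this]
    have "(\<lambda>p. measure (local_randomness n) (Pair p -` {x \<in> space ?N. D w x \<noteq> w}))
      \<in> borel_measurable (P \<Otimes>\<^sub>M fading)"
      unfolding measure_def by (rule measurable_compose) simp
    also have "?this \<longleftrightarrow> ?thesis"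
      by (intro measurable_cong arg_cong[where f = "measure (local_randomness n)"])
        (auto simp: space_pair_measure)
    finally show ?thesis .
  qed
  have "(\<lambda>p. (\<Sum>w<M. measure (local_randomness n) {x \<in> space (local_randomness n). D w (p, x) \<noteq> w}) / real M)
      \<in> borel_measurable (P \<Otimes>\<^sub>M fading)"
    by (intro borel_measurable_divide borel_measurable_sum meas) auto
  also have "(\<lambda>p. (\<Sum>w<M. measure (local_randomness n) {x \<in> space (local_randomness n). D w (p, x) \<noteq> w}) / real M)
      = (\<lambda>(f, h). cond_error a b c \<rho> (K f) h)"
    by (auto simp: fun_eq_iff cond_error_def n M D_def case_prod_beta)
  finally show ?thesis .
qed

lemma measurable_cond_error:
  assumes "relay_code_ok a' \<rho>' K"
  shows "cond_error a b c \<rho> K \<in> borel_measurable fading"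
proof -
  \<comment> \<open>A single code is a family indexed by a one-point space.\<close>
  have "(\<lambda>(f :: unit, h). cond_error a b c \<rho> K h) \<in> borel_measurable (count_space UNIV \<Otimes>\<^sub>M fading)"
    using assms unfolding case_prod_beta
    by (intro measurable_cond_error_family[unfolded case_prod_beta])
      (auto simp: relay_code_ok_def intro: measurable_compose[OF measurable_snd])
  from measurable_compose[OF measurable_Pair1'[of "()" "count_space UNIV"] this] show ?thesis
    by simp
qed

section \<open>Static quantize-map-forward as a random relay code\<close>

lemma prob_space_gaussian_codebook: "prob_space gaussian_codebook"
  unfolding gaussian_codebook_def by (intro prob_space_PiM prob_space_cnormal)

text \<open>Codebook positions are countably many, so the product sigma-algebra is the Borel one,
  with respect to which \<open>qmf_scheme_ok\<close> requires the decoder to be measurable.\<close>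

lemma sets_gaussian_codebook [measurable_cong]: "sets gaussian_codebook = sets borel"
proof -
  have "sets gaussian_codebook = sets (PiM UNIV (\<lambda>_. borel) :: relay_codebook measure)"
    unfolding gaussian_codebook_def by (intro sets_PiM_cong) auto
  then show ?thesis by (simp add: sets_PiM_equal_borel)
qed

lemma measurable_quantize: "quantize m \<in> borel \<rightarrow>\<^sub>M count_space UNIV"
proof -
  have coord: "(\<lambda>y::nat \<Rightarrow> complex. y i) \<in> borel_measurable borel" for i
    by (rule borel_measurable_continuous_onI) (rule continuous_on_product_coordinates)
  have [measurable]: "(\<lambda>y. round (Re (y i))) \<in> borel \<rightarrow>\<^sub>M count_space UNIV"
      "(\<lambda>y. round (Im (y i))) \<in> borel \<rightarrow>\<^sub>M count_space UNIV" for i :: nat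
    using coord[of i] unfolding round_def by measurable
  have "Measurable.pred borel (\<lambda>y. quantize m y = l)" for l
  proof -
    have "quantize m y = l \<longleftrightarrow> length l = m \<and>
        (\<forall>i<m. round (Re (y i)) = fst (l ! i) \<and> round (Im (y i)) = snd (l ! i))" for y
      by (auto simp: quantize_def list_eq_iff_nth_eq prod_eq_iff)
    then show ?thesis by simp
  qed
  then have "{y \<in> space borel. quantize m y = l} \<in> sets borel" for l by measurable
  then show ?thesis
    unfolding measurable_count_space_eq2_countable by (auto simp: vimage_def)
qed

lemma measurable_relay_codeword:
  assumes F: "F \<in> N \<rightarrow>\<^sub>M gaussian_codebook" and q: "q \<in> N \<rightarrow>\<^sub>M count_space UNIV"
  shows "(\<lambda>x. relay_codeword m (F x) (q x) i) \<in> borel_measurable N"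
proof (rule measurable_compose_countable[OF _ q])
  fix l
  have [measurable]: "(\<lambda>x. F x (l, j)) \<in> borel_measurable N" for j
  proof -
    have "(\<lambda>x. F x (l, j)) \<in> N \<rightarrow>\<^sub>M cnormal"
      by (rule measurable_compose[OF F[unfolded gaussian_codebook_def] measurable_component_singleton]) simp
    then show ?thesis by (simp cong: measurable_cong_sets)
  qed
  show "(\<lambda>x. relay_codeword m (F x) l i) \<in> borel_measurable N"
    unfolding relay_codeword_def by measurable
qed

lemma measurable_qmf_sym:
  "(\<lambda>(F, s). relay_sym (qmf_code Q F) i s) \<in> borel_measurable (gaussian_codebook \<Otimes>\<^sub>M borel)"
proof -
  have "(\<lambda>x. quantize (half_len Q) (snd (snd (snd x)))) \<in>
      gaussian_codebook \<Otimes>\<^sub>M (borel :: (complex \<times> real \<times> (nat \<Rightarrow> complex)) measure) \<rightarrow>\<^sub>M count_space UNIV"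
    by (intro measurable_compose[OF measurable_snd] measurable_compose[OF _ measurable_quantize]
      borel_measurable_continuous_onI continuous_intros)
  from measurable_relay_codeword[OF measurable_fst this] show ?thesis
    by (simp add: qmf_code_def case_prod_beta)
qed

lemma measurable_qmf_decode:
  assumes "qmf_scheme_ok Q"
  shows "(\<lambda>(F, s). decode (qmf_code Q F) s) \<in> gaussian_codebook \<Otimes>\<^sub>M borel \<rightarrow>\<^sub>M count_space UNIV"
proof -
  have dec: "qmf_decode Q \<in> borel \<rightarrow>\<^sub>M count_space UNIV" using assms by (simp add: qmf_scheme_ok_def)
  have fst: "fst \<in> gaussian_codebook \<Otimes>\<^sub>M (borel :: (gains \<times> (nat \<Rightarrow> complex)) measure) \<rightarrow>\<^sub>M borel"
    using measurable_cong_sets[OF refl sets_gaussian_codebook] measurable_fst by blast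
  have "(\<lambda>x. (fst x, snd x)) \<in> gaussian_codebook \<Otimes>\<^sub>M (borel :: (gains \<times> (nat \<Rightarrow> complex)) measure) \<rightarrow>\<^sub>M borel"
    by (intro borel_measurable_Pair fst measurable_snd)
  from measurable_compose[OF this dec] show ?thesis
    by (simp add: qmf_code_def case_prod_beta)
qed

text \<open>The constraint has to hold for every codebook, not just for typical ones. The relay is
  silent during the first half and may spend the whole budget 2 m in the second; codewords above
  that budget have been replaced by zero.\<close>

lemma qmf_code_ok:
  assumes Q: "qmf_scheme_ok Q"
  shows "relay_code_ok a \<rho> (qmf_code Q F)"
proof -
  let ?K = "qmf_code Q F" and ?m = "half_len Q"
  have K: "blocklen ?K = 2 * ?m" "nmsg ?K = qmf_nmsg Q" "enc ?K = qmf_enc Q"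
    "relay_sends ?K i s \<longleftrightarrow> ?m \<le> i" for i s by (simp_all add: qmf_code_def)
  have m: "?m > 0" using Q by (simp add: qmf_scheme_ok_def)
  have F: "(\<lambda>_. F) \<in> N \<rightarrow>\<^sub>M gaussian_codebook" for N :: "'n measure"
    by (simp add: gaussian_codebook_def space_PiM)
  have sym: "relay_sym ?K i \<in> borel_measurable borel" for i
    using measurable_compose[OF measurable_Pair[OF F measurable_ident] measurable_qmf_sym[of Q i]]
    by simp
  have dec: "decode ?K \<in> borel \<rightarrow>\<^sub>M count_space UNIV"
    using measurable_compose[OF measurable_Pair[OF F measurable_ident] measurable_qmf_decode[OF Q]]
    by simp
  have pow: "(\<Sum>i<2 * ?m. (cmod (relay_input a \<rho> ?K hsr u w z i))\<^sup>2) \<le> real (2 * ?m)" for hsr u w z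
  proof -
    define L where "L = listens a \<rho> ?K hsr u w z"
    define f where "f j = hsr * of_real (\<rho> powr (a / 2)) * qmf_enc Q w j + z j" for j
    define q where "q = quantize ?m (masked L f ?m)"
    \<comment> \<open>From time m on, the first m entries of the memory are frozen, so all symbols
      of the second half come from one and the same codeword.\<close>
    have q: "quantize ?m (masked L f i) = q" if "?m \<le> i" for i
      using that by (auto simp: q_def quantize_def masked_def)
    have inp: "relay_input a \<rho> ?K hsr u w z i = (if ?m \<le> i then relay_codeword ?m F q (i - ?m) else 0)"
      if "i < 2 * ?m" for i
    proof (cases "?m \<le> i")
      case True
      have "relay_input a \<rho> ?K hsr u w z i =
          relay_codeword ?m F (quantize ?m (relay_hist a \<rho> ?K hsr u w z i)) (i - ?m)"
        using True by (simp add: relay_input_def K(4)) (simp add: qmf_code_def)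
      also have "relay_hist a \<rho> ?K hsr u w z i = masked L f i"
        using that by (subst relay_hist_eq_masked) (simp_all add: K L_def f_def[abs_def])
      finally show ?thesis using True by (simp add: q)
    next
      case False
      then show ?thesis by (simp add: relay_input_def K(4))
    qed
    have "(\<Sum>i<2 * ?m. (cmod (relay_input a \<rho> ?K hsr u w z i))\<^sup>2) =
        (\<Sum>i\<in>{?m..<?m + ?m}. (cmod (relay_codeword ?m F q (i - ?m)))\<^sup>2)"
      by (rule sum.mono_neutral_cong_right) (auto simp: inp)
    also have "\<dots> = (\<Sum>j<?m. (cmod (relay_codeword ?m F q j))\<^sup>2)"
      using sum.shift_bounds_nat_ivl[of "\<lambda>i. (cmod (relay_codeword ?m F q (i - ?m)))\<^sup>2" 0 ?m ?m]
      by (simp add: lessThan_atLeast0)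
    also have "\<dots> \<le> 2 * real ?m"
      by (cases "(\<Sum>j<?m. (cmod (F (q, j)))\<^sup>2) \<le> 2 * real ?m") (simp_all add: relay_codeword_def)
    finally show ?thesis by simp
  qed
  show ?thesis
    unfolding relay_code_ok_def K(1-3)
  proof (intro conjI allI ballI impI)
    show "relay_sends ?K i \<in> borel \<rightarrow>\<^sub>M count_space UNIV" for i by (simp add: qmf_code_def)
    show "(\<Sum>i<2 * ?m. (cmod (relay_input a \<rho> ?K hsr u w z i))\<^sup>2) / real (2 * ?m) \<le> 1" for hsr u w z
      using pow[of hsr u w z] m by (simp add: divide_le_eq_1_pos)
  qed (use Q sym dec in \<open>auto simp: qmf_scheme_ok_def\<close>)
qed

text \<open>Random coding: by Fubini the error averaged over codebooks equals the integral of
  \<open>qmf_cond_error\<close>, and some codebook is no worse than the average.\<close>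

lemma qmf_error_average:
  assumes Q: "qmf_scheme_ok Q"
  shows "qmf_cond_error a b c \<rho> Q \<in> borel_measurable fading"
    and "\<exists>F. error_prob a b c \<rho> (qmf_code Q F) \<le> (\<integral>h. qmf_cond_error a b c \<rho> Q h \<partial>fading)"
proof -
  interpret G: prob_space gaussian_codebook by (rule prob_space_gaussian_codebook)
  interpret H: prob_space fading by (rule prob_space_fading)
  interpret GH: pair_prob_space gaussian_codebook fading ..
  let ?f = "\<lambda>F h. cond_error a b c \<rho> (qmf_code Q F) h"
  have meas: "(\<lambda>(F, h). ?f F h) \<in> borel_measurable (gaussian_codebook \<Otimes>\<^sub>M fading)"
    by (rule measurable_cond_error_family[OF _ _ _ _ measurable_qmf_sym measurable_qmf_decode[OF Q]])
      (simp_all add: qmf_code_def)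
  have bnd: "0 \<le> ?f F h" "?f F h \<le> 1" for F h
    using qmf_code_ok[OF Q, of 0 0 F] by (auto intro!: cond_error_bounds simp: relay_code_ok_def)
  have int: "integrable (gaussian_codebook \<Otimes>\<^sub>M fading) (\<lambda>(F, h). ?f F h)"
    by (rule GH.integrable_const_bound[where B = 1]) (use meas bnd in auto)
  show "qmf_cond_error a b c \<rho> Q \<in> borel_measurable fading"
    unfolding qmf_cond_error_def
    using meas by (intro G.borel_measurable_lebesgue_integral measurable_pair_swap) (simp_all add: case_prod_beta)
  have intF: "integrable gaussian_codebook (\<lambda>F. \<integral>h. ?f F h \<partial>fading)"
    using GH.integrable_fst[OF int] .
  define I where "I = (\<integral>h. qmf_cond_error a b c \<rho> Q h \<partial>fading)"
  have I: "(\<integral>F. (\<integral>h. ?f F h \<partial>fading) \<partial>gaussian_codebook) = I"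
    using GH.Fubini_integral[OF int] by (simp add: I_def qmf_cond_error_def)
  show "\<exists>F. error_prob a b c \<rho> (qmf_code Q F) \<le> I"
  proof (rule ccontr)
    assume "\<not> ?thesis"
    then have gt: "I < (\<integral>h. ?f F h \<partial>fading)" for F by (auto simp: error_prob_def not_le)
    have "(\<integral>F. I \<partial>gaussian_codebook) < (\<integral>F. (\<integral>h. ?f F h \<partial>fading) \<partial>gaussian_codebook)"
      using gt by (intro G.integral_less_AE_space intF) (auto simp: G.emeasure_space_1)
    then show False by (simp add: I G.prob_space)
  qed
qed

text \<open>At fixed \<rho>, the error off the outage event tends to 0 along the schemes by
  dominated convergence, and on the outage event it is at most 1. First a scheme is chosen for the
  tolerance \<delta>, then a codebook for that scheme. A rate deviation of 1 vanishes after division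
  by ln \<rho>.\<close>

lemma qmf_good_code:
  assumes sup: "qmf_supports a b c S" and S: "S \<rho> \<in> borel_measurable borel"
    and "\<rho> > 1" "R \<ge> 0" and \<delta>: "\<delta> > 0"
  shows "\<exists>K. relay_code_ok a \<rho> K \<and> \<bar>code_rate K - R\<bar> \<le> 1 \<and>
    error_prob a b c \<rho> K \<le> measure fading {h. S \<rho> h \<le> R} + \<delta>"
proof -
  interpret H: prob_space fading by (rule prob_space_fading)
  obtain Q where Q: "\<And>k. qmf_scheme_ok (Q k)" and rate: "(\<lambda>k. qmf_rate (Q k)) \<longlonglongrightarrow> R"
    and lim: "AE h in fading. R < S \<rho> h \<longrightarrow> (\<lambda>k. qmf_cond_error a b c \<rho> (Q k) h) \<longlonglongrightarrow> 0"
    using sup assms(3,4) unfolding qmf_supports_def by blast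
  let ?f = "\<lambda>k h. qmf_cond_error a b c \<rho> (Q k) h"
  have [measurable]: "S \<rho> \<in> borel_measurable fading"
    using S measurable_cong_sets[OF sets_fading refl] by blast
  have [measurable]: "?f k \<in> borel_measurable fading" for k by (rule qmf_error_average(1)[OF Q])
  have bnd: "0 \<le> ?f k h" "?f k h \<le> 1" for k h
  proof -
    interpret G: prob_space gaussian_codebook by (rule prob_space_gaussian_codebook)
    have b: "0 \<le> cond_error a b c \<rho> (qmf_code (Q k) F) h" "cond_error a b c \<rho> (qmf_code (Q k) F) h \<le> 1" for F
      using qmf_code_ok[OF Q, of 0 0 k F] by (auto intro!: cond_error_bounds simp: relay_code_ok_def)
    show "0 \<le> ?f k h" unfolding qmf_cond_error_def by (intro Bochner_Integration.integral_nonneg b)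
    show "?f k h \<le> 1" unfolding qmf_cond_error_def
      by (rule order_trans[OF Bochner_Integration.integral_mono'[of _ "\<lambda>_. 1"]]) (use b in \<open>auto simp: G.prob_space\<close>)
  qed
  \<comment> \<open>The error is cut off on the outage event, where no convergence is known.\<close>
  define g where "g k h = (if R < S \<rho> h then ?f k h else 0)" for k h
  have [measurable]: "g k \<in> borel_measurable fading" for k unfolding g_def by measurable
  have "(\<lambda>k. \<integral>h. g k h \<partial>fading) \<longlonglongrightarrow> (\<integral>h. 0 \<partial>fading)"
  proof (rule integral_dominated_convergence[where w = "\<lambda>_. 1"])
    show "AE h in fading. (\<lambda>k. g k h) \<longlonglongrightarrow> 0"
      using lim
    proof eventually_elim
      case (elim h)
      then show ?case by (cases "R < S \<rho> h") (simp_all add: g_def)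
    qed
  qed (use bnd in \<open>auto simp: g_def\<close>)
  then have "(\<lambda>k. \<integral>h. g k h \<partial>fading) \<longlonglongrightarrow> 0" by simp
  from order_tendstoD(2)[OF this \<delta>] tendstoD[OF rate, of 1]
  have "\<forall>\<^sub>F k in sequentially. (\<integral>h. g k h \<partial>fading) < \<delta> \<and> dist (qmf_rate (Q k)) R < 1"
    by (simp add: eventually_conj)
  then obtain k where k: "(\<integral>h. g k h \<partial>fading) < \<delta>" "dist (qmf_rate (Q k)) R < 1"
    by (auto simp: eventually_sequentially)
  obtain F where F: "error_prob a b c \<rho> (qmf_code (Q k) F) \<le> (\<integral>h. ?f k h \<partial>fading)"
    using qmf_error_average(2)[OF Q] by blast
  have "(\<integral>h. ?f k h \<partial>fading) \<le> (\<integral>h. g k h + indicator {h. S \<rho> h \<le> R} h \<partial>fading)"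
  proof (rule Bochner_Integration.integral_mono)
    show "integrable fading (?f k)"
      by (rule H.integrable_const_bound[where B = 1]) (use bnd in auto)
    show "integrable fading (\<lambda>h. g k h + indicator {h. S \<rho> h \<le> R} h)"
    proof (rule H.integrable_const_bound[where B = 2])
      have "\<bar>g k h + indicator {h. S \<rho> h \<le> R} h\<bar> \<le> 2" for h
        using bnd[of k h] by (auto simp: g_def indicator_def)
      then show "AE h in fading. norm (g k h + indicator {h. S \<rho> h \<le> R} h) \<le> 2" by simp
    qed measurable
  qed (use bnd in \<open>auto simp: g_def indicator_def\<close>)
  also have "\<dots> = (\<integral>h. g k h \<partial>fading) + measure fading {h. S \<rho> h \<le> R}"
  proof -
    have "integrable fading (g k)"
      by (rule H.integrable_const_bound[where B = 1]) (use bnd in \<open>auto simp: g_def\<close>)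
    moreover have m: "{h. S \<rho> h \<le> R} \<in> sets fading"
      using measurable_sets[of "S \<rho>" fading borel "{..R}"] by (simp add: vimage_def)
    moreover have "integrable fading (indicator {h. S \<rho> h \<le> R} :: gains \<Rightarrow> real)"
      using m by (simp add: H.emeasure_eq_measure)
    ultimately show ?thesis by simp
  qed
  finally have "error_prob a b c \<rho> (qmf_code (Q k) F) \<le> measure fading {h. S \<rho> h \<le> R} + \<delta>"
    using F k(1) by simp
  moreover have "\<bar>code_rate (qmf_code (Q k) F) - R\<bar> \<le> 1"
    using k(2) by (simp add: code_rate_def qmf_rate_def qmf_code_def dist_real_def)
  ultimately show ?thesis using qmf_code_ok[OF Q] by blast
qed

section \<open>Small gains\<close>

text \<open>The density is at most 1 / pi and the disc has area pi * x.\<close>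

lemma measure_cnormal_disc_le:
  assumes "x \<ge> 0"
  shows "measure cnormal {z. (cmod z)\<^sup>2 \<le> x} \<le> x"
proof -
  have disc: "{z. (cmod z)\<^sup>2 \<le> x} = cball 0 (sqrt x)"
  proof -
    have "(cmod z)\<^sup>2 \<le> x \<longleftrightarrow> cmod z \<le> sqrt x" for z
      using assms real_sqrt_le_iff[of "(cmod z)\<^sup>2" x] by simp
    then show ?thesis by (simp only: set_eq_iff mem_Collect_eq mem_cball_0 simp_thms)
  qed
  have "emeasure cnormal (cball 0 (sqrt x)) =
      (\<integral>\<^sup>+ z. ennreal (exp (- (cmod z)\<^sup>2) / pi) * indicator (cball 0 (sqrt x)) z \<partial>lborel)"
    unfolding cnormal_def by (intro emeasure_density) auto
  also have "\<dots> \<le> (\<integral>\<^sup>+ z. ennreal (1 / pi) * indicator (cball (0::complex) (sqrt x)) z \<partial>lborel)"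
    by (intro nn_integral_mono mult_right_mono ennreal_leI divide_right_mono) auto
  also have "\<dots> = ennreal (1 / pi) * emeasure lborel (cball (0::complex) (sqrt x))"
    by (simp add: nn_integral_cmult_indicator)
  also have "\<dots> = ennreal x"
    using assms by (subst emeasure_cball) (auto simp: unit_ball_vol_2 ennreal_mult'[symmetric])
  finally show ?thesis
    unfolding disc using assms by (simp add: measure_def enn2real_leI)
qed

text \<open>Inside the unit disc the density is at least 1 / (3 * pi), and the annulus has area 3 *
  pi * x / 4. An annulus is needed because the converse wants the source-relay gain small but still
  above the direct one.\<close>

lemma measure_cnormal_annulus_ge:
  assumes "0 \<le> x" "x \<le> 1"
  shows "x / 4 \<le> measure cnormal {z. x / 4 \<le> (cmod z)\<^sup>2 \<and> (cmod z)\<^sup>2 \<le> x}"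
proof -
  interpret prob_space cnormal by (rule prob_space_cnormal)
  define S where "S = cball (0::complex) (sqrt x) - ball 0 (sqrt x / 2)"
  have S: "S = {z. x / 4 \<le> (cmod z)\<^sup>2 \<and> (cmod z)\<^sup>2 \<le> x}"
  proof -
    have "x / 4 \<le> (cmod z)\<^sup>2 \<longleftrightarrow> sqrt x / 2 \<le> cmod z" for z
      using assms real_sqrt_le_iff[of "x / 4" "(cmod z)\<^sup>2"] by (simp add: real_sqrt_divide)
    moreover have "(cmod z)\<^sup>2 \<le> x \<longleftrightarrow> cmod z \<le> sqrt x" for z
      using assms real_sqrt_le_iff[of "(cmod z)\<^sup>2" x] by simp
    ultimately show ?thesis
      by (simp only: S_def set_eq_iff Diff_iff mem_Collect_eq mem_cball_0 mem_ball_0 not_less) blast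
  qed
  have [measurable]: "S \<in> sets borel" by (auto simp: S_def)
  have e: "exp (- 1 :: real) \<ge> 1 / 3"
    using exp_le by (simp add: exp_minus field_simps)
  have sub: "ball (0::complex) (sqrt x / 2) \<subseteq> cball 0 (sqrt x)"
    using assms by (intro order_trans[OF ball_subset_cball] subset_cball) auto
  have "emeasure lborel S = emeasure lborel (cball (0::complex) (sqrt x)) - emeasure lborel (ball (0::complex) (sqrt x / 2))"
    unfolding S_def using sub by (intro emeasure_Diff) (auto simp: emeasure_ball assms)
  also have "\<dots> = ennreal (pi * x - pi * (x / 4))"
    using assms by (simp add: emeasure_cball emeasure_ball unit_ball_vol_2 power_divide ennreal_minus)
  finally have area: "emeasure lborel S = ennreal (pi * (3 * x / 4))" by (simp add: algebra_simps)
  have "ennreal (x / 4) \<le> ennreal (1 / 3 / pi) * emeasure lborel S"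
    using assms by (simp add: area ennreal_mult'[symmetric])
  also have "\<dots> = (\<integral>\<^sup>+ z. ennreal (1 / 3 / pi) * indicator S z \<partial>lborel)"
    by (simp add: nn_integral_cmult_indicator)
  also have "\<dots> \<le> (\<integral>\<^sup>+ z. ennreal (exp (- (cmod z)\<^sup>2) / pi) * indicator S z \<partial>lborel)"
  proof (rule nn_integral_mono)
    fix z :: complex
    show "ennreal (1 / 3 / pi) * indicator S z \<le> ennreal (exp (- (cmod z)\<^sup>2) / pi) * indicator S z"
    proof (cases "z \<in> S")
      case True
      then have "(cmod z)\<^sup>2 \<le> 1" using S assms by auto
      then have "exp (- 1) \<le> exp (- (cmod z)\<^sup>2)" by simp
      with e have "1 / 3 \<le> exp (- (cmod z)\<^sup>2)" by linarith
      then have "1 / 3 / pi \<le> exp (- (cmod z)\<^sup>2) / pi" by (intro divide_right_mono) auto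
      then have "ennreal (1 / 3 / pi) \<le> ennreal (exp (- (cmod z)\<^sup>2) / pi)" by (rule ennreal_leI)
      then show ?thesis using True by (simp only: indicator_simps mult_1_right)
    qed simp
  qed
  also have "\<dots> = emeasure cnormal S"
    unfolding cnormal_def by (intro emeasure_density[symmetric]) auto
  finally show ?thesis by (simp add: emeasure_eq_measure S)
qed

lemma measure_fading_box:
  assumes "A \<in> sets borel" "B \<in> sets borel" "D \<in> sets borel"
  shows "measure fading {h. fst h \<in> A \<and> fst (snd h) \<in> B \<and> snd (snd h) \<in> D} =
    measure cnormal A * measure cnormal B * measure cnormal D"
proof -
  interpret C: prob_space cnormal by (rule prob_space_cnormal)
  interpret CC: pair_prob_space cnormal cnormal ..
  have "{h. fst h \<in> A \<and> fst (snd h) \<in> B \<and> snd (snd h) \<in> D} = A \<times> (B \<times> D)" by auto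
  moreover have "emeasure fading (A \<times> (B \<times> D)) = emeasure cnormal A * (emeasure cnormal B * emeasure cnormal D)"
    unfolding fading_def using assms
    by (subst CC.emeasure_pair_measure_Times)
      (auto simp: C.emeasure_pair_measure_Times intro!: pair_measureI)
  ultimately show ?thesis
    by (simp add: measure_def enn2real_mult mult.assoc)
qed

text \<open>On a logarithmic scale the region below the hyperbola is covered by a staircase of
  \<open>N\<close> rectangles, each with side product t powr (1 - 1 / N). A point missed by every
  rectangle climbs the stairs: X \<le> t powr (j / N) forces a lower bound on \<open>Z\<close>,
  which by the product bound gives the next level for \<open>X\<close>, until X \<le> t.\<close>

lemma small_product_cases:
  fixes X Z t :: real and N :: nat
  assumes "0 \<le> X" "0 \<le> Z" "0 < t" "t \<le> 1" "X * Z \<le> t" "N > 0"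
  shows "X \<le> t \<or> Z \<le> t \<or> (\<exists>j<N. X \<le> t powr (j / N) \<and> Z \<le> t powr (1 - (real j + 1) / real N))"
proof (rule ccontr)
  assume "\<not> ?thesis"
  then have X: "X > t" and Z: "Z > t"
    and no: "\<And>j. j < N \<Longrightarrow> X \<le> t powr (j / N) \<Longrightarrow> Z > t powr (1 - (real j + 1) / real N)"
    by (auto simp: not_le)
  have "X \<le> t powr (j / N)" if "j \<le> N" for j :: nat
    using that
  proof (induction j)
    case 0
    \<comment> \<open>Z > t together with X * Z \<le> t gives X \<le> 1, the lowest level.\<close>
    have "X * t \<le> X * Z" using Z assms by (intro mult_left_mono) auto
    then have "X * t \<le> 1 * t" using assms(5) by linarith
    then have "X \<le> 1" using assms(3) by (rule mult_right_le_imp_le)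
    then show ?case using assms by simp
  next
    case (Suc j)
    then have "Z > t powr (1 - (real j + 1) / real N)" by (intro no) auto
    then have "X * t powr (1 - (real j + 1) / real N) \<le> X * Z" using assms by (intro mult_left_mono) auto
    also have "\<dots> \<le> t" by fact
    finally have "X \<le> t / t powr (1 - (real j + 1) / real N)" using assms by (simp add: field_simps)
    also have "\<dots> = t powr (Suc j / N)"
      using assms powr_diff[of t 1 "1 - (real j + 1) / real N"] by (simp add: add.commute)
    finally show ?case .
  qed
  from this[of N] have "X \<le> t" using assms by simp
  with X show False by simp
qed

text \<open>The slightly worse exponent \<open>1 - 1/N\<close> stands in for the true order \<open>t ln (1/t)\<close>.\<close>

lemma (in prob_space) prob_small_product_le:
  fixes U V :: "'a \<Rightarrow> real"
  assumes [measurable]: "U \<in> borel_measurable M" "V \<in> borel_measurable M"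
    and nonneg: "\<And>x. 0 \<le> U x" "\<And>x. 0 \<le> V x"
    and U: "\<And>u. 0 \<le> u \<Longrightarrow> prob {x \<in> space M. U x \<le> u} \<le> u"
    and V: "\<And>v. 0 \<le> v \<Longrightarrow> prob {x \<in> space M. V x \<le> v} \<le> v"
    and UV: "\<And>u v. 0 \<le> u \<Longrightarrow> 0 \<le> v \<Longrightarrow> prob {x \<in> space M. U x \<le> u \<and> V x \<le> v} \<le> u * v"
    and t: "0 < t" "t \<le> 1" and N: "N > 0"
  shows "prob {x \<in> space M. U x * V x \<le> t} \<le> (real N + 2) * t powr (1 - 1 / real N)"
proof -
  let ?B = "\<lambda>j. {x \<in> space M. U x \<le> t powr (real j / real N) \<and> V x \<le> t powr (1 - (real j + 1) / real N)}"
  have "prob {x \<in> space M. U x * V x \<le> t} \<le>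
      prob ({x \<in> space M. U x \<le> t} \<union> ({x \<in> space M. V x \<le> t} \<union> (\<Union>j<N. ?B j)))"
  proof (rule finite_measure_mono)
    show "{x \<in> space M. U x * V x \<le> t} \<subseteq>
        {x \<in> space M. U x \<le> t} \<union> ({x \<in> space M. V x \<le> t} \<union> (\<Union>j<N. ?B j))"
      using small_product_cases[OF nonneg t _ N] by auto
  qed measurable
  also have "\<dots> \<le> prob {x \<in> space M. U x \<le> t} + prob ({x \<in> space M. V x \<le> t} \<union> (\<Union>j<N. ?B j))"
    by (intro measure_Un_le) measurable
  also have "\<dots> \<le> prob {x \<in> space M. U x \<le> t} + (prob {x \<in> space M. V x \<le> t} + prob (\<Union>j<N. ?B j))"
    by (intro add_left_mono measure_Un_le) measurable
  also have "\<dots> \<le> t + (t + (\<Sum>j<N. t powr (1 - 1 / real N)))"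
  proof (intro add_mono U V)
    have "prob (\<Union>j<N. ?B j) \<le> (\<Sum>j<N. prob (?B j))"
      by (intro measure_UNION_le) auto
    also have "\<dots> \<le> (\<Sum>j<N. t powr (1 - 1 / real N))"
    proof (rule sum_mono)
      fix j
      have "prob (?B j) \<le> t powr (real j / real N) * t powr (1 - (real j + 1) / real N)"
        by (intro UV) auto
      also have "\<dots> = t powr (1 - 1 / real N)"
        using t by (simp add: powr_add[symmetric] add_divide_distrib)
      finally show "prob (?B j) \<le> t powr (1 - 1 / real N)" .
    qed
    finally show "prob (\<Union>j<N. ?B j) \<le> (\<Sum>j<N. t powr (1 - 1 / real N))" .
  qed (use t in auto)
  also have "\<dots> = 2 * t + real N * t powr (1 - 1 / real N)" by simp
  also have "t \<le> t powr (1 - 1 / real N)"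
    using powr_mono'[of "1 - 1 / real N" 1 t] t N by simp
  then have "2 * t + real N * t powr (1 - 1 / real N) \<le> (real N + 2) * t powr (1 - 1 / real N)"
    by (simp add: algebra_simps)
  finally show ?thesis .
qed

lemma measurable_cmod_power2:
  "(\<lambda>h. (cmod (fst h))\<^sup>2) \<in> borel_measurable fading"
  "(\<lambda>h. (cmod (fst (snd h)))\<^sup>2) \<in> borel_measurable fading"
  "(\<lambda>h. (cmod (snd (snd h)))\<^sup>2) \<in> borel_measurable fading"
  unfolding measurable_cong_sets[OF sets_fading refl]
  by (intro borel_measurable_continuous_onI continuous_intros)+

lemma measure_fading_small_product_le:
  fixes f :: "gains \<Rightarrow> complex"
  assumes f: "f = fst \<or> f = (\<lambda>h. fst (snd h))" and t: "0 < t" "t \<le> 1" and N: "N > 0"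
  shows "measure fading {h. (cmod (f h))\<^sup>2 * (cmod (snd (snd h)))\<^sup>2 \<le> t} \<le>
    (real N + 2) * t powr (1 - 1 / real N)"
proof -
  interpret C: prob_space cnormal by (rule prob_space_cnormal)
  interpret H: prob_space fading by (rule prob_space_fading)
  let ?D = "\<lambda>u. {z. (cmod z)\<^sup>2 \<le> u}"
  have disc [measurable]: "?D u \<in> sets borel" for u :: real
    by measurable
  have C1: "measure cnormal UNIV = 1" using C.prob_space by simp
  have box: "measure fading {h. (cmod (f h))\<^sup>2 \<le> u \<and> (cmod (snd (snd h)))\<^sup>2 \<le> v} =
      measure cnormal (?D u) * measure cnormal (?D v)" for u v
    using f
  proof
    assume "f = fst"
    then show ?thesis
      using measure_fading_box[of "?D u" UNIV "?D v"] C1 by simp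
  next
    assume "f = (\<lambda>h. fst (snd h))"
    then show ?thesis
      using measure_fading_box[of UNIV "?D u" "?D v"] C1 by simp
  qed
  have U: "measure fading {h. (cmod (f h))\<^sup>2 \<le> u} = measure cnormal (?D u)" for u
    using f
  proof
    assume "f = fst"
    then show ?thesis
      using measure_fading_box[of "?D u" UNIV UNIV] C1 by simp
  next
    assume "f = (\<lambda>h. fst (snd h))"
    then show ?thesis
      using measure_fading_box[of UNIV "?D u" UNIV] C1 by simp
  qed
  have V: "measure fading {h. (cmod (snd (snd h)))\<^sup>2 \<le> u} = measure cnormal (?D u)" for u
    using measure_fading_box[of UNIV UNIV "?D u"] C1 by simp
  have fm: "(\<lambda>h. (cmod (f h))\<^sup>2) \<in> borel_measurable fading"
    using f measurable_cmod_power2(1,2) by auto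
  have "H.prob {h \<in> space fading. (cmod (f h))\<^sup>2 * (cmod (snd (snd h)))\<^sup>2 \<le> t} \<le>
    (real N + 2) * t powr (1 - 1 / real N)"
    using t N
    by (intro H.prob_small_product_le fm measurable_cmod_power2)
      (auto simp: box U V intro!: mult_mono measure_cnormal_disc_le)
  then show ?thesis by simp
qed

section \<open>Diversity gains\<close>

lemma eventually_less_ln: "\<forall>\<^sub>F \<rho> in at_top. (k::real) < ln \<rho>"
  using ln_at_top by (simp add: filterlim_at_top_dense)

lemma eventually_less_powr:
  assumes "\<epsilon> > 0"
  shows "\<forall>\<^sub>F \<rho> in at_top. (k::real) < \<rho> powr \<epsilon>"
  using eventually_less_ln[of "k / \<epsilon>"] eventually_gt_at_top[of 0]
proof eventually_elim
  case (elim \<rho>)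
  then have "k < 1 + \<epsilon> * ln \<rho>" using assms by (simp add: pos_divide_less_eq mult.commute)
  also have "\<dots> \<le> \<rho> powr \<epsilon>" using elim by (simp add: powr_def exp_ge_add_one_self)
  finally show ?case .
qed

lemma multiplexing_gain_bounds:
  assumes "has_multiplexing_gain R r" "\<epsilon> > 0"
  shows "\<forall>\<^sub>F \<rho> in at_top. (r - \<epsilon>) * ln \<rho> < R \<rho>" "\<forall>\<^sub>F \<rho> in at_top. R \<rho> < (r + \<epsilon>) * ln \<rho>"
proof -
  have lim: "((\<lambda>\<rho>. R \<rho> / ln \<rho>) \<longlongrightarrow> r) at_top"
    using assms(1) by (simp add: has_multiplexing_gain_def)
  show "\<forall>\<^sub>F \<rho> in at_top. (r - \<epsilon>) * ln \<rho> < R \<rho>"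
    using order_tendstoD(1)[OF lim, of "r - \<epsilon>", simplified, OF assms(2)] eventually_less_ln[of 0]
    by eventually_elim (simp add: pos_less_divide_eq)
  show "\<forall>\<^sub>F \<rho> in at_top. R \<rho> < (r + \<epsilon>) * ln \<rho>"
    using order_tendstoD(2)[OF lim, of "r + \<epsilon>", simplified, OF assms(2)] eventually_less_ln[of 0]
    by eventually_elim (simp add: pos_divide_less_eq)
qed

text \<open>The lower bound also keeps \<open>P\<close> eventually positive, so that
  \<open>elog\<close> agrees with \<open>ln\<close> and the real limit carries over.\<close>

lemma has_diversity_gainI:
  assumes lower: "\<And>\<epsilon>. \<epsilon> > 0 \<Longrightarrow> \<forall>\<^sub>F \<rho> in at_top. \<rho> powr (- d - \<epsilon>) \<le> P \<rho>"
    and upper: "\<And>\<epsilon>. \<epsilon> > 0 \<Longrightarrow> \<forall>\<^sub>F \<rho> in at_top. P \<rho> \<le> \<rho> powr (- d + \<epsilon>)"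
  shows "has_diversity_gain P (ereal d)"
proof -
  have "((\<lambda>\<rho>. ln (P \<rho>) / ln \<rho>) \<longlongrightarrow> - d) at_top"
  proof (rule tendstoI)
    fix e :: real assume "e > 0"
    then have e: "e / 2 > 0" by simp
    show "\<forall>\<^sub>F \<rho> in at_top. dist (ln (P \<rho>) / ln \<rho>) (- d) < e"
      using lower[OF e] upper[OF e] eventually_gt_at_top[of 1]
    proof eventually_elim
      case (elim \<rho>)
      have ln: "ln \<rho> > 0" and pos: "\<rho> powr (- d - e / 2) > 0" using elim by auto
      have P: "P \<rho> > 0" using elim(1) pos by linarith
      have "ln (\<rho> powr (- d - e / 2)) \<le> ln (P \<rho>)" using elim(1) pos P by (simp only: ln_le_cancel_iff)
      moreover have "ln (P \<rho>) \<le> ln (\<rho> powr (- d + e / 2))" using elim(2) P by (intro ln_mono) auto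
      ultimately have "- d - e / 2 \<le> ln (P \<rho>) / ln \<rho>" "ln (P \<rho>) / ln \<rho> \<le> - d + e / 2"
        using ln elim(3) by (simp_all add: ln_powr pos_le_divide_eq pos_divide_le_eq)
      then show ?case using \<open>e > 0\<close> by (simp add: dist_real_def abs_less_iff)
    qed
  qed
  then have lim: "((\<lambda>\<rho>. ereal (ln (P \<rho>) / ln \<rho>)) \<longlongrightarrow> ereal (- d)) at_top" by simp
  have "\<forall>\<^sub>F \<rho> in at_top. ereal (ln (P \<rho>) / ln \<rho>) = elog (P \<rho>) / ereal (ln \<rho>)"
    using lower[of 1, OF zero_less_one] eventually_gt_at_top[of 1]
  proof eventually_elim
    case (elim \<rho>)
    then have "\<rho> powr (- d - 1) > 0" by simp
    with elim have "P \<rho> > 0" by linarith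
    then show ?case using elim by (simp add: elog_def)
  qed
  from Lim_transform_eventually[OF lim this] show ?thesis
    unfolding has_diversity_gain_def by simp
qed

lemma has_diversity_gain_le:
  assumes gain: "has_diversity_gain P d'"
    and lower: "\<And>\<epsilon>. \<epsilon> > 0 \<Longrightarrow> \<forall>\<^sub>F \<rho> in at_top. \<rho> powr (- d - \<epsilon>) \<le> P \<rho>"
  shows "d' \<le> ereal d"
proof (rule ereal_le_epsilon2)
  fix e :: real assume e: "e > 0"
  have "\<forall>\<^sub>F \<rho> in at_top. ereal (- d - e) \<le> elog (P \<rho>) / ereal (ln \<rho>)"
    using lower[OF e] eventually_gt_at_top[of 1]
  proof eventually_elim
    case (elim \<rho>)
    have ln: "ln \<rho> > 0" and pos: "\<rho> powr (- d - e) > 0" using elim by auto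
    have P: "P \<rho> > 0" using elim(1) pos by linarith
    have "ln (\<rho> powr (- d - e)) \<le> ln (P \<rho>)" using elim(1) pos P by (simp only: ln_le_cancel_iff)
    then show ?case using P ln elim by (simp add: elog_def ln_powr pos_le_divide_eq)
  qed
  then have "ereal (- d - e) \<le> - d'"
    using gain unfolding has_diversity_gain_def
    by (intro tendsto_lowerbound) auto
  then show "d' \<le> ereal d + ereal e" by (cases d') auto
qed

text \<open>The dominant error event: the direct link is weak enough that the two cut values add up to
  less than \<open>2 r\<close>. The lower bound on the source-relay gain only keeps that link stronger than the
  direct one.\<close>

definition weak_gains :: "real \<Rightarrow> real \<Rightarrow> real \<Rightarrow> gains set" where
  "weak_gains e d \<rho> = {h. \<rho> powr - e / 4 \<le> (cmod (fst h))\<^sup>2 \<and> (cmod (fst h))\<^sup>2 \<le> \<rho> powr - e \<and>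
     (cmod (fst (snd h)))\<^sup>2 \<le> \<rho> powr - e \<and> (cmod (snd (snd h)))\<^sup>2 \<le> \<rho> powr - d}"

lemma sets_weak_gains: "weak_gains e d \<rho> \<in> sets fading"
proof -
  note [measurable] = measurable_cmod_power2
  have "{h \<in> space fading. \<rho> powr - e / 4 \<le> (cmod (fst h))\<^sup>2 \<and> (cmod (fst h))\<^sup>2 \<le> \<rho> powr - e \<and>
     (cmod (fst (snd h)))\<^sup>2 \<le> \<rho> powr - e \<and> (cmod (snd (snd h)))\<^sup>2 \<le> \<rho> powr - d} \<in> sets fading"
    by measurable
  then show ?thesis by (simp add: weak_gains_def)
qed

text \<open>The gains are independent and each event has at least a quarter of its nominal
  probability, whence 1/64. Both relay gains are lowered by \<open>e\<close>, which costs 2 * e in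
  the exponent.\<close>

lemma measure_weak_gains_ge:
  assumes "\<rho> > 1" "e \<ge> 0" "d \<ge> 0"
  shows "\<rho> powr (- d - 2 * e) / 64 \<le> measure fading (weak_gains e d \<rho>)"
proof -
  interpret C: prob_space cnormal by (rule prob_space_cnormal)
  let ?S = "\<lambda>x. {z. x / 4 \<le> (cmod z)\<^sup>2 \<and> (cmod z)\<^sup>2 \<le> x}"
  let ?T = "\<lambda>x. {z. (cmod z)\<^sup>2 \<le> x}"
  have [measurable]: "?S x \<in> sets borel" "?T x \<in> sets borel" for x :: real by measurable
  have le1: "\<rho> powr - e \<le> 1" "\<rho> powr - d \<le> 1"
    using assms powr_mono[of "- e" 0 \<rho>] powr_mono[of "- d" 0 \<rho>] by auto
  have S: "x / 4 \<le> measure cnormal (?S x)" and T: "x / 4 \<le> measure cnormal (?T x)"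
    if "0 \<le> x" "x \<le> 1" for x
  proof -
    show "x / 4 \<le> measure cnormal (?S x)" using that by (rule measure_cnormal_annulus_ge)
    also have "\<dots> \<le> measure cnormal (?T x)" by (intro C.finite_measure_mono) auto
    finally show "x / 4 \<le> measure cnormal (?T x)" .
  qed
  have "\<rho> powr (- d - 2 * e) / 64 = \<rho> powr - e / 4 * (\<rho> powr - e / 4) * (\<rho> powr - d / 4)"
  proof -
    have "- d - 2 * e = - e + - e + - d" by simp
    then show ?thesis by (simp only: powr_add)
  qed
  also have "\<dots> \<le> measure cnormal (?S (\<rho> powr - e)) * measure cnormal (?T (\<rho> powr - e)) *
      measure cnormal (?T (\<rho> powr - d))"
    using le1 by (intro mult_mono S T) auto
  also have "\<dots> = measure fading (weak_gains e d \<rho>)"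
    using measure_fading_box[of "?S (\<rho> powr - e)" "?T (\<rho> powr - e)" "?T (\<rho> powr - d)"]
    by (simp add: weak_gains_def conj_assoc)
  finally show ?thesis .
qed

section \<open>Weak gains defeat every code and put static QMF in outage\<close>

lemma cmod_power2_scaled:
  assumes "\<rho> > 0"
  shows "(cmod (z * of_real (\<rho> powr (a / 2))))\<^sup>2 = (cmod z)\<^sup>2 * \<rho> powr a"
proof -
  have "(\<rho> powr (a / 2))\<^sup>2 = \<rho> powr a"
    using assms by (simp add: power2_eq_square powr_add[symmetric])
  then show ?thesis by (simp add: norm_mult power_mult_distrib)
qed

lemma cond_error_weak_gains_ge:
  assumes ok: "relay_code_ok p \<rho> K" and \<rho>: "\<rho> > 1" and d: "d \<le> c"
    and link: "4 * \<rho> powr (c - d) \<le> \<rho> powr (p - e)"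
    and h: "h \<in> weak_gains e d \<rho>"
  shows "1 - 2 * (32 * exp 8 * \<rho> powr ((p + c - d - e) / 2)) ^ blocklen K / real (nmsg K) \<le>
    cond_error p p c \<rho> K h"
proof -
  obtain hsr hrd hsd where h_eq: "h = (hsr, hrd, hsd)" by (cases h)
  define gr gb gd where "gr = hsr * of_real (\<rho> powr (p / 2))"
    and "gb = hrd * of_real (\<rho> powr (p / 2))" and "gd = hsd * of_real (\<rho> powr (c / 2))"
  have gr: "(cmod gr)\<^sup>2 = (cmod hsr)\<^sup>2 * \<rho> powr p" and gb: "(cmod gb)\<^sup>2 = (cmod hrd)\<^sup>2 * \<rho> powr p"
    and gd: "(cmod gd)\<^sup>2 = (cmod hsd)\<^sup>2 * \<rho> powr c"
    using \<rho> by (simp_all add: gr_def gb_def gd_def cmod_power2_scaled)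
  have sr: "\<rho> powr - e / 4 \<le> (cmod hsr)\<^sup>2" "(cmod hsr)\<^sup>2 \<le> \<rho> powr - e"
    and rd: "(cmod hrd)\<^sup>2 \<le> \<rho> powr - e" and sd: "(cmod hsd)\<^sup>2 \<le> \<rho> powr - d"
    using h by (auto simp: weak_gains_def h_eq)
  have scale: "x * \<rho> powr s \<le> \<rho> powr (s - t)" if "x \<le> \<rho> powr - t" for x s t
  proof -
    have "x * \<rho> powr s \<le> \<rho> powr - t * \<rho> powr s" using that by (intro mult_right_mono) auto
    then show ?thesis by (simp add: powr_add[symmetric])
  qed
  have le: "(cmod gr)\<^sup>2 \<le> \<rho> powr (p - e)" "(cmod gb)\<^sup>2 \<le> \<rho> powr (p - e)" "(cmod gd)\<^sup>2 \<le> \<rho> powr (c - d)"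
    unfolding gr gb gd by (intro scale sr rd sd)+
  \<comment> \<open>The 4 in \<open>link\<close> compensates for the inner radius of the annulus,
    which guarantees only a quarter of the nominal strength of the source-relay link.\<close>
  have "\<rho> powr (p - e) / 4 = \<rho> powr - e / 4 * \<rho> powr p" by (simp add: powr_add[symmetric])
  also have "\<dots> \<le> (cmod gr)\<^sup>2" unfolding gr using sr by (intro mult_right_mono) auto
  finally have "(cmod gd)\<^sup>2 \<le> (cmod gr)\<^sup>2" using le link by linarith
  then have gd_gr: "cmod gd \<le> cmod gr" by simp
  have "(cmod gr)\<^sup>2 > 0"
  proof -
    have "0 < \<rho> powr - e / 4 * \<rho> powr p" using \<rho> by simp
    also have "\<dots> \<le> (cmod gr)\<^sup>2" unfolding gr using sr by (intro mult_right_mono) auto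
    finally show ?thesis .
  qed
  then have gr0: "gr \<noteq> 0" by auto
  have "1 \<le> \<rho> powr (c - d)" using \<rho> d by (simp add: ge_one_powr_ge_zero)
  \<comment> \<open>The factor 4 in both bounds secures 4 \<le> C, since the direct link stays at or
    above noise level. It turns the constant 8 of the realization bound into 32.\<close>
  then interpret relay_realization p p c \<rho> K hsr hrd hsd gr gb gd "gd / gr"
      "4 * \<rho> powr (p - e)" "4 * \<rho> powr (c - d)"
    using le gd_gr gr0 link
    by unfold_locales (auto simp: ok gr_def gb_def gd_def norm_divide divide_le_eq_1 intro: order_trans)
  have "sqrt ((4 * \<rho> powr (p - e)) * (4 * \<rho> powr (c - d))) = 4 * \<rho> powr ((p + c - d - e) / 2)"
  proof (rule real_sqrt_unique)
    have "(4 * \<rho> powr ((p + c - d - e) / 2))\<^sup>2 = 16 * \<rho> powr ((p - e) + (c - d))"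
      by (simp add: power2_eq_square powr_add[symmetric] algebra_simps)
    then show "(4 * \<rho> powr ((p + c - d - e) / 2))\<^sup>2 = (4 * \<rho> powr (p - e)) * (4 * \<rho> powr (c - d))"
      by (simp only: powr_add)
  qed simp
  then have "8 * exp 8 * sqrt ((4 * \<rho> powr (p - e)) * (4 * \<rho> powr (c - d))) =
      32 * exp 8 * \<rho> powr ((p + c - d - e) / 2)" by (simp only: mult_ac)
  then show ?thesis using cond_error_ge unfolding n_def h_eq by (simp only:)
qed

text \<open>This is where r \<ge> p / 2 enters: weakening the direct link by the required exponent
  leaves it no weaker than the noise. Weakening it further would not reduce the rate any
  more.\<close>

lemma direct_gain_exponent_le:
  fixes p c r :: real
  assumes "0 \<le> c" "r \<ge> p / 2"
  shows "max 0 (p + c - 2 * r) \<le> c"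
  using assms by auto

lemma eventually_weak_link:
  assumes "c - d < p - e"
  shows "\<forall>\<^sub>F \<rho>::real in at_top. 4 * \<rho> powr (c - d) \<le> \<rho> powr (p - e)"
proof -
  have "\<forall>\<^sub>F \<rho> in at_top. 4 < \<rho> powr (p - e - (c - d))"
    using assms by (intro eventually_less_powr) simp
  then show ?thesis
  proof eventually_elim
    case (elim \<rho>)
    then have "4 * \<rho> powr (c - d) \<le> \<rho> powr (p - e - (c - d)) * \<rho> powr (c - d)"
      by (intro mult_right_mono) auto
    then show ?case by (simp add: powr_add[symmetric])
  qed
qed

text \<open>A third \<open>e\<close> in the exponent buys off the constant 64 and the factor 2,
  which will offset a conditional error of only 1/2.\<close>

lemma eventually_measure_weak_gains:
  assumes "e > 0" "d \<ge> 0"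
  shows "\<forall>\<^sub>F \<rho> in at_top. 2 * \<rho> powr (- d - 3 * e) \<le> measure fading (weak_gains e d \<rho>)"
  using eventually_less_powr[OF assms(1), of 128] eventually_gt_at_top[of 1]
proof eventually_elim
  case (elim \<rho>)
  have "128 * \<rho> powr (- d - 3 * e) \<le> \<rho> powr e * \<rho> powr (- d - 3 * e)"
    using elim by (intro mult_right_mono) auto
  then have "2 * \<rho> powr (- d - 3 * e) \<le> \<rho> powr (- d - 2 * e) / 64"
    by (simp add: powr_add[symmetric] algebra_simps)
  also have "\<dots> \<le> measure fading (weak_gains e d \<rho>)"
    using elim assms by (intro measure_weak_gains_ge) auto
  finally show ?case .
qed

lemma error_prob_lower:
  assumes c: "0 \<le> c" "c < p" and r: "r \<ge> p / 2"
    and ok: "\<And>\<rho>. \<rho> > 1 \<Longrightarrow> relay_code_ok p \<rho> (K \<rho>)"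
    and rate: "has_multiplexing_gain (\<lambda>\<rho>. code_rate (K \<rho>)) r"
    and \<epsilon>: "\<epsilon> > 0"
  shows "\<forall>\<^sub>F \<rho> in at_top. \<rho> powr (- max 0 (p + c - 2 * r) - \<epsilon>) \<le> error_prob p p c \<rho> (K \<rho>)"
proof -
  define d where "d = max 0 (p + c - 2 * r)"
  \<comment> \<open>Three times \<open>e\<close> is the loss in the probability of the weak gains,
    and e < p - c keeps the relay links above the direct one.\<close>
  define e where "e = min (\<epsilon> / 3) ((p - c) / 2)"
  have e: "e > 0" "3 * e \<le> \<epsilon>" "e < p - c" using c \<epsilon> by (auto simp: e_def min_def)
  have d: "0 \<le> d" "d \<le> c" "p + c - d \<le> 2 * r"
    using direct_gain_exponent_le[OF c(1) r] by (auto simp: d_def)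
  have "\<forall>\<^sub>F \<rho> in at_top. 4 * \<rho> powr (c - d) \<le> \<rho> powr (p - e)"
    using d e by (intro eventually_weak_link) auto
  moreover have "\<forall>\<^sub>F \<rho> in at_top. (r - e / 4) * ln \<rho> < code_rate (K \<rho>)"
    using multiplexing_gain_bounds(1)[OF rate, of "e / 4"] e by simp
  moreover have "\<forall>\<^sub>F \<rho> in at_top. 128 * exp 8 < \<rho> powr (e / 4)"
    using e by (intro eventually_less_powr) simp
  moreover have "\<forall>\<^sub>F \<rho> in at_top. 2 * \<rho> powr (- d - 3 * e) \<le> measure fading (weak_gains e d \<rho>)"
    using e d by (intro eventually_measure_weak_gains)
  ultimately show ?thesis
    using eventually_gt_at_top[of 1]
  proof eventually_elim
    case (elim \<rho>)
    interpret H: prob_space fading by (rule prob_space_fading)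
    have ok': "relay_code_ok p \<rho> (K \<rho>)" using elim ok by simp
    define n M where "n = blocklen (K \<rho>)" and "M = nmsg (K \<rho>)"
    have nM: "n > 0" "M > 0" using ok' by (auto simp: relay_code_ok_def n_def M_def)
    have "real n * ((r - e / 4) * ln \<rho>) < ln (real M)"
      using elim(2) nM by (simp add: code_rate_def n_def M_def pos_less_divide_eq mult.commute)
    then have M: "(\<rho> powr (r - e / 4)) ^ n \<le> real M"
    proof -
      assume "real n * ((r - e / 4) * ln \<rho>) < ln (real M)"
      then have "exp (real n * ((r - e / 4) * ln \<rho>)) \<le> exp (ln (real M))" by simp
      then show ?thesis using nM elim(5) by (simp add: powr_def exp_of_nat_mult)
    qed
    \<comment> \<open>The cuts allow at most the exponent r - e / 2, the rate exceeds r - e / 4. The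
      gap beats the constant per symbol and leaves a factor 1/4 per symbol, so that a block of any
      length n \<ge> 1 suffices.\<close>
    have "(32 * exp 8 * \<rho> powr ((p + c - d - e) / 2)) ^ n \<le> (1 / 4 * \<rho> powr (r - e / 4)) ^ n"
    proof (rule power_mono)
      have "32 * exp 8 * \<rho> powr ((p + c - d - e) / 2) \<le> \<rho> powr (e / 4) / 4 * \<rho> powr (r - e / 2)"
        using elim d by (intro mult_mono powr_mono) auto
      also have "\<dots> = 1 / 4 * \<rho> powr (r - e / 4)"
        by (simp add: powr_add[symmetric])
      finally show "32 * exp 8 * \<rho> powr ((p + c - d - e) / 2) \<le> 1 / 4 * \<rho> powr (r - e / 4)" .
    qed auto
    also have "\<dots> = (1 / 4) ^ n * (\<rho> powr (r - e / 4)) ^ n" by (rule power_mult_distrib)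
    also have "\<dots> \<le> 1 / 4 * real M"
      using M nM power_decreasing[of 1 n "1 / 4 :: real"] by (intro mult_mono) auto
    finally have half: "2 * (32 * exp 8 * \<rho> powr ((p + c - d - e) / 2)) ^ n / real M \<le> 1 / 2"
      using nM by (simp add: pos_divide_le_eq)
    have ge: "1 / 2 \<le> cond_error p p c \<rho> (K \<rho>) h" if "h \<in> weak_gains e d \<rho>" for h
      using cond_error_weak_gains_ge[OF ok' elim(5) d(2) elim(1) that] half
      by (simp add: n_def M_def)
    have bnd: "0 \<le> cond_error p p c \<rho> (K \<rho>) h" "cond_error p p c \<rho> (K \<rho>) h \<le> 1" for h
      using nM by (auto intro!: cond_error_bounds simp: M_def)
    note sets = sets_weak_gains[of e d \<rho>]
    have "\<rho> powr (- d - \<epsilon>) \<le> \<rho> powr (- d - 3 * e)" using elim e by (intro powr_mono) auto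
    also have "\<dots> \<le> 1 / 2 * measure fading (weak_gains e d \<rho>)" using elim by simp
    also have "\<dots> = (\<integral>h. 1 / 2 * indicator (weak_gains e d \<rho>) h \<partial>fading)" using sets by simp
    also have "\<dots> \<le> error_prob p p c \<rho> (K \<rho>)"
      unfolding error_prob_def
    proof (rule Bochner_Integration.integral_mono)
      show "integrable fading (cond_error p p c \<rho> (K \<rho>))"
        using bnd by (intro H.integrable_const_bound[where B = 1] measurable_cond_error[OF ok']) auto
      show "integrable fading (\<lambda>h. 1 / 2 * indicator (weak_gains e d \<rho>) h :: real)"
        using sets by (intro integrable_mult_right) (simp add: H.emeasure_eq_measure)
    qed (use ge bnd in \<open>auto simp: indicator_def\<close>)
    finally show ?case by (simp add: d_def)
  qed
qed

text \<open>The event that defeats every code also serves here. The cut-set rate is a minimum, so it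
  is enough that its first term falls below the target rate.\<close>

lemma outage_prob_lower:
  assumes c: "0 \<le> c" "c < p" and r: "r \<ge> p / 2"
    and S: "\<And>\<rho>. \<rho> > 1 \<Longrightarrow> S \<rho> \<in> borel_measurable borel"
    and le: "\<And>\<rho> h. \<rho> > 1 \<Longrightarrow> S \<rho> h \<le> cutset_rate p p c (1/2) \<rho> h"
    and R: "has_multiplexing_gain R r" and \<epsilon>: "\<epsilon> > 0"
  shows "\<forall>\<^sub>F \<rho> in at_top. \<rho> powr (- max 0 (p + c - 2 * r) - \<epsilon>) \<le> measure fading {h. S \<rho> h \<le> R \<rho>}"
proof -
  define d where "d = max 0 (p + c - 2 * r)"
  define e where "e = min (\<epsilon> / 3) ((p - c) / 2)"
  have e: "e > 0" "3 * e \<le> \<epsilon>" "e < p - c" using c \<epsilon> by (auto simp: e_def min_def)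
  have d: "0 \<le> d" "d \<le> c" "p + c - d \<le> 2 * r"
    using direct_gain_exponent_le[OF c(1) r] by (auto simp: d_def)
  have "\<forall>\<^sub>F \<rho> in at_top. (r - e / 4) * ln \<rho> < R \<rho>"
    using multiplexing_gain_bounds(1)[OF R, of "e / 4"] e by simp
  \<comment> \<open>With 1 \<le> C \<le> A the arguments of the two logarithms are at most 3 * A and
    2 * C; their constants multiply to 6.\<close>
  moreover have "\<forall>\<^sub>F \<rho> in at_top. 6 < \<rho> powr (e / 2)"
    using e by (intro eventually_less_powr) simp
  moreover have "\<forall>\<^sub>F \<rho> in at_top. 2 * \<rho> powr (- d - 3 * e) \<le> measure fading (weak_gains e d \<rho>)"
    using e d by (intro eventually_measure_weak_gains)
  ultimately show ?thesis
    using eventually_gt_at_top[of 1]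
  proof eventually_elim
    case (elim \<rho>)
    interpret H: prob_space fading by (rule prob_space_fading)
    define A C where "A = \<rho> powr (p - e)" and "C = \<rho> powr (c - d)"
    have C: "1 \<le> C" "C \<le> A"
      using elim d e by (auto simp: A_def C_def ge_one_powr_ge_zero intro!: powr_mono)
    have sub: "weak_gains e d \<rho> \<subseteq> {h. S \<rho> h \<le> R \<rho>}"
    proof
      fix h assume h: "h \<in> weak_gains e d \<rho>"
      obtain hsr hrd hsd where h_eq: "h = (hsr, hrd, hsd)" by (cases h)
      have "(cmod hsr)\<^sup>2 * \<rho> powr p \<le> \<rho> powr - e * \<rho> powr p"
        using h by (intro mult_right_mono) (auto simp: weak_gains_def h_eq)
      then have sr: "(cmod hsr)\<^sup>2 * \<rho> powr p \<le> A" by (simp add: A_def powr_add[symmetric])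
      have "(cmod hsd)\<^sup>2 * \<rho> powr c \<le> \<rho> powr - d * \<rho> powr c"
        using h by (intro mult_right_mono) (auto simp: weak_gains_def h_eq)
      then have sd: "(cmod hsd)\<^sup>2 * \<rho> powr c \<le> C" by (simp add: C_def powr_add[symmetric])
      have pos: "0 \<le> (cmod hsr)\<^sup>2 * \<rho> powr p" "0 \<le> (cmod hsd)\<^sup>2 * \<rho> powr c" by auto
      have "S \<rho> h \<le> cutset_rate p p c (1/2) \<rho> h" using elim le by simp
      also have "\<dots> \<le> 1/2 * ln (1 + (cmod hsr)\<^sup>2 * \<rho> powr p + (cmod hsd)\<^sup>2 * \<rho> powr c)
            + (1 - 1/2) * ln (1 + (cmod hsd)\<^sup>2 * \<rho> powr c)"
        by (simp only: cutset_rate_def h_eq prod.case min.cobounded1)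
      also have "\<dots> \<le> 1/2 * ln (3 * A) + (1 - 1/2) * ln (2 * C)"
        using C sr sd pos by (intro add_mono mult_left_mono ln_mono) linarith+
      also have "\<dots> = 1/2 * ln (6 * (A * C))"
        using C ln_mult[of "3 * A" "2 * C"] by (simp add: mult_ac)
      also have "\<dots> \<le> 1/2 * ln (\<rho> powr (2 * (r - e / 4)))"
      proof -
        have "A * C = \<rho> powr (p - e + (c - d))" by (simp only: A_def C_def powr_add)
        then have "6 * (A * C) \<le> \<rho> powr (e / 2) * \<rho> powr (p - e + (c - d))"
          using elim by (simp only:) (intro mult_right_mono, auto)
        also have "\<dots> = \<rho> powr (p + c - d - e / 2)" by (simp add: powr_add[symmetric] algebra_simps)
        also have "\<dots> \<le> \<rho> powr (2 * (r - e / 4))" using elim d by (intro powr_mono) auto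
        finally show ?thesis using C by (intro mult_left_mono ln_mono) auto
      qed
      also have "\<dots> = (r - e / 4) * ln \<rho>" using elim by (simp add: ln_powr)
      also have "\<dots> \<le> R \<rho>" using elim by simp
      finally show "h \<in> {h. S \<rho> h \<le> R \<rho>}" by simp
    qed
    have [measurable]: "S \<rho> \<in> borel_measurable fading"
      using S[OF elim(4)] measurable_cong_sets[OF sets_fading refl] by blast
    have m: "{h. S \<rho> h \<le> R \<rho>} \<in> sets fading"
      using measurable_sets[of "S \<rho>" fading borel "{..R \<rho>}"] by (simp add: vimage_def)
    have "\<rho> powr (- d - \<epsilon>) \<le> \<rho> powr (- d - 3 * e)" using elim e by (intro powr_mono) auto
    also have "\<dots> \<le> measure fading (weak_gains e d \<rho>)" using elim(3) by (rule order_trans[rotated]) simp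
    also have "\<dots> \<le> measure fading {h. S \<rho> h \<le> R \<rho>}" by (rule H.finite_measure_mono[OF sub m])
    finally show ?case by (simp add: d_def)
  qed
qed

section \<open>Outage of static QMF is no more likely than the converse requires\<close>

lemma ln_product_le_cut:
  fixes x z u v :: real
  assumes "0 \<le> x" "0 \<le> z" "x * z \<noteq> 0" "x \<le> u" "z \<le> v"
  shows "1/2 * ln (x * z) \<le> 1/2 * ln (1 + u) + 1/2 * ln (1 + v)"
proof -
  have "x \<noteq> 0" "z \<noteq> 0" using assms(3) by auto
  with assms(1,2) have pos: "x > 0" "z > 0" "0 < x * z" by simp_all
  have "x * z \<le> (1 + u) * (1 + v)" using assms by (intro mult_mono) auto
  then have "ln (x * z) \<le> ln ((1 + u) * (1 + v))" using pos by (intro ln_mono)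
  also have "\<dots> = ln (1 + u) + ln (1 + v)" using pos assms by (simp add: ln_mult)
  finally show ?thesis by simp
qed

text \<open>Each cut carries the product of one relay link with the direct link.\<close>

lemma cutset_rate_ge:
  assumes "\<rho> > 1" and h: "h = (hsr, hrd, hsd)" and le: "cutset_rate p p c (1/2) \<rho> h \<le> x"
    and t: "t = exp (2 * x) / \<rho> powr (p + c)"
  shows "(cmod hsr)\<^sup>2 * (cmod hsd)\<^sup>2 \<le> t \<or> (cmod hrd)\<^sup>2 * (cmod hsd)\<^sup>2 \<le> t"
proof -
  define Z where "Z = (cmod hsd)\<^sup>2 * \<rho> powr c"
  have Z: "0 \<le> Z" by (simp add: Z_def)
  have key: "Y * (cmod hsd)\<^sup>2 \<le> t"
    if "0 \<le> Y" "Y * \<rho> powr p \<le> u" "1/2 * ln (1 + u) + 1/2 * ln (1 + Z) \<le> x" for Y u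
  proof (cases "Y * \<rho> powr p * Z = 0")
    \<comment> \<open>A vanishing product is treated apart, since \<open>ln 0\<close> does not stand
      for minus infinity.\<close>
    case True
    then have "Y * (cmod hsd)\<^sup>2 = 0" using assms(1) by (auto simp: Z_def)
    then show ?thesis by (simp only: t) simp
  next
    case False
    then have "1/2 * ln (Y * \<rho> powr p * Z) \<le> x"
      using ln_product_le_cut[of "Y * \<rho> powr p" Z u Z] that Z by (auto intro: order_trans)
    moreover have "Y * \<rho> powr p * Z > 0" using False that Z by (auto simp: less_le)
    ultimately have "Y * \<rho> powr p * Z \<le> exp (2 * x)"
      by (subst ln_le_cancel_iff[symmetric]) simp_all
    then have "Y * (cmod hsd)\<^sup>2 * \<rho> powr (p + c) \<le> exp (2 * x)"
      by (simp add: Z_def powr_add mult_ac)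
    then show ?thesis using assms(1) by (simp add: t pos_le_divide_eq)
  qed
  have sq: "(cmod hrd * \<rho> powr (p / 2))\<^sup>2 = (cmod hrd)\<^sup>2 * \<rho> powr p"
    using cmod_power2_scaled[of \<rho> hrd p] assms(1) by (simp add: norm_mult)
  consider "1/2 * ln (1 + (cmod hsr)\<^sup>2 * \<rho> powr p + Z) + (1 - 1/2) * ln (1 + Z) \<le> x"
    | "1/2 * ln (1 + Z) + (1 - 1/2) * ln (1 + (cmod hrd * \<rho> powr (p / 2) + cmod hsd * \<rho> powr (c / 2))\<^sup>2) \<le> x"
    using le unfolding cutset_rate_def h prod.case min_le_iff_disj Z_def by blast
  then show ?thesis
  proof cases
    case 1
    then have "(cmod hsr)\<^sup>2 * (cmod hsd)\<^sup>2 \<le> t"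
      using Z by (intro key[of _ "(cmod hsr)\<^sup>2 * \<rho> powr p + Z"]) (auto simp: add.assoc)
    then show ?thesis ..
  next
    case 2
    have "(cmod hrd * \<rho> powr (p / 2))\<^sup>2 \<le> (cmod hrd * \<rho> powr (p / 2) + cmod hsd * \<rho> powr (c / 2))\<^sup>2"
      by (intro power_mono) auto
    then have "(cmod hrd)\<^sup>2 * (cmod hsd)\<^sup>2 \<le> t"
      using 2 by (intro key[of _ "(cmod hrd * \<rho> powr (p / 2) + cmod hsd * \<rho> powr (c / 2))\<^sup>2"]) (auto simp: sq add.commute)
    then show ?thesis ..
  qed
qed

lemma outage_prob_upper:
  assumes ge: "\<And>\<rho> h. \<rho> > 1 \<Longrightarrow> cutset_rate p p c (1/2) \<rho> h - \<kappa> \<le> S \<rho> h"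
    and R: "has_multiplexing_gain R r" and \<epsilon>: "\<epsilon> > 0"
  shows "\<forall>\<^sub>F \<rho> in at_top. measure fading {h. S \<rho> h \<le> R \<rho>} \<le> \<rho> powr (- max 0 (p + c - 2 * r) + \<epsilon>)"
proof -
  interpret H: prob_space fading by (rule prob_space_fading)
  define d where "d = max 0 (p + c - 2 * r)"
  show ?thesis
  proof (cases "\<epsilon> \<ge> d")
    case True
    show ?thesis
      using eventually_gt_at_top[of 1]
    proof eventually_elim
      case (elim \<rho>)
      have "measure fading {h. S \<rho> h \<le> R \<rho>} \<le> 1" by (rule H.prob_le_1)
      also have "\<dots> \<le> \<rho> powr (- d + \<epsilon>)" using elim True by (intro ge_one_powr_ge_zero) auto
      finally show ?case by (simp add: d_def)
    qed
  next
    case False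
    then have d: "d = p + c - 2 * r" "d > \<epsilon>" using \<epsilon> by (auto simp: d_def max_def split: if_splits)
    \<comment> \<open>The staircase with \<open>N\<close> steps loses d / N in the exponent. The
      allowance \<epsilon> is spent as \<epsilon> / 4 on rate slack and \<kappa>, \<epsilon> / 4 on
      this loss, and \<epsilon> / 2 on the constant 2 * (N + 2).\<close>
    obtain N :: nat where N: "N > 0" "d / N \<le> \<epsilon> / 4"
    proof -
      obtain N :: nat where "4 * d / \<epsilon> < real N" using reals_Archimedean2 by blast
      moreover have "0 < 4 * d / \<epsilon>" using d \<epsilon> by simp
      ultimately have N: "real N > 0" and "4 * d / \<epsilon> < real N" by linarith+
      then have "4 * d < real N * \<epsilon>" using \<epsilon> by (simp only: pos_divide_less_eq)
      with N have "d / N \<le> \<epsilon> / 4" by (simp add: pos_divide_le_eq mult_ac)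
      with N show ?thesis by (intro that) auto
    qed
    have "\<forall>\<^sub>F \<rho> in at_top. R \<rho> < (r + \<epsilon> / 16) * ln \<rho>"
      using \<epsilon> by (intro multiplexing_gain_bounds(2)[OF R]) simp
    moreover have "\<forall>\<^sub>F \<rho> in at_top. 16 * \<kappa> / \<epsilon> < ln \<rho>" by (rule eventually_less_ln)
    moreover have "\<forall>\<^sub>F \<rho> in at_top. 2 * (real N + 2) < \<rho> powr (\<epsilon> / 2)"
      using \<epsilon> by (intro eventually_less_powr) simp
    ultimately show ?thesis
      using eventually_gt_at_top[of 1]
    proof eventually_elim
      case (elim \<rho>)
      \<comment> \<open>The threshold for the products of gains: doubling the rate slack \<epsilon>
        / 16 and an equal share for \<kappa> gives \<epsilon> / 4.\<close>
      define t where "t = \<rho> powr (- d + \<epsilon> / 4)"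
      have t: "0 < t" "t \<le> 1" using elim d \<epsilon> powr_mono[of "- d + \<epsilon> / 4" 0 \<rho>] by (auto simp: t_def)
      define x where "x = R \<rho> + \<kappa>"
      have "x \<le> (r + \<epsilon> / 8) * ln \<rho>"
        using elim(1,2) \<epsilon> by (simp add: x_def field_simps)
      then have "exp (2 * x) \<le> exp ((2 * r + \<epsilon> / 4) * ln \<rho>)" by (simp add: algebra_simps)
      also have "\<dots> = t * \<rho> powr (p + c)"
        using elim by (simp add: t_def powr_add[symmetric] d(1)) (simp add: powr_def)
      finally have xt: "exp (2 * x) / \<rho> powr (p + c) \<le> t" using elim by (simp add: pos_divide_le_eq)
      let ?A = "{h. (cmod (fst h))\<^sup>2 * (cmod (snd (snd h)))\<^sup>2 \<le> t}"
      let ?B = "{h. (cmod (fst (snd h)))\<^sup>2 * (cmod (snd (snd h)))\<^sup>2 \<le> t}"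
      note [measurable] = measurable_cmod_power2
      have "{h \<in> space fading. (cmod (fst h))\<^sup>2 * (cmod (snd (snd h)))\<^sup>2 \<le> t} \<in> sets fading"
        "{h \<in> space fading. (cmod (fst (snd h)))\<^sup>2 * (cmod (snd (snd h)))\<^sup>2 \<le> t} \<in> sets fading"
        by measurable
      then have m: "?A \<in> sets fading" "?B \<in> sets fading" by simp_all
      have "{h. S \<rho> h \<le> R \<rho>} \<subseteq> ?A \<union> ?B"
      proof
        fix h assume "h \<in> {h. S \<rho> h \<le> R \<rho>}"
        then have le: "cutset_rate p p c (1/2) \<rho> h \<le> x" using ge[OF elim(4), of h] by (simp add: x_def)
        obtain hsr hrd hsd where h: "h = (hsr, hrd, hsd)" by (cases h)
        from cutset_rate_ge[OF elim(4) h le refl] show "h \<in> ?A \<union> ?B" using xt by (auto simp: h)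
      qed
      then have "measure fading {h. S \<rho> h \<le> R \<rho>} \<le> measure fading (?A \<union> ?B)"
        using m by (intro H.finite_measure_mono) auto
      also have "\<dots> \<le> measure fading ?A + measure fading ?B" using m by (intro measure_Un_le)
      also have "\<dots> \<le> (real N + 2) * t powr (1 - 1 / real N) + (real N + 2) * t powr (1 - 1 / real N)"
        using t N by (intro add_mono measure_fading_small_product_le) auto
      also have "\<dots> = 2 * (real N + 2) * t powr (1 - 1 / real N)" by simp
      also have "t powr (1 - 1 / real N) \<le> \<rho> powr (- d + \<epsilon> / 2)"
      proof -
        have "(- d + \<epsilon> / 4) * (1 - 1 / real N) = - d + \<epsilon> / 4 + d / N - \<epsilon> / 4 / N"
          using N by (simp add: field_simps)
        also have "\<dots> \<le> - d + \<epsilon> / 2"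
        proof -
          have "\<epsilon> / 4 / N \<ge> 0" using \<epsilon> by simp
          then show ?thesis using N(2) by linarith
        qed
        finally show ?thesis using elim by (simp add: t_def powr_powr)
      qed
      then have "2 * (real N + 2) * t powr (1 - 1 / real N) \<le> \<rho> powr (\<epsilon> / 2) * \<rho> powr (- d + \<epsilon> / 2)"
        using elim by (intro mult_mono) auto
      also have "\<dots> = \<rho> powr (- d + \<epsilon>)" by (simp add: powr_add[symmetric])
      finally show ?case by (simp add: d_def)
    qed
  qed
qed

section \<open>The optimal tradeoff and the conclusion\<close>

lemma is_qmf_rateD:
  assumes "is_qmf_rate a b c S"
  shows "qmf_supports a b c S" "\<And>\<rho>. \<rho> > 1 \<Longrightarrow> S \<rho> \<in> borel_measurable borel"
    "\<And>\<rho> h. \<rho> > 1 \<Longrightarrow> S \<rho> h \<le> cutset_rate a b c (1/2) \<rho> h"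
  using assms unfolding is_qmf_rate_def by blast+

text \<open>One code per \<rho> is chosen at rate about r * ln \<rho>, with additive tolerance
  \<rho> powr - d so that the tolerance does not lower the exponent. The outage bound gives one half
  of the limit; the converse, applied to these very codes, gives the other.\<close>

lemma qmf_achieves_dmt:
  assumes c: "0 \<le> c" "c < p" and r: "r \<ge> p / 2" and S: "is_qmf_rate p p c S"
  shows "achieves_dmt p p c r (ereal (max 0 (p + c - 2 * r)))"
proof -
  define d where "d = max 0 (p + c - 2 * r)"
  have r0: "r \<ge> 0" using c r by simp
  have "\<forall>\<rho>. \<exists>K. \<rho> > 1 \<longrightarrow> relay_code_ok p \<rho> K \<and> \<bar>code_rate K - r * ln \<rho>\<bar> \<le> 1 \<and>
      error_prob p p c \<rho> K \<le> measure fading {h. S \<rho> h \<le> r * ln \<rho>} + \<rho> powr - d"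
  proof
    fix \<rho> :: real
    show "\<exists>K. \<rho> > 1 \<longrightarrow> relay_code_ok p \<rho> K \<and> \<bar>code_rate K - r * ln \<rho>\<bar> \<le> 1 \<and>
      error_prob p p c \<rho> K \<le> measure fading {h. S \<rho> h \<le> r * ln \<rho>} + \<rho> powr - d"
    proof (cases "\<rho> > 1")
      case True
      then show ?thesis
        using qmf_good_code[OF is_qmf_rateD(1,2)[OF S], of \<rho> "r * ln \<rho>" "\<rho> powr - d"] r0 by auto
    qed simp
  qed
  then obtain K where K: "\<And>\<rho>. \<rho> > 1 \<Longrightarrow> relay_code_ok p \<rho> (K \<rho>)"
      "\<And>\<rho>. \<rho> > 1 \<Longrightarrow> \<bar>code_rate (K \<rho>) - r * ln \<rho>\<bar> \<le> 1"
      "\<And>\<rho>. \<rho> > 1 \<Longrightarrow> error_prob p p c \<rho> (K \<rho>) \<le> measure fading {h. S \<rho> h \<le> r * ln \<rho>} + \<rho> powr - d"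
    by metis
  have rate: "has_multiplexing_gain (\<lambda>\<rho>. code_rate (K \<rho>)) r"
    unfolding has_multiplexing_gain_def
  proof (rule tendstoI)
    fix e :: real assume e: "e > 0"
    show "\<forall>\<^sub>F \<rho> in at_top. dist (code_rate (K \<rho>) / ln \<rho>) r < e"
      using eventually_less_ln[of "1 / e"] eventually_gt_at_top[of 1]
    proof eventually_elim
      case (elim \<rho>)
      then have ln: "ln \<rho> > 0" by simp
      have "dist (code_rate (K \<rho>) / ln \<rho>) r = \<bar>code_rate (K \<rho>) - r * ln \<rho>\<bar> / ln \<rho>"
        using ln by (simp add: dist_real_def field_simps)
      also have "\<dots> \<le> 1 / ln \<rho>" using K(2)[OF elim(2)] ln by (intro divide_right_mono) auto
      also have "\<dots> < e" using elim(1) ln e by (simp add: field_simps)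
      finally show ?case .
    qed
  qed
  have gain: "has_multiplexing_gain (\<lambda>\<rho>. r * ln \<rho>) r"
    unfolding has_multiplexing_gain_def
    by (rule tendsto_eventually, rule eventually_mono[OF eventually_less_ln[of 0]]) simp
  obtain \<kappa> where \<kappa>: "\<And>\<rho> h. \<rho> > 1 \<Longrightarrow> cutset_rate p p c (1/2) \<rho> h - \<kappa> \<le> S \<rho> h"
    using S unfolding is_qmf_rate_def by blast
  have "has_diversity_gain (\<lambda>\<rho>. error_prob p p c \<rho> (K \<rho>)) (ereal d)"
  proof (rule has_diversity_gainI)
    fix \<epsilon> :: real assume \<epsilon>: "\<epsilon> > 0"
    show "\<forall>\<^sub>F \<rho> in at_top. \<rho> powr (- d - \<epsilon>) \<le> error_prob p p c \<rho> (K \<rho>)"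
      unfolding d_def by (rule error_prob_lower[OF c r K(1) rate \<epsilon>])
    have "\<forall>\<^sub>F \<rho> in at_top. measure fading {h. S \<rho> h \<le> r * ln \<rho>} \<le> \<rho> powr (- d + \<epsilon> / 2)"
      unfolding d_def using \<epsilon> by (intro outage_prob_upper[OF \<kappa> gain]) auto
    moreover have "\<forall>\<^sub>F \<rho> in at_top. 2 < \<rho> powr (\<epsilon> / 2)"
      using \<epsilon> by (intro eventually_less_powr) simp
    ultimately show "\<forall>\<^sub>F \<rho> in at_top. error_prob p p c \<rho> (K \<rho>) \<le> \<rho> powr (- d + \<epsilon>)"
      using eventually_gt_at_top[of 1]
    proof eventually_elim
      case (elim \<rho>)
      have "\<rho> powr - d \<le> \<rho> powr (- d + \<epsilon> / 2)" using elim \<epsilon> by (intro powr_mono) auto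
      then have "error_prob p p c \<rho> (K \<rho>) \<le> 2 * \<rho> powr (- d + \<epsilon> / 2)"
        using K(3)[OF elim(3)] elim(1) by linarith
      also have "\<dots> \<le> \<rho> powr (\<epsilon> / 2) * \<rho> powr (- d + \<epsilon> / 2)"
        using elim by (intro mult_right_mono) auto
      also have "\<dots> = \<rho> powr (- d + \<epsilon>)" by (simp add: powr_add[symmetric])
      finally show ?case .
    qed
  qed
  then show ?thesis unfolding achieves_dmt_def d_def using K(1) rate by blast
qed

text \<open>The supremum is attained: the QMF rate in the hypotheses yields codes that reach the
  value, and the converse excludes anything larger, infinity included.\<close>

lemma optimal_dmt_eq:
  assumes "0 \<le> c" "c < p" "r \<ge> p / 2" "is_qmf_rate p p c S"
  shows "optimal_dmt p p c r = ereal (max 0 (p + c - 2 * r))"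
  unfolding optimal_dmt_def
proof (rule Sup_eqI)
  fix d' assume "d' \<in> {d. achieves_dmt p p c r d}"
  then obtain K where K: "\<And>\<rho>. \<rho> > 1 \<Longrightarrow> relay_code_ok p \<rho> (K \<rho>)"
      "has_multiplexing_gain (\<lambda>\<rho>. code_rate (K \<rho>)) r"
      "has_diversity_gain (\<lambda>\<rho>. error_prob p p c \<rho> (K \<rho>)) d'"
    by (auto simp: achieves_dmt_def)
  show "d' \<le> ereal (max 0 (p + c - 2 * r))"
    by (rule has_diversity_gain_le[OF K(3) error_prob_lower[OF assms(1-3) K(1,2)]])
next
  fix y assume "\<And>d. d \<in> {d. achieves_dmt p p c r d} \<Longrightarrow> d \<le> y"
  then show "ereal (max 0 (p + c - 2 * r)) \<le> y" using qmf_achieves_dmt[OF assms] by blast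
qed

theorem lemma5:
  fixes p c r :: real
    and R_QMF :: "real \<Rightarrow> gains \<Rightarrow> real"
    and R :: "real \<Rightarrow> real"
  assumes "0 \<le> c" and "c < p"
    and "r \<ge> p / 2"
    and "is_qmf_rate p p c R_QMF"
    and "has_multiplexing_gain R r"
  shows "has_diversity_gain (\<lambda>\<rho>. measure fading {h. R_QMF \<rho> h \<le> R \<rho>}) (optimal_dmt p p c r)"
proof -
  obtain \<kappa> where \<kappa>: "\<And>\<rho> h. \<rho> > 1 \<Longrightarrow> cutset_rate p p c (1/2) \<rho> h - \<kappa> \<le> R_QMF \<rho> h"
    using assms(4) unfolding is_qmf_rate_def by blast
  show ?thesis
    unfolding optimal_dmt_eq[OF assms(1-4)]
    by (intro has_diversity_gainI outage_prob_upper[OF \<kappa> assms(5)]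
      outage_prob_lower[OF assms(1-3) is_qmf_rateD(2,3)[OF assms(4)] assms(5)])
qed

end
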